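(* Let $(\mathcal V,\mathcal E)$ be a finite connected directed graph with at least one boundary vertex ($\mathcal V_\partial\neq\emptyset$), with edge lengths $0<l^e<\infty$ for $e\in\mathcal E$, let $a,b,c\in L^2(\mathcal E)$ satisfy $C_0\le a,b,c\le C_1$ a.e. on $\mathcal E$ for some constants $C_0,C_1>0$, and let $T>0$. Then for all $u_0\in H(\mathrm{div})$, $p_0\in H^1_0$ and $f,g\in W^{1,1}(0,T;L^2(\mathcal E))$ there exists a unique $$(u,p)\in C^1([0,T];L^2\times L^2)\cap C([0,T];H(\mathrm{div})\times H^1_0)$$ such that $$c\,\partial_t u+\partial_x' p+a u=f,\qquad b\,\partial_t p+\partial_x' u=g\qquad\text{on }\mathcal E,\ t>0,\qquad u(0)=u_0,\quad p(0)=p_0,$$ (the coupling and boundary conditions at the vertices being contained in the definition of $H(\mathrm{div})$ and $H^1_0$). Moreover, the norm of $(u,p)$ in this solution space is bounded by a constant, independent of the data, times the norm of the data: $\|u_0\|_{H(\mathrm{div})}+\|p_0\|_{H^1}+\|f\|_{W^{1,1}(0,T;L^2)}+\|g\|_{W^{1,1}(0,T;L^2)}$.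
   Context: Network notation: $\mathcal E\subset\mathcal V\times\mathcal V$, the two end vertices of each edge being distinct; connectedness ignores edge orientation. $\mathcal E(v)$ is the set of edges having $v$ as an end vertex; $\mathcal V_0=\{v:|\mathcal E(v)|\ge2\}$ are the interior vertices and $\mathcal V_\partial=\mathcal V\setminus\mathcal V_0$ the boundary vertices. For $e\in\mathcal E$: $n^e(v)=-1$ if $e=(v,\cdot)$, $n^e(v)=1$ if $e=(\cdot,v)$, and $n^e(v)=0$ otherwise. Each edge $e=(v_l,v_r)$ is identified with the interval $[0,l^e]$, $v_l$ with $0$ and $v_r$ with $l^e$; for a function $w$ on the network, $w^e=w|_e$ and $w^e(v)$ is the value (trace) of $w^e$ at the endpoint corresponding to $v$. Function spaces: $L^2=L^2(\mathcal E)=\{w: w^e\in L^2(e)\ \forall e\}$ with $(w,z)_{\mathcal E}=\sum_e(w^e,z^e)_{L^2(e)}$ and norm $\|\cdot\|_{L^2}$; $H^1(\mathcal E)=\{w: w^e\in H^1(e)\ \forall e\}$; $\partial_x' w$ is the edgewise derivative, $(\partial_x' w)|_e=\partial_x w^e$. $H^1_0=\{p\in H^1(\mathcal E): p^e(v)=p^{e'}(v)\ \forall e,e'\in\mathcal E(v),v\in\mathcal V_0;\ p^e(v)=0\ \forall v\in\mathcal V_\partial, e\in\mathcal E(v)\}$. $H(\mathrm{div})=\{u\in H^1(\mathcal E):\sum_{e\in\mathcal E(v)}n^e(v)u^e(v)=0\ \forall v\in\mathcal V_0\}$. Both carry the norm $(\|w\|_{L^2}^2+\|\partial_x' w\|_{L^2}^2)^{1/2}$,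 written $\|\cdot\|_{H^1}$ and $\|\cdot\|_{H(\mathrm{div})}$ respectively. *)

theory Defs
  imports "HOL-Analysis.Analysis"
begin

section \<open>The Hilbert space of square integrable functions\<close>

definition square_integrable :: "(real \<Rightarrow> real) \<Rightarrow> bool" where
  "square_integrable f \<longleftrightarrow> f \<in> borel_measurable borel \<and> integrable lborel (\<lambda>x. (f x)\<^sup>2)"

definition L2_rel :: "(real \<Rightarrow> real) \<Rightarrow> (real \<Rightarrow> real) \<Rightarrow> bool" where
  "L2_rel f g \<longleftrightarrow> square_integrable f \<and> square_integrable g \<and> (AE x in lborel. f x = g x)"

lemma square_integrable_zero: "square_integrable (\<lambda>x. 0)"
  by (simp add: square_integrable_def)

lemma square_integrable_measurable [measurable_dest]:
  "square_integrable f \<Longrightarrow> f \<in> borel_measurable borel"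
  by (simp add: square_integrable_def)

text \<open>
  \<open>L2\<close> is the Hilbert space $L^2(\mathbb R)$ of classes modulo equality almost everywhere
  (every class of Lebesgue measurable functions has a Borel representative). \<open>rep_L2\<close> picks
  some representative, so only statements about it that hold almost everywhere are meaningful.
\<close>

quotient_type L2 = "real \<Rightarrow> real" / partial: L2_rel
proof (rule part_equivpI)
  show "\<exists>f. L2_rel f f"
    using square_integrable_zero by (auto simp: L2_rel_def)
  show "symp L2_rel"
    by (auto simp: L2_rel_def symp_def eq_commute)
  show "transp L2_rel"
    unfolding transp_def L2_rel_def by (auto elim: eventually_elim2)
qed

lemma square_integrable_rep [simp, intro]: "square_integrable (rep_L2 u)"
  using Quotient3_rep_reflp[OF Quotient3_L2, of u] by (simp add: L2_rel_def)

lemma rep_L2_measurable [measurable]: "rep_L2 u \<in> borel_measurable borel"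
  using square_integrable_rep by (rule square_integrable_measurable)

lemma abs_rep_L2 [simp]: "abs_L2 (rep_L2 u) = u"
  by (rule Quotient3_abs_rep[OF Quotient3_L2])

lemma AE_rep_abs: "square_integrable f \<Longrightarrow> AE x in lborel. rep_L2 (abs_L2 f) x = f x"
  using Quotient3_rep_abs[OF Quotient3_L2, of f] by (simp add: L2_rel_def)

lemma abs_L2_eqI:
  "square_integrable f \<Longrightarrow> square_integrable g \<Longrightarrow> AE x in lborel. f x = g x \<Longrightarrow> abs_L2 f = abs_L2 g"
  using Quotient3_rel_abs[OF Quotient3_L2, of f g] by (simp add: L2_rel_def)

lemma L2_eqI: "AE x in lborel. rep_L2 u x = rep_L2 v x \<Longrightarrow> u = v"
  using abs_L2_eqI[of "rep_L2 u" "rep_L2 v"] by simp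

lemma square_integrable_bound:
  assumes "square_integrable h" "f \<in> borel_measurable borel"
    "AE x in lborel. \<bar>f x\<bar> \<le> \<bar>h x\<bar>"
  shows "square_integrable f"
  unfolding square_integrable_def
proof (intro conjI assms)
  show "integrable lborel (\<lambda>x. (f x)\<^sup>2)"
  proof (rule Bochner_Integration.integrable_bound[where f="\<lambda>x. (h x)\<^sup>2"])
    show "AE x in lborel. norm ((f x)\<^sup>2) \<le> norm ((h x)\<^sup>2)"
      using assms(3) by eventually_elim (simp add: abs_le_square_iff)
  qed (use assms in \<open>simp_all add: square_integrable_def\<close>)
qed

lemma integrable_mult_L2:
  assumes "square_integrable f" "square_integrable g"
  shows "integrable lborel (\<lambda>x. f x * g x)"
proof (rule Bochner_Integration.integrable_bound[where f="\<lambda>x. (f x)\<^sup>2 + (g x)\<^sup>2"])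
  show "integrable lborel (\<lambda>x. (f x)\<^sup>2 + (g x)\<^sup>2)"
    using assms by (simp add: square_integrable_def)
  have "\<bar>f x * g x\<bar> \<le> (f x)\<^sup>2 + (g x)\<^sup>2" for x
  proof -
    have "2 * \<bar>f x\<bar> * \<bar>g x\<bar> \<le> (f x)\<^sup>2 + (g x)\<^sup>2"
      using sum_squares_bound[of "\<bar>f x\<bar>" "\<bar>g x\<bar>"] by simp
    moreover have "0 \<le> \<bar>f x\<bar> * \<bar>g x\<bar>" by simp
    ultimately show ?thesis unfolding abs_mult by linarith
  qed
  then show "AE x in lborel. norm (f x * g x) \<le> norm ((f x)\<^sup>2 + (g x)\<^sup>2)"
    by (intro AE_I2) (simp add: abs_mult)
qed (use assms in measurable)

lemma square_integrable_scale: "square_integrable f \<Longrightarrow> square_integrable (\<lambda>x. c * f x)"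
  by (auto simp: square_integrable_def power_mult_distrib)

lemma square_integrable_add:
  assumes "square_integrable f" "square_integrable g"
  shows "square_integrable (\<lambda>x. f x + g x)"
  using assms integrable_mult_L2[OF assms]
  by (auto simp: square_integrable_def power2_sum mult.assoc)

lemma square_integrable_minus:
  "square_integrable f \<Longrightarrow> square_integrable (\<lambda>x. - f x)"
  by (auto simp: square_integrable_def)

lemma square_integrable_diff:
  assumes "square_integrable f" "square_integrable g"
  shows "square_integrable (\<lambda>x. f x - g x)"
  using square_integrable_add[OF assms(1) square_integrable_minus[OF assms(2)]] by simp

lemma square_integrable_abs:
  "square_integrable f \<Longrightarrow> square_integrable (\<lambda>x. \<bar>f x\<bar>)"
  by (auto simp: square_integrable_def)

instantiation L2 :: real_inner
begin

definition zero_L2 :: L2 where "0 = abs_L2 (\<lambda>x. 0)"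
definition plus_L2 :: "L2 \<Rightarrow> L2 \<Rightarrow> L2" where
  "u + v = abs_L2 (\<lambda>x. rep_L2 u x + rep_L2 v x)"
definition minus_L2 :: "L2 \<Rightarrow> L2 \<Rightarrow> L2" where
  "u - v = abs_L2 (\<lambda>x. rep_L2 u x - rep_L2 v x)"
definition uminus_L2 :: "L2 \<Rightarrow> L2" where
  "- u = abs_L2 (\<lambda>x. - rep_L2 u x)"
definition scaleR_L2 :: "real \<Rightarrow> L2 \<Rightarrow> L2" where
  "scaleR r u = abs_L2 (\<lambda>x. r * rep_L2 u x)"
definition inner_L2 :: "L2 \<Rightarrow> L2 \<Rightarrow> real" where
  "inner u v = (LINT x|lborel. rep_L2 u x * rep_L2 v x)"
definition norm_L2 :: "L2 \<Rightarrow> real" where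
  "norm (u :: L2) = sqrt (inner u u)"
definition sgn_L2 :: "L2 \<Rightarrow> L2" where
  "sgn (u :: L2) = inverse (norm u) *\<^sub>R u"
definition dist_L2 :: "L2 \<Rightarrow> L2 \<Rightarrow> real" where
  "dist (u :: L2) v = norm (u - v)"
definition uniformity_L2 :: "(L2 \<times> L2) filter" where
  "uniformity = (INF e\<in>{0<..}. principal {(x :: L2, y). dist x y < e})"
definition open_L2 :: "L2 set \<Rightarrow> bool" where
  "open (U :: L2 set) \<longleftrightarrow> (\<forall>x\<in>U. eventually (\<lambda>(x', y). x' = x \<longrightarrow> y \<in> U) uniformity)"

lemma AE_rep_zero: "AE x in lborel. rep_L2 0 x = 0"
  unfolding zero_L2_def by (rule AE_rep_abs[OF square_integrable_zero])

lemma AE_rep_plus: "AE x in lborel. rep_L2 (u + v) x = rep_L2 u x + rep_L2 v x"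
  unfolding plus_L2_def by (rule AE_rep_abs) (auto intro: square_integrable_add)

lemma AE_rep_diff: "AE x in lborel. rep_L2 (u - v) x = rep_L2 u x - rep_L2 v x"
  unfolding minus_L2_def by (rule AE_rep_abs) (auto intro: square_integrable_diff)

lemma AE_rep_uminus: "AE x in lborel. rep_L2 (- u) x = - rep_L2 u x"
  unfolding uminus_L2_def by (rule AE_rep_abs) (auto intro: square_integrable_minus)

lemma AE_rep_scaleR: "AE x in lborel. rep_L2 (r *\<^sub>R u) x = r * rep_L2 u x"
  unfolding scaleR_L2_def by (rule AE_rep_abs) (auto intro: square_integrable_scale)

lemma inner_L2_cong:
  assumes "AE x in lborel. rep_L2 u x = f x" "AE x in lborel. rep_L2 v x = g x"
    "f \<in> borel_measurable borel" "g \<in> borel_measurable borel"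
  shows "inner u v = (LINT x|lborel. f x * g x)"
  unfolding inner_L2_def
proof (rule integral_cong_AE)
  show "AE x in lborel. rep_L2 u x * rep_L2 v x = f x * g x"
    using assms(1,2) by eventually_elim simp
qed (use assms(3,4) in measurable)

instance
proof
  fix u v w :: L2 and r s :: real
  show "u + v + w = u + (v + w)"
    using AE_rep_plus[of "u + v" w] AE_rep_plus[of u v] AE_rep_plus[of u "v + w"] AE_rep_plus[of v w]
    by (intro L2_eqI, eventually_elim) simp
  show "u + v = v + u"
    using AE_rep_plus[of u v] AE_rep_plus[of v u]
    by (intro L2_eqI, eventually_elim) simp
  show "0 + u = u"
    using AE_rep_plus[of 0 u] AE_rep_zero
    by (intro L2_eqI, eventually_elim) simp
  show "- u + u = 0"
    using AE_rep_plus[of "- u" u] AE_rep_zero AE_rep_uminus[of u]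
    by (intro L2_eqI, eventually_elim) simp
  show "u - v = u + - v"
    using AE_rep_plus[of u "- v"] AE_rep_diff[of u v] AE_rep_uminus[of v]
    by (intro L2_eqI, eventually_elim) simp
  show "r *\<^sub>R (u + v) = r *\<^sub>R u + r *\<^sub>R v"
    using AE_rep_plus[of u v] AE_rep_plus[of "r *\<^sub>R u" "r *\<^sub>R v"] AE_rep_scaleR[of r u]
      AE_rep_scaleR[of r v] AE_rep_scaleR[of r "u + v"]
    by (intro L2_eqI, eventually_elim) (simp add: algebra_simps)
  show "(r + s) *\<^sub>R u = r *\<^sub>R u + s *\<^sub>R u"
    using AE_rep_plus[of "r *\<^sub>R u" "s *\<^sub>R u"] AE_rep_scaleR[of r u]
      AE_rep_scaleR[of s u] AE_rep_scaleR[of "r + s" u]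
    by (intro L2_eqI, eventually_elim) (simp add: algebra_simps)
  show "r *\<^sub>R s *\<^sub>R u = (r * s) *\<^sub>R u"
    using AE_rep_scaleR[of r "s *\<^sub>R u"] AE_rep_scaleR[of s u] AE_rep_scaleR[of "r * s" u]
    by (intro L2_eqI, eventually_elim) simp
  show "1 *\<^sub>R u = u"
    using AE_rep_scaleR[of 1 u] by (intro L2_eqI, eventually_elim) simp
  show "dist u v = norm (u - v)" "sgn u = inverse (norm u) *\<^sub>R u"
    by (simp_all add: dist_L2_def sgn_L2_def)
  show "uniformity = (INF e\<in>{0<..}. principal {(x, y :: L2). dist x y < e})"
    by (simp add: uniformity_L2_def)
  show "open U \<longleftrightarrow> (\<forall>x\<in>U. \<forall>\<^sub>F (x', y) in uniformity. x' = x \<longrightarrow> y \<in> U)" for U :: "L2 set"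
    by (simp add: open_L2_def)
  show "inner u v = inner v u"
    by (simp add: inner_L2_def mult.commute)
  show "inner (u + v) w = inner u w + inner v w"
  proof -
    have "inner (u + v) w = (LINT x|lborel. (rep_L2 u x + rep_L2 v x) * rep_L2 w x)"
      by (intro inner_L2_cong AE_rep_plus AE_I2) auto
    also have "\<dots> = inner u w + inner v w"
      unfolding inner_L2_def distrib_right
      by (intro Bochner_Integration.integral_add integrable_mult_L2) auto
    finally show ?thesis .
  qed
  show "inner (r *\<^sub>R u) v = r * inner u v"
  proof -
    have "inner (r *\<^sub>R u) v = (LINT x|lborel. (r * rep_L2 u x) * rep_L2 v x)"
      by (intro inner_L2_cong AE_rep_scaleR AE_I2) auto
    then show ?thesis
      unfolding inner_L2_def by (simp add: mult.assoc)
  qed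
  show "0 \<le> inner u u"
    by (simp add: inner_L2_def)
  show "inner u u = 0 \<longleftrightarrow> u = 0"
  proof
    assume "inner u u = 0"
    then have "AE x in lborel. rep_L2 u x * rep_L2 u x = 0"
      unfolding inner_L2_def
      by (subst (asm) integral_nonneg_eq_0_iff_AE) (auto intro: integrable_mult_L2)
    then show "u = 0"
      using AE_rep_zero by (intro L2_eqI, eventually_elim) simp
  next
    assume "u = 0"
    then have "inner u u = (LINT x|(lborel :: real measure). (\<lambda>_. 0) x * (\<lambda>_. 0 :: real) x)"
      using AE_rep_zero by (intro inner_L2_cong) auto
    then show "inner u u = 0" by simp
  qed
  show "norm u = sqrt (inner u u)"
    by (rule norm_L2_def)
qed

end

lemma norm_L2_eq: "norm (u :: L2) = sqrt (LINT x|lborel. (rep_L2 u x)\<^sup>2)"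
  by (simp add: norm_L2_def inner_L2_def power2_eq_square)

lemma norm_L2_AE:
  assumes "AE x in lborel. rep_L2 u x = f x" "f \<in> borel_measurable borel"
  shows "(norm u)\<^sup>2 = (LINT x|lborel. (f x)\<^sup>2)"
  using inner_L2_cong[OF assms(1) assms(1) assms(2) assms(2)]
  by (simp add: power2_norm_eq_inner flip: power2_eq_square)

lemma abs_L2_add:
  assumes "square_integrable f" "square_integrable g"
  shows "abs_L2 (\<lambda>x. f x + g x) = abs_L2 f + abs_L2 g"
  using AE_rep_abs[OF square_integrable_add[OF assms]] AE_rep_abs[OF assms(1)]
    AE_rep_abs[OF assms(2)] AE_rep_plus[of "abs_L2 f" "abs_L2 g"]
  by (intro L2_eqI, eventually_elim) simp

lemma abs_L2_diff:
  assumes "square_integrable f" "square_integrable g"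
  shows "abs_L2 (\<lambda>x. f x - g x) = abs_L2 f - abs_L2 g"
  using AE_rep_abs[OF square_integrable_diff[OF assms]] AE_rep_abs[OF assms(1)]
    AE_rep_abs[OF assms(2)] AE_rep_diff[of "abs_L2 f" "abs_L2 g"]
  by (intro L2_eqI, eventually_elim) simp

lemma abs_L2_scale:
  assumes "square_integrable f"
  shows "abs_L2 (\<lambda>x. c * f x) = c *\<^sub>R abs_L2 f"
  using AE_rep_abs[OF square_integrable_scale[OF assms, of c]] AE_rep_abs[OF assms(1)]
    AE_rep_scaleR[of c "abs_L2 f"]
  by (intro L2_eqI, eventually_elim) simp

lemma norm_abs_L2:
  assumes "square_integrable f"
  shows "(norm (abs_L2 f))\<^sup>2 = (LINT x|lborel. (f x)\<^sup>2)"
  using assms by (intro norm_L2_AE AE_rep_abs) auto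

lemma L2_dominated_convergence:
  assumes f: "\<And>n. f n \<in> borel_measurable borel" and F: "F \<in> borel_measurable borel"
    and h: "square_integrable h" and fh: "\<And>n. AE x in lborel. \<bar>f n x\<bar> \<le> h x"
    and lim: "AE x in lborel. (\<lambda>n. f n x) \<longlonglongrightarrow> F x"
  shows "square_integrable F" and "\<And>n. square_integrable (f n)"
    and "(\<lambda>n. abs_L2 (f n)) \<longlonglongrightarrow> abs_L2 F"
proof -
  have fh': "AE x in lborel. \<forall>n. \<bar>f n x\<bar> \<le> h x"
    using fh by (simp add: AE_all_countable)
  have Fh: "AE x in lborel. \<bar>F x\<bar> \<le> h x"
    using fh' lim
  proof eventually_elim
    case (elim x)
    then show ?case
      by (intro LIMSEQ_le_const2[OF tendsto_rabs[OF elim(2)]]) auto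
  qed
  show sF: "square_integrable F"
    by (rule square_integrable_bound[OF h F]) (use Fh in eventually_elim, simp)
  show sf: "square_integrable (f n)" for n
    by (rule square_integrable_bound[OF h f]) (use fh[of n] in eventually_elim, simp)
  have [measurable]: "h \<in> borel_measurable borel" "F \<in> borel_measurable borel"
    "\<And>n. f n \<in> borel_measurable borel"
    using h f F by auto
  have "(\<lambda>n. LINT x|lborel. (f n x - F x)\<^sup>2) \<longlonglongrightarrow> (LINT x|(lborel :: real measure). (0::real))"
  proof (rule integral_dominated_convergence[where w="\<lambda>x. (2 * h x)\<^sup>2"])
    show "integrable lborel (\<lambda>x. (2 * h x)\<^sup>2)"
      using square_integrable_scale[OF h, of 2] by (simp add: square_integrable_def)
    show "AE x in lborel. (\<lambda>n. (f n x - F x)\<^sup>2) \<longlonglongrightarrow> 0"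
      using lim
    proof eventually_elim
      case (elim x)
      have "(\<lambda>n. (f n x - F x)\<^sup>2) \<longlonglongrightarrow> (F x - F x)\<^sup>2"
        by (intro tendsto_intros elim)
      then show ?case by simp
    qed
    show "AE x in lborel. norm ((f n x - F x)\<^sup>2) \<le> (2 * h x)\<^sup>2" for n
      using fh[of n] Fh
    proof eventually_elim
      case (elim x)
      then have "\<bar>f n x - F x\<bar> \<le> \<bar>2 * h x\<bar>" by linarith
      then show ?case by (simp only: abs_le_square_iff) simp
    qed
  qed measurable
  moreover have "(norm (abs_L2 (f n) - abs_L2 F))\<^sup>2 = (LINT x|lborel. (f n x - F x)\<^sup>2)" for n
    by (subst abs_L2_diff[symmetric]) (auto intro!: norm_abs_L2 square_integrable_diff sf sF)
  ultimately have "(\<lambda>n. (norm (abs_L2 (f n) - abs_L2 F))\<^sup>2) \<longlonglongrightarrow> 0"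
    by simp
  from tendsto_real_sqrt[OF this]
  have "(\<lambda>n. norm (abs_L2 (f n) - abs_L2 F)) \<longlonglongrightarrow> 0" by simp
  then show "(\<lambda>n. abs_L2 (f n)) \<longlonglongrightarrow> abs_L2 F"
    using LIM_zero_cancel tendsto_norm_zero_iff by blast
qed

lemma square_integrable_sum:
  assumes "\<And>i. i \<in> A \<Longrightarrow> square_integrable (f i)"
  shows "square_integrable (\<lambda>x. \<Sum>i\<in>A. f i x)"
  using assms by (induction A rule: infinite_finite_induct)
    (auto intro: square_integrable_zero square_integrable_add)

lemma abs_L2_sum:
  assumes "\<And>i. i \<in> A \<Longrightarrow> square_integrable (f i)"
  shows "abs_L2 (\<lambda>x. \<Sum>i\<in>A. f i x) = (\<Sum>i\<in>A. abs_L2 (f i))"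
  using assms
proof (induction A rule: infinite_finite_induct)
  case (insert i A)
  then show ?case by (simp add: abs_L2_add square_integrable_sum)
qed (simp_all add: zero_L2_def)

instance L2 :: banach
proof
  fix X :: "nat \<Rightarrow> L2"
  assume X: "Cauchy X"
  have "\<exists>N. \<forall>m\<ge>N. \<forall>n\<ge>N. norm (X m - X n) < (1/2)^k" for k :: nat
    using X by (auto simp: Cauchy_iff)
  then obtain N where N: "\<And>k m n. m \<ge> N k \<Longrightarrow> n \<ge> N k \<Longrightarrow> norm (X m - X n) < (1/2)^k"
    by metis
  define r where "r k = (\<Sum>i\<le>k. Suc (N i))" for k
  have r: "strict_mono r"
    by (auto simp: strict_mono_Suc_iff r_def)
  have rN: "N k \<le> r k" for k
    by (cases k) (simp_all add: r_def)
  define Y where "Y n = rep_L2 (X (r n))" for n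
  have Y_sq [simp]: "square_integrable (Y n)" for n
    by (simp add: Y_def)
  have [measurable]: "Y n \<in> borel_measurable borel" for n
    by (simp add: Y_def)
  define d where "d n = (\<lambda>x. \<bar>Y (Suc n) x - Y n x\<bar>)" for n
  have d_sq: "square_integrable (d n)" for n
    unfolding d_def by (intro square_integrable_abs square_integrable_diff) auto
  have [measurable]: "d n \<in> borel_measurable borel" for n
    using d_sq by (rule square_integrable_measurable)
  have d_nonneg: "0 \<le> d n x" for n x
    by (simp add: d_def)
  have d_norm: "norm (abs_L2 (d n)) \<le> (1/2)^n" for n
  proof -
    have "(norm (abs_L2 (d n)))\<^sup>2 = (norm (X (r (Suc n)) - X (r n)))\<^sup>2"
      unfolding norm_abs_L2[OF d_sq]
      by (subst norm_L2_AE[OF AE_rep_diff]) (simp_all add: d_def Y_def)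
    then have "norm (abs_L2 (d n)) = norm (X (r (Suc n)) - X (r n))"
      by simp
    also have "\<dots> < (1/2)^n"
      using r by (intro N order_trans[OF rN[of n]]) (auto simp: strict_mono_leD)
    finally show ?thesis by simp
  qed
  define S where "S n x = (\<Sum>i<n. d i x)" for n x
  have S_sq: "square_integrable (S n)" for n
    unfolding S_def by (intro square_integrable_sum d_sq)
  have [measurable]: "S n \<in> borel_measurable borel" for n
    using S_sq by (rule square_integrable_measurable)
  have S_nonneg: "0 \<le> S n x" for n x
    unfolding S_def by (intro sum_nonneg d_nonneg)
  have S_mono: "S m x \<le> S n x" if "m \<le> n" for m n x
    unfolding S_def using that d_nonneg by (intro sum_mono2) auto
  have S_int: "(\<integral>\<^sup>+x. ennreal ((S n x)\<^sup>2) \<partial>lborel) \<le> 4" for n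
  proof -
    have "norm (abs_L2 (S n)) \<le> (\<Sum>i<n. norm (abs_L2 (d i)))"
      unfolding S_def by (simp add: abs_L2_sum d_sq norm_sum)
    also have "\<dots> \<le> (\<Sum>i<n. (1/2)^i)"
      by (intro sum_mono d_norm)
    also have "\<dots> \<le> 2"
      by (simp add: sum_gp_strict)
    finally have "(norm (abs_L2 (S n)))\<^sup>2 \<le> 2\<^sup>2"
      by (intro power_mono) auto
    then have "(LINT x|lborel. (S n x)\<^sup>2) \<le> 4"
      by (simp add: norm_abs_L2[OF S_sq])
    moreover have "(\<integral>\<^sup>+x. ennreal ((S n x)\<^sup>2) \<partial>lborel) = ennreal (LINT x|lborel. (S n x)\<^sup>2)"
      using S_sq[of n] by (intro nn_integral_eq_integral) (auto simp: square_integrable_def)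
    ultimately show ?thesis
      by (metis ennreal_leI ennreal_numeral)
  qed
  define G where "G x = (SUP n. ennreal ((S n x)\<^sup>2))" for x
  have "(\<integral>\<^sup>+x. G x \<partial>lborel) = (SUP n. \<integral>\<^sup>+x. ennreal ((S n x)\<^sup>2) \<partial>lborel)"
    unfolding G_def
  proof (rule nn_integral_monotone_convergence_SUP)
    show "incseq (\<lambda>n x. ennreal ((S n x)\<^sup>2))"
      using S_mono S_nonneg by (auto simp: incseq_def le_fun_def intro!: ennreal_leI power_mono)
  qed measurable
  also have "\<dots> \<le> 4"
    using S_int by (intro SUP_least) auto
  finally have G_int: "(\<integral>\<^sup>+x. G x \<partial>lborel) \<le> 4" .
  have [measurable]: "G \<in> borel_measurable borel"
    unfolding G_def by measurable
  have "AE x in lborel. G x \<noteq> \<infinity>"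
    using G_int by (intro nn_integral_noteq_infinite) (auto simp: top_unique)
  then have d_summable: "AE x in lborel. summable (\<lambda>n. d n x)"
  proof eventually_elim
    case (elim x)
    have le: "(S n x)\<^sup>2 \<le> enn2real (G x)" for n
    proof -
      have "ennreal ((S n x)\<^sup>2) \<le> G x"
        unfolding G_def by (rule SUP_upper) simp
      then have "enn2real (ennreal ((S n x)\<^sup>2)) \<le> enn2real (G x)"
        using elim by (intro enn2real_mono) (auto simp: top.not_eq_extremum)
      then show ?thesis by simp
    qed
    have "(\<Sum>i<n. norm (d i x)) \<le> sqrt (enn2real (G x))" for n
      using real_sqrt_le_mono[OF le[of n]] S_nonneg[of n x] d_nonneg by (simp add: S_def)
    then show ?case
      using d_nonneg by (intro bounded_imp_summable[where B="sqrt (enn2real (G x))"])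
        (auto simp del: sum.lessThan_Suc simp add: lessThan_Suc_atMost[symmetric])
  qed
  define H where "H x = (\<Sum>n. d n x)" for x
  have [measurable]: "H \<in> borel_measurable borel"
    unfolding H_def by measurable
  have H_G: "AE x in lborel. ennreal ((H x)\<^sup>2) \<le> G x"
    using d_summable
  proof eventually_elim
    case (elim x)
    have "(\<lambda>n. S n x) \<longlonglongrightarrow> H x"
      unfolding S_def H_def by (rule summable_LIMSEQ[OF elim])
    then have "(\<lambda>n. ennreal ((S n x)\<^sup>2)) \<longlonglongrightarrow> ennreal ((H x)\<^sup>2)"
      by (intro tendsto_ennrealI tendsto_power)
    then show ?case
      by (rule LIMSEQ_le_const2) (intro exI allI impI, unfold G_def, rule SUP_upper, simp)
  qed
  have H_sq: "square_integrable H"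
    unfolding square_integrable_def
  proof (intro conjI integrableI_nonneg)
    have "(\<integral>\<^sup>+x. ennreal ((H x)\<^sup>2) \<partial>lborel) \<le> (\<integral>\<^sup>+x. G x \<partial>lborel)"
      by (rule nn_integral_mono_AE[OF H_G])
    also note G_int
    finally show "(\<integral>\<^sup>+x. ennreal ((H x)\<^sup>2) \<partial>lborel) < \<infinity>"
      by (rule le_less_trans) (simp add: less_top[symmetric])
    show "AE x in lborel. 0 \<le> (H x)\<^sup>2"
      by (rule AE_I2) simp
  qed measurable
  define F where "F x = lim (\<lambda>n. Y n x)" for x
  have [measurable]: "F \<in> borel_measurable borel"
    unfolding F_def by measurable
  have Y_tele: "Y n x - Y 0 x = (\<Sum>i<n. Y (Suc i) x - Y i x)" for n x
    by (induction n) auto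
  have conv: "AE x in lborel. (\<lambda>n. Y n x) \<longlonglongrightarrow> F x"
    using d_summable
  proof eventually_elim
    case (elim x)
    then have "summable (\<lambda>i. Y (Suc i) x - Y i x)"
      unfolding d_def by (rule summable_rabs_cancel)
    then have "(\<lambda>n. \<Sum>i<n. Y (Suc i) x - Y i x) \<longlonglongrightarrow> (\<Sum>i. Y (Suc i) x - Y i x)"
      by (rule summable_LIMSEQ)
    then have "(\<lambda>n. Y n x - Y 0 x) \<longlonglongrightarrow> (\<Sum>i. Y (Suc i) x - Y i x)"
      by (simp add: Y_tele)
    from tendsto_add[OF this tendsto_const[of "Y 0 x"]]
    have "convergent (\<lambda>n. Y n x)"
      by (auto simp: convergent_def)
    then show ?case
      by (simp add: F_def convergent_LIMSEQ_iff)
  qed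
  have bnd: "AE x in lborel. \<bar>Y n x\<bar> \<le> \<bar>Y 0 x\<bar> + H x" for n
    using d_summable
  proof eventually_elim
    case (elim x)
    have "\<bar>Y n x - Y 0 x\<bar> \<le> S n x"
      unfolding Y_tele S_def d_def by (rule sum_abs)
    also have "S n x \<le> H x"
      unfolding S_def H_def by (rule sum_le_suminf[OF elim]) (auto simp: d_nonneg)
    finally show ?case by linarith
  qed
  have "(\<lambda>n. abs_L2 (Y n)) \<longlonglongrightarrow> abs_L2 F"
    by (rule L2_dominated_convergence[OF _ _ _ bnd conv])
       (auto intro!: square_integrable_add square_integrable_abs H_sq)
  then have "(X \<circ> r) \<longlonglongrightarrow> abs_L2 F"
    by (simp add: Y_def o_def)
  then show "convergent X"
    using Cauchy_converges_subseq[OF X r] by (auto simp: convergent_def)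
qed


text \<open>
  Separability, which the Bochner integral of \<open>L2\<close>-valued functions needs: the rational step
  functions are dense.
\<close>

lemma square_integrable_indicator:
  assumes "A \<in> sets borel"
  shows "square_integrable (indicator (A \<inter> {a..b}))"
proof -
  have "(\<lambda>x. (indicator (A \<inter> {a..b}) x :: real)\<^sup>2) = indicator (A \<inter> {a..b})"
    by (auto simp: indicator_def power2_eq_square)
  moreover have "emeasure lborel (A \<inter> {a..b}) < \<infinity>"
    using emeasure_mono[of "A \<inter> {a..b}" "{a..b}" lborel] assms
    by (auto simp: emeasure_lborel_cbox_eq[of a b, unfolded cbox_interval] intro: order.strict_trans1)
  ultimately show ?thesis
    using assms by (auto simp: square_integrable_def)
qed

definition rat_step :: "(rat \<times> rat \<times> rat) list \<Rightarrow> L2" where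
  "rat_step xs = (\<Sum>(q, a, b)\<leftarrow>xs. real_of_rat q *\<^sub>R abs_L2 (indicator {real_of_rat a..real_of_rat b}))"

lemma rat_step_closure_add:
  assumes "u \<in> closure (range rat_step)" "v \<in> closure (range rat_step)"
  shows "u + v \<in> closure (range rat_step)"
proof -
  obtain X Y where X: "\<And>n. X n \<in> range rat_step" "X \<longlonglongrightarrow> u"
    and Y: "\<And>n. Y n \<in> range rat_step" "Y \<longlonglongrightarrow> v"
    using assms unfolding closure_sequential by blast
  have "X n + Y n \<in> range rat_step" for n
  proof -
    obtain xs ys where "X n = rat_step xs" "Y n = rat_step ys"
      using X(1) Y(1) by blast
    then have "X n + Y n = rat_step (xs @ ys)"
      by (simp add: rat_step_def)
    then show ?thesis by simp
  qed
  then show ?thesis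
    unfolding closure_sequential using tendsto_add[OF X(2) Y(2)]
    by (intro exI[of _ "\<lambda>n. X n + Y n"] conjI allI)
qed

lemma rat_step_closure_scaleR:
  assumes "u \<in> closure (range rat_step)"
  shows "c *\<^sub>R u \<in> closure (range rat_step)"
proof -
  obtain X where X: "\<And>n. X n \<in> range rat_step" "X \<longlonglongrightarrow> u"
    using assms unfolding closure_sequential by blast
  have "\<exists>p. c < real_of_rat p \<and> real_of_rat p < c + 1 / Suc n" for n
    using of_rat_dense[of c "c + 1 / Suc n"] by simp
  then obtain q where q: "\<And>n. c < real_of_rat (q n)" "\<And>n. real_of_rat (q n) < c + 1 / Suc n"
    by metis
  have inv: "(\<lambda>n. 1 / real (Suc n)) \<longlonglongrightarrow> 0"
    using LIMSEQ_inverse_real_of_nat by (simp add: inverse_eq_divide)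
  have qlim: "(\<lambda>n. real_of_rat (q n)) \<longlonglongrightarrow> c"
  proof (rule tendsto_sandwich[where f="\<lambda>_. c" and h="\<lambda>n. c + 1 / Suc n"])
    show "(\<lambda>n. c + 1 / Suc n) \<longlonglongrightarrow> c"
      using tendsto_add[OF tendsto_const[of c] inv] by simp
  qed (use q in \<open>auto intro!: always_eventually less_imp_le\<close>)
  have "real_of_rat (q n) *\<^sub>R X n \<in> range rat_step" for n
  proof -
    obtain xs where xs: "X n = rat_step xs"
      using X(1) by auto
    have "real_of_rat (q n) *\<^sub>R rat_step xs = rat_step (map (\<lambda>(r, a, b). (q n * r, a, b)) xs)"
      by (induction xs) (auto simp: rat_step_def scaleR_add_right of_rat_mult)
    then show ?thesis using xs by simp
  qed
  then show ?thesis
    unfolding closure_sequential using tendsto_scaleR[OF qlim X(2)]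
    by (intro exI[of _ "\<lambda>n. real_of_rat (q n) *\<^sub>R X n"] conjI allI)
qed

lemma rat_step_closure_zero: "0 \<in> closure (range rat_step)"
proof -
  have "rat_step [] = 0" by (simp add: rat_step_def)
  moreover have "rat_step [] \<in> closure (range rat_step)"
    by (rule subsetD[OF closure_subset]) (rule rangeI)
  ultimately show ?thesis by simp
qed

lemma rat_step_closure_sum:
  assumes "\<And>i. i \<in> A \<Longrightarrow> u i \<in> closure (range rat_step)"
  shows "(\<Sum>i\<in>A. u i) \<in> closure (range rat_step)"
  using assms by (induction A rule: infinite_finite_induct)
    (auto intro: rat_step_closure_zero rat_step_closure_add)

lemma closure_rat_step_tendsto:
  assumes "\<And>n. X n \<in> closure (range rat_step)" "X \<longlonglongrightarrow> u"
  shows "u \<in> closure (range rat_step)"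
  using closed_sequentially[OF closed_closure, of X] assms by blast

lemma rat_step_closure_interval: "abs_L2 (indicator {a..b}) \<in> closure (range rat_step)"
proof -
  have "\<exists>q. a - 1 / Suc n < real_of_rat q \<and> real_of_rat q < a" for n
    using of_rat_dense[of "a - 1 / Suc n" a] by simp
  then obtain p where p: "\<And>n. a - 1 / Suc n < real_of_rat (p n)" "\<And>n. real_of_rat (p n) < a"
    by metis
  have "\<exists>q. b < real_of_rat q \<and> real_of_rat q < b + 1 / Suc n" for n
    using of_rat_dense[of b "b + 1 / Suc n"] by simp
  then obtain q where q: "\<And>n. real_of_rat (q n) < b + 1 / Suc n" "\<And>n. b < real_of_rat (q n)"
    by metis
  have inv: "(\<lambda>n. 1 / real (Suc n)) \<longlonglongrightarrow> 0"
    using LIMSEQ_inverse_real_of_nat by (simp add: inverse_eq_divide)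
  have plim: "(\<lambda>n. real_of_rat (p n)) \<longlonglongrightarrow> a"
  proof (rule tendsto_sandwich[where f="\<lambda>n. a - 1 / Suc n" and h="\<lambda>_. a"])
    show "(\<lambda>n. a - 1 / Suc n) \<longlonglongrightarrow> a"
      using tendsto_diff[OF tendsto_const[of a] inv] by simp
  qed (use p in \<open>auto intro!: always_eventually less_imp_le\<close>)
  have qlim: "(\<lambda>n. real_of_rat (q n)) \<longlonglongrightarrow> b"
  proof (rule tendsto_sandwich[where f="\<lambda>_. b" and h="\<lambda>n. b + 1 / Suc n"])
    show "(\<lambda>n. b + 1 / Suc n) \<longlonglongrightarrow> b"
      using tendsto_add[OF tendsto_const[of b] inv] by simp
  qed (use q in \<open>auto intro!: always_eventually less_imp_le\<close>)
  define X where "X n = (indicator {real_of_rat (p n)..real_of_rat (q n)} :: real \<Rightarrow> real)" for n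
  have "(\<lambda>n. abs_L2 (X n)) \<longlonglongrightarrow> abs_L2 (indicator {a..b})"
  proof (rule L2_dominated_convergence(3))
    show "square_integrable (indicator {a - 1..b + 1})"
      using square_integrable_indicator[of UNIV "a - 1" "b + 1"] by simp
    have "\<bar>X n x\<bar> \<le> indicator {a - 1..b + 1} x" for n x
    proof -
      have "1 / real (Suc n) \<le> 1" by simp
      then have "a - 1 \<le> real_of_rat (p n)" "real_of_rat (q n) \<le> b + 1"
        using p(1)[of n] q(1)[of n] by linarith+
      then show ?thesis by (auto simp: X_def indicator_def)
    qed
    then show "AE x in lborel. \<bar>X n x\<bar> \<le> indicator {a - 1..b + 1} x" for n
      by simp
    have "(\<lambda>n. X n x) \<longlonglongrightarrow> indicator {a..b} x" for x
    proof (rule tendsto_eventually)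
      consider "x < a" | "b < x" | "a \<le> x" "x \<le> b" by linarith
      then show "\<forall>\<^sub>F n in sequentially. X n x = indicator {a..b} x"
      proof cases
        case 1
        show ?thesis
          using order_tendstoD(1)[OF plim 1]
          by eventually_elim (use 1 in \<open>auto simp: X_def\<close>)
      next
        case 2
        show ?thesis
          using order_tendstoD(2)[OF qlim 2]
          by eventually_elim (use 2 in \<open>auto simp: X_def\<close>)
      next
        case 3
        have "real_of_rat (p n) \<le> x \<and> x \<le> real_of_rat (q n)" for n
          using p(2)[of n] q(2)[of n] 3 by linarith
        then show ?thesis using 3 by (simp add: X_def)
      qed
    qed
    then show "AE x in lborel. (\<lambda>n. X n x) \<longlonglongrightarrow> indicator {a..b} x"
      by simp
  qed (auto simp: X_def)
  moreover have "abs_L2 (X n) = rat_step [(1, p n, q n)]" for n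
    by (simp add: X_def rat_step_def)
  ultimately show ?thesis
    unfolding closure_sequential by (intro exI[of _ "\<lambda>n. abs_L2 (X n)"]) auto
qed

lemma rat_step_closure_indicator:
  assumes "A \<in> sets borel"
  shows "abs_L2 (indicator (A \<inter> {a..b})) \<in> closure (range rat_step)"
  using assms
proof (induction A rule: borel_set_induct)
  case empty
  have "abs_L2 (indicator {}) = 0"
    unfolding zero_L2_def by (intro arg_cong[of _ _ abs_L2]) auto
  then show ?case by (simp only: Int_empty_left rat_step_closure_zero)
next
  case (interval c d)
  then show ?case by (simp add: Int_atLeastAtMost rat_step_closure_interval)
next
  case (compl A)
  have sq: "square_integrable (indicator {a..b})"
    using square_integrable_indicator[of UNIV a b] by simp
  have "indicator (- A \<inter> {a..b}) = (\<lambda>x. indicator {a..b} x - indicator (A \<inter> {a..b}) x :: real)"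
    by (auto simp: indicator_def)
  then have "abs_L2 (indicator (- A \<inter> {a..b}))
      = abs_L2 (indicator {a..b}) + (-1) *\<^sub>R abs_L2 (indicator (A \<inter> {a..b}))"
    using abs_L2_diff[OF sq square_integrable_indicator[OF compl(1), of a b]] by simp
  then show ?case
    using compl(2) by (metis rat_step_closure_add rat_step_closure_interval rat_step_closure_scaleR)
next
  case (union f)
  define X where "X n = (indicator ((\<Union>i<n. f i) \<inter> {a..b}) :: real \<Rightarrow> real)" for n :: nat
  have "X n = (\<lambda>x. \<Sum>i<n. indicator (f i \<inter> {a..b}) x)" for n
  proof
    fix x
    show "X n x = (\<Sum>i<n. indicator (f i \<inter> {a..b}) x)"
      using indicator_UN_disjoint[of "{..<n}" "\<lambda>i. f i \<inter> {a..b}" x] union(1)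
      unfolding X_def disjoint_family_on_def by (auto simp: Int_UN_distrib2)
  qed
  then have "abs_L2 (X n) = (\<Sum>i<n. abs_L2 (indicator (f i \<inter> {a..b})))" for n
    by (simp add: abs_L2_sum square_integrable_indicator union(2))
  then have *: "abs_L2 (X n) \<in> closure (range rat_step)" for n
    using union(3) by (auto intro: rat_step_closure_sum)
  have "(\<lambda>n. abs_L2 (X n)) \<longlonglongrightarrow> abs_L2 (indicator ((\<Union>i. f i) \<inter> {a..b}))"
  proof (rule L2_dominated_convergence(3))
    show "square_integrable (indicator {a..b})"
      using square_integrable_indicator[of UNIV a b] by simp
    show "AE x in lborel. \<bar>X n x\<bar> \<le> indicator {a..b} x" for n
      by (auto simp: X_def indicator_def)
    have "(\<lambda>n. X n x) \<longlonglongrightarrow> indicator ((\<Union>i. f i) \<inter> {a..b}) x" for x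
      using LIMSEQ_indicator_UN[of "\<lambda>i. f i \<inter> {a..b}" x] by (simp add: X_def Int_UN_distrib2)
    then show "AE x in lborel. (\<lambda>n. X n x) \<longlonglongrightarrow> indicator ((\<Union>i. f i) \<inter> {a..b}) x"
      by simp
  qed (use union(2) in \<open>auto simp: X_def\<close>)
  with * show ?case
    by (rule closure_rat_step_tendsto)
qed

lemma rat_step_dense: "closure (range rat_step) = UNIV"
proof -
  have "u \<in> closure (range rat_step)" for u
  proof -
    define h where "h = rep_L2 u"
    obtain F where F: "\<And>i. simple_function borel (F i)"
      "\<And>x. (\<lambda>i. F i x) \<longlonglongrightarrow> h x" "\<And>i x. \<bar>F i x\<bar> \<le> 2 * \<bar>h x\<bar>"
      using borel_measurable_implies_sequence_metric[of h borel 0] by (auto simp: h_def)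
    define X where "X n x = F n x * indicator {- real n..real n} x" for n x
    have [measurable]: "F n \<in> borel_measurable borel" for n
      using F(1) by (rule borel_measurable_simple_function)
    have "(\<lambda>n. abs_L2 (X n)) \<longlonglongrightarrow> abs_L2 h"
    proof (rule L2_dominated_convergence(3))
      show "square_integrable (\<lambda>x. 2 * \<bar>h x\<bar>)"
        unfolding h_def by (intro square_integrable_scale square_integrable_abs) auto
      show "AE x in lborel. \<bar>X n x\<bar> \<le> 2 * \<bar>h x\<bar>" for n
        using F(3)[of n] by (auto simp: X_def indicator_def)
      have "(\<lambda>n. X n x) \<longlonglongrightarrow> h x" for x
      proof (rule Lim_transform_eventually[OF F(2)])
        have "\<forall>\<^sub>F n in sequentially. \<bar>x\<bar> \<le> real n"
          using eventually_ge_at_top[of "nat \<lceil>\<bar>x\<bar>\<rceil>"] by eventually_elim linarith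
        then show "\<forall>\<^sub>F n in sequentially. F n x = X n x"
          by eventually_elim (auto simp: X_def indicator_def)
      qed
      then show "AE x in lborel. (\<lambda>n. X n x) \<longlonglongrightarrow> h x"
        by simp
    qed (auto simp: X_def[abs_def] h_def)
    moreover have "abs_L2 (X n) \<in> closure (range rat_step)" for n
    proof -
      have fin: "finite (range (F n))"
        using F(1)[of n] by (simp add: simple_function_def)
      have sets: "F n -` {y} \<in> sets borel" for y
        using F(1)[of n] by (metis borel_singleton measurable_sets_borel borel_measurable_simple_function sets.empty_sets)
      have "X n = (\<lambda>x. \<Sum>y\<in>range (F n). y * indicator (F n -` {y} \<inter> {- real n..real n}) x)"
      proof
        fix x
        have "(\<Sum>y\<in>range (F n). y * indicator (F n -` {y} \<inter> {- real n..real n}) x)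
            = (\<Sum>y\<in>range (F n). if y = F n x then X n x else 0)"
          by (rule sum.cong) (auto simp: X_def indicator_def)
        also have "\<dots> = X n x"
          using fin by (simp add: sum.delta)
        finally show "X n x = (\<Sum>y\<in>range (F n). y * indicator (F n -` {y} \<inter> {- real n..real n}) x)"
          by simp
      qed
      then have "abs_L2 (X n)
          = (\<Sum>y\<in>range (F n). y *\<^sub>R abs_L2 (indicator (F n -` {y} \<inter> {- real n..real n})))"
        using sets by (simp add: abs_L2_sum abs_L2_scale square_integrable_scale square_integrable_indicator)
      then show ?thesis
        using sets by (simp add: rat_step_closure_sum rat_step_closure_scaleR rat_step_closure_indicator)
    qed
    ultimately show ?thesis
      using closure_rat_step_tendsto[of "\<lambda>n. abs_L2 (X n)" u] by (simp add: h_def)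
  qed
  then show ?thesis by blast
qed

lemma countable_dense_imp_subbasis:
  fixes D :: "'a :: metric_space set"
  assumes "countable D" "closure D = UNIV"
  shows "\<exists>B :: 'a set set. countable B \<and> open = generate_topology B"
proof -
  define B where "B = (\<lambda>(d, n). ball d (1 / real (Suc n))) ` (D \<times> (UNIV :: nat set))"
  have "topological_basis B"
  proof (rule topological_basisI)
    show "open U" if "U \<in> B" for U
      using that by (auto simp: B_def)
    fix U :: "'a set" and x
    assume "open U" "x \<in> U"
    then obtain e where e: "0 < e" "ball x e \<subseteq> U"
      by (auto simp: open_contains_ball)
    obtain n where n: "1 / real (Suc n) < e / 2"
      using nat_approx_posE[of "e / 2"] e(1) by auto
    obtain d where d: "d \<in> D" "dist d x < 1 / real (Suc n)"
      using assms(2) closure_approachable[of x D] by (metis UNIV_I divide_pos_pos of_nat_0_less_iff zero_less_Suc zero_less_one)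
    have "ball d (1 / real (Suc n)) \<subseteq> U"
    proof
      fix y assume "y \<in> ball d (1 / real (Suc n))"
      then have "dist x y < e"
        using d(2) n dist_triangle[of x y d] by (simp add: dist_commute)
      then show "y \<in> U" using e(2) by auto
    qed
    moreover have "x \<in> ball d (1 / real (Suc n))"
      using d(2) by (simp add: dist_commute)
    moreover have "ball d (1 / real (Suc n)) \<in> B"
      using d(1) by (force simp: B_def)
    ultimately show "\<exists>B'\<in>B. x \<in> B' \<and> B' \<subseteq> U"
      by blast
  qed
  moreover have "countable B"
    unfolding B_def using assms(1) by auto
  ultimately show ?thesis
    by (intro exI[of _ B] conjI topological_basis_imp_subbasis)
qed

instance L2 :: second_countable_topology
  by standard (intro countable_dense_imp_subbasis[OF _ rat_step_dense], simp)

instance vec :: ("{metric_space, second_countable_topology}", finite) second_countable_topology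
proof
  obtain A :: "'a set set" where A: "countable A" "topological_basis A"
    using ex_countable_basis by blast
  define B where "B = (\<lambda>F. {x :: ('a, 'b) vec. \<forall>i. x $ i \<in> F i}) ` (UNIV \<rightarrow>\<^sub>E A)"
  have "topological_basis B"
  proof (rule topological_basisI)
    show "open U" if "U \<in> B" for U
      using that A(2) by (auto simp: B_def intro!: open_vector_box topological_basis_open)
    fix U :: "('a, 'b) vec set" and x
    assume "open U" "x \<in> U"
    then have "\<exists>G. (\<forall>i. open (G i) \<and> x $ i \<in> G i) \<and> (\<forall>y. (\<forall>i. y $ i \<in> G i) \<longrightarrow> y \<in> U)"
      by (simp add: open_vec_def)
    then obtain G where G0: "(\<forall>i. open (G i) \<and> x $ i \<in> G i) \<and> (\<forall>y. (\<forall>i. y $ i \<in> G i) \<longrightarrow> y \<in> U)" ..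
    have G: "\<And>i. open (G i)" "\<And>i. x $ i \<in> G i" "\<And>y. \<forall>i. y $ i \<in> G i \<Longrightarrow> y \<in> U"
      using G0 by simp_all
    have "\<exists>C\<in>A. x $ i \<in> C \<and> C \<subseteq> G i" for i
      by (rule topological_basisE[OF A(2) G(1)[of i] G(2)[of i]]) blast
    then obtain F where F: "\<And>i. F i \<in> A" "\<And>i. x $ i \<in> F i" "\<And>i. F i \<subseteq> G i"
      by metis
    show "\<exists>B'\<in>B. x \<in> B' \<and> B' \<subseteq> U"
    proof (rule bexI[of _ "{y. \<forall>i. y $ i \<in> F i}"])
      show "x \<in> {y. \<forall>i. y $ i \<in> F i} \<and> {y. \<forall>i. y $ i \<in> F i} \<subseteq> U"
        using F(2,3) by (auto intro!: G(3))
      show "{y. \<forall>i. y $ i \<in> F i} \<in> B"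
        using F(1) by (auto simp: B_def)
    qed
  qed
  moreover have "countable B"
    unfolding B_def using A(1) by (intro countable_image countable_PiE) auto
  ultimately show "\<exists>B :: ('a, 'b) vec set set. countable B \<and> open = generate_topology B"
    by (intro exI[of _ B] conjI topological_basis_imp_subbasis)
qed


section \<open>Sobolev functions of one variable\<close>

definition test_functions :: "real \<Rightarrow> real \<Rightarrow> (real \<Rightarrow> real) set" where
  "test_functions a b = {\<phi>. (\<forall>k x. ((deriv ^^ k) \<phi>) field_differentiable (at x)) \<and>
     (\<exists>c d. a < c \<and> d < b \<and> (\<forall>x. x \<notin> {c..d} \<longrightarrow> \<phi> x = 0))}"

text \<open>
  \<open>f\<close> and \<open>g\<close> are integrable on the interval and \<open>g\<close> is the distributional derivative of \<open>f\<close>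
  there. Both are insensitive to changes on null sets. The values lie in an arbitrary separable
  Banach space: \<^typ>\<open>real\<close> is used on the edges and the Bochner case is used in time.
\<close>

definition has_weak_derivative ::
  "(real \<Rightarrow> 'a::{banach, second_countable_topology}) \<Rightarrow> (real \<Rightarrow> 'a) \<Rightarrow> real \<Rightarrow> real \<Rightarrow> bool" where
  "has_weak_derivative f g a b \<longleftrightarrow>
     set_integrable lborel {a<..<b} f \<and> set_integrable lborel {a<..<b} g \<and>
     (\<forall>\<phi>\<in>test_functions a b.
        (LINT x:{a<..<b}|lborel. deriv \<phi> x *\<^sub>R f x) = - (LINT x:{a<..<b}|lborel. \<phi> x *\<^sub>R g x))"

section \<open>Networks\<close>

text \<open>
  The vertex set is the whole of a finite type, and an edge is the ordered pair of its ends.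
\<close>

definition weakly_connected :: "('v \<times> 'v) set \<Rightarrow> bool" where
  "weakly_connected E \<longleftrightarrow> (\<forall>v w. (v, w) \<in> (E \<union> E\<inverse>)\<^sup>*)"

definition incident_edges :: "('v \<times> 'v) set \<Rightarrow> 'v \<Rightarrow> ('v \<times> 'v) set" where
  "incident_edges E v = {e \<in> E. fst e = v \<or> snd e = v}"

definition interior_vertices :: "('v \<times> 'v) set \<Rightarrow> 'v set" where
  "interior_vertices E = {v. 2 \<le> card (incident_edges E v)}"

definition boundary_vertices :: "('v \<times> 'v) set \<Rightarrow> 'v set" where
  "boundary_vertices E = UNIV - interior_vertices E"

definition edge_sign :: "'v \<times> 'v \<Rightarrow> 'v \<Rightarrow> real" where
  "edge_sign e v = (if fst e = v then - 1 else if snd e = v then 1 else 0)"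

text \<open>
  A function on the network is a vector of elements of \<^typ>\<open>L2\<close> indexed by all pairs of vertices.
  The component at an edge \<open>e\<close> is extended by zero outside \<open>{0..l e}\<close>, and the components at pairs
  that are not edges are zero. On this closed subspace the Euclidean norm of \<^type>\<open>vec\<close> is the
  norm of $L^2(\mathcal E)$.
\<close>

type_synonym 'v network_fun = "(L2, 'v \<times> 'v) vec"

definition L2_network :: "('v::finite \<times> 'v) set \<Rightarrow> ('v \<times> 'v \<Rightarrow> real) \<Rightarrow> 'v network_fun set" where
  "L2_network E l = {w. (\<forall>e\<in>E. AE x in lborel. x \<notin> {0..l e} \<longrightarrow> rep_L2 (w $ e) x = 0) \<and>
     (\<forall>e. e \<notin> E \<longrightarrow> w $ e = 0)}"

definition has_edge_derivative ::
  "('v::finite \<times> 'v) set \<Rightarrow> ('v \<times> 'v \<Rightarrow> real) \<Rightarrow> 'v network_fun \<Rightarrow> 'v network_fun \<Rightarrow> bool" where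
  "has_edge_derivative E l w z \<longleftrightarrow> z \<in> L2_network E l \<and>
     (\<forall>e\<in>E. has_weak_derivative (rep_L2 (w $ e)) (rep_L2 (z $ e)) 0 (l e))"

definition H1_network :: "('v::finite \<times> 'v) set \<Rightarrow> ('v \<times> 'v \<Rightarrow> real) \<Rightarrow> 'v network_fun set" where
  "H1_network E l = {w \<in> L2_network E l. \<exists>z. has_edge_derivative E l w z}"

definition edge_derivative ::
  "('v::finite \<times> 'v) set \<Rightarrow> ('v \<times> 'v \<Rightarrow> real) \<Rightarrow> 'v network_fun \<Rightarrow> 'v network_fun" where
  "edge_derivative E l w = (THE z. has_edge_derivative E l w z)"

text \<open>The trace is the value at the endpoint of the continuous representative.\<close>

definition edge_trace :: "('v \<times> 'v \<Rightarrow> real) \<Rightarrow> 'v::finite network_fun \<Rightarrow> 'v \<times> 'v \<Rightarrow> 'v \<Rightarrow> real" where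
  "edge_trace l w e v = (THE y. \<exists>h. continuous_on {0..l e} h \<and>
     (AE x in lborel. x \<in> {0..l e} \<longrightarrow> rep_L2 (w $ e) x = h x) \<and>
     y = h (if fst e = v then 0 else l e))"

definition H1_0 :: "('v::finite \<times> 'v) set \<Rightarrow> ('v \<times> 'v \<Rightarrow> real) \<Rightarrow> 'v network_fun set" where
  "H1_0 E l = {p \<in> H1_network E l.
     (\<forall>v\<in>interior_vertices E. \<forall>e\<in>incident_edges E v. \<forall>e'\<in>incident_edges E v.
        edge_trace l p e v = edge_trace l p e' v) \<and>
     (\<forall>v\<in>boundary_vertices E. \<forall>e\<in>incident_edges E v. edge_trace l p e v = 0)}"

definition H_div :: "('v::finite \<times> 'v) set \<Rightarrow> ('v \<times> 'v \<Rightarrow> real) \<Rightarrow> 'v network_fun set" where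
  "H_div E l = {u \<in> H1_network E l.
     \<forall>v\<in>interior_vertices E. (\<Sum>e\<in>incident_edges E v. edge_sign e v * edge_trace l u e v) = 0}"

definition H1_norm :: "('v::finite \<times> 'v) set \<Rightarrow> ('v \<times> 'v \<Rightarrow> real) \<Rightarrow> 'v network_fun \<Rightarrow> real" where
  "H1_norm E l w = sqrt ((norm w)\<^sup>2 + (norm (edge_derivative E l w))\<^sup>2)"

definition bounded_between ::
  "('v::finite \<times> 'v) set \<Rightarrow> ('v \<times> 'v \<Rightarrow> real) \<Rightarrow> real \<Rightarrow> real \<Rightarrow> 'v network_fun \<Rightarrow> bool" where
  "bounded_between E l C0 C1 w \<longleftrightarrow>
     (\<forall>e\<in>E. AE x in lborel. x \<in> {0..l e} \<longrightarrow> C0 \<le> rep_L2 (w $ e) x \<and> rep_L2 (w $ e) x \<le> C1)"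

section \<open>Evolution problems on networks\<close>

text \<open>
  Only the behaviour on the time interval \<open>(0, T)\<close>, up to null sets, matters for membership in
  \<open>W11_L2\<close>; the weak derivative in \<open>W11_norm\<close> is unique up to null sets.
\<close>

definition W11_L2 ::
  "('v::finite \<times> 'v) set \<Rightarrow> ('v \<times> 'v \<Rightarrow> real) \<Rightarrow> real \<Rightarrow> (real \<Rightarrow> 'v network_fun) set" where
  "W11_L2 E l T = {f. (AE t in lborel. t \<in> {0<..<T} \<longrightarrow> f t \<in> L2_network E l) \<and>
     (\<exists>g. has_weak_derivative f g 0 T)}"

definition W11_norm :: "real \<Rightarrow> (real \<Rightarrow> 'v::finite network_fun) \<Rightarrow> real" where
  "W11_norm T f = (LINT t:{0<..<T}|lborel. norm (f t)) +
     (LINT t:{0<..<T}|lborel. norm ((SOME g. has_weak_derivative f g 0 T) t))"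

definition time_derivative ::
  "real \<Rightarrow> (real \<Rightarrow> 'v::finite network_fun) \<Rightarrow> real \<Rightarrow> 'v network_fun" where
  "time_derivative T u t = vector_derivative u (at t within {0..T})"

definition solution_space ::
  "('v::finite \<times> 'v) set \<Rightarrow> ('v \<times> 'v \<Rightarrow> real) \<Rightarrow> real \<Rightarrow>
     ((real \<Rightarrow> 'v network_fun) \<times> (real \<Rightarrow> 'v network_fun)) set" where
  "solution_space E l T = {(u, p).
     (\<forall>t\<in>{0..T}. u differentiable (at t within {0..T}) \<and> p differentiable (at t within {0..T})) \<and>
     continuous_on {0..T} (time_derivative T u) \<and> continuous_on {0..T} (time_derivative T p) \<and>
     (\<forall>t\<in>{0..T}. u t \<in> H_div E l \<and> p t \<in> H1_0 E l) \<and>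
     (\<forall>t\<in>{0..T}. ((\<lambda>s. H1_norm E l (u s - u t)) \<longlongrightarrow> 0) (at t within {0..T}) \<and>
                 ((\<lambda>s. H1_norm E l (p s - p t)) \<longlongrightarrow> 0) (at t within {0..T}))}"

definition solution_norm ::
  "('v::finite \<times> 'v) set \<Rightarrow> ('v \<times> 'v \<Rightarrow> real) \<Rightarrow> real \<Rightarrow>
     (real \<Rightarrow> 'v network_fun) \<Rightarrow> (real \<Rightarrow> 'v network_fun) \<Rightarrow> real" where
  "solution_norm E l T u p =
     (SUP t\<in>{0..T}. norm (u t, p t)) +
     (SUP t\<in>{0..T}. norm (time_derivative T u t, time_derivative T p t)) +
     (SUP t\<in>{0..T}. sqrt ((H1_norm E l (u t))\<^sup>2 + (H1_norm E l (p t))\<^sup>2))"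

text \<open>
  The elements of \<open>W11_L2\<close> are classes modulo null sets in time, so the equations are required for
  almost every \<open>t\<close>. For the continuous representatives of \<open>f\<close> and \<open>g\<close> this is the same as all \<open>t\<close>.
\<close>

definition is_solution ::
  "('v::finite \<times> 'v) set \<Rightarrow> ('v \<times> 'v \<Rightarrow> real) \<Rightarrow> real \<Rightarrow>
     'v network_fun \<Rightarrow> 'v network_fun \<Rightarrow> 'v network_fun \<Rightarrow>
     'v network_fun \<Rightarrow> 'v network_fun \<Rightarrow> (real \<Rightarrow> 'v network_fun) \<Rightarrow> (real \<Rightarrow> 'v network_fun) \<Rightarrow>
     (real \<Rightarrow> 'v network_fun) \<Rightarrow> (real \<Rightarrow> 'v network_fun) \<Rightarrow> bool" where
  "is_solution E l T a b c u0 p0 f g u p \<longleftrightarrow>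
     (u, p) \<in> solution_space E l T \<and> u 0 = u0 \<and> p 0 = p0 \<and>
     (AE t in lborel. t \<in> {0<..<T} \<longrightarrow>
        (\<forall>e\<in>E. AE x in lborel. x \<in> {0..l e} \<longrightarrow>
           rep_L2 (c $ e) x * rep_L2 (time_derivative T u t $ e) x +
             rep_L2 (edge_derivative E l (p t) $ e) x + rep_L2 (a $ e) x * rep_L2 (u t $ e) x
             = rep_L2 (f t $ e) x \<and>
           rep_L2 (b $ e) x * rep_L2 (time_derivative T p t $ e) x +
             rep_L2 (edge_derivative E l (u t) $ e) x = rep_L2 (g t $ e) x))"

end

theory Submission
  imports Defs
begin

text \<open>
  The edgewise derivatives on $H(\mathrm{div})$ and on $H^1_0$ are the negative adjoints of each
  other: Green's formula gives one inclusion, and testing with bump functions and with edgewise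
  affine functions gives the other. Closedness and density then come for free, and the operator
  $A(u,p) = (-c^{-1}(\partial_x' p + a u), -b^{-1}\partial_x' u)$ is dissipative for the energy
  $(cu,u) + (bp,p)$. The range of $1 - hA$ is closed by coercivity, and a vector orthogonal to it
  would lie in the adjoint domain and have zero energy, so the resolvents exist, and their powers
  are uniformly bounded. The implicit Euler scheme with dyadic steps converges to the semigroup $S$.
  For $w' = A w + F$ with $F(t) = F_0 + \int_0^t F'$ the solution is the primitive of
  $z(t) = S(t)(A w_0 + F_0) + \int_0^t S(t-s) F'(s)\,ds$, which gives the regularity and the
  estimate. Uniqueness follows from the decay of the energy.
\<close>

section \<open>Bump functions and the lemma of du Bois-Reymond\<close>

text \<open>The time derivative z = w' formally solves z' = A z + F' with z(0) = A w0 + F0. A mild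
  solution of this equation is already enough, because w = w0 + int z is then continuously
  differentiable; z itself is never differentiated. This is where the integrable derivatives of the
  sources enter. The unbounded A cannot be moved under an integral. Membership in its graph is
  therefore expressed through the bounded operator \<open>J 1\<close>: (x, y) lies in the graph iff
  x = J 1 (x - y). The resolvents contract the energy, which is only equivalent to the square of the
  norm, with constants C0 and max C0 C1. The abstract theory therefore runs on the whole vector
  type: the derivative relations disregard what lies off the edges, the coefficients are truncated,
  and the solution is projected back at the end.\<close>

definition flat_exp :: "real poly \<Rightarrow> real \<Rightarrow> real" where
  "flat_exp p x = (if 0 < x then poly p (1 / x) * exp (- 1 / x) else 0)"

lemma poly_over_exp_tendsto_0: "((\<lambda>x. poly p x * exp (- x)) \<longlongrightarrow> (0 :: real)) at_top"
proof -
  have "((\<lambda>x. (\<Sum>i\<le>degree p. coeff p i * (x ^ i / exp x))) \<longlongrightarrow> (\<Sum>i\<le>degree p. coeff p i * (0 :: real))) at_top"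
    by (intro tendsto_intros tendsto_power_div_exp_0)
  then show ?thesis
    by (simp add: poly_altdef sum_distrib_right exp_minus divide_inverse mult.assoc)
qed

lemma flat_exp_tendsto_0: "(flat_exp p \<longlongrightarrow> 0) (at 0)"
proof (rule filterlim_split_at)
  have "((\<lambda>x. poly p (inverse x) * exp (- inverse x)) \<longlongrightarrow> 0) (at_right 0)"
    by (rule filterlim_compose[OF poly_over_exp_tendsto_0 filterlim_inverse_at_top_right])
  then show "(flat_exp p \<longlongrightarrow> 0) (at_right 0)"
    by (rule Lim_transform_eventually)
      (auto simp: eventually_at_filter flat_exp_def inverse_eq_divide)
  show "(flat_exp p \<longlongrightarrow> 0) (at_left 0)"
    by (rule tendsto_eventually) (auto simp: eventually_at_filter flat_exp_def)
qed

text \<open>The derivative of p(1/x) exp(-1/x) is q(1/x) exp(-1/x) with q(y) = y^2 (p(y) - p'(y)).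
  The polynomial parameter of \<open>flat_exp\<close> makes the family closed under
  differentiation.\<close>

definition flat_exp_deriv :: "real poly \<Rightarrow> real poly" where
  "flat_exp_deriv p = [:0, 0, 1:] * (p - pderiv p)"

lemma flat_exp_has_derivative:
  "(flat_exp p has_field_derivative flat_exp (flat_exp_deriv p) x) (at x)"
proof -
  consider "x < 0" | "x > 0" | "x = 0" by linarith
  then show ?thesis
  proof cases
    case 1
    have "((\<lambda>_. 0) has_field_derivative 0) (at x)" by simp
    from has_field_derivative_transform_within_open[OF this, of "{..<0}" "flat_exp p"] 1
    show ?thesis by (auto simp: flat_exp_def)
  next
    case 2
    have "((\<lambda>x. poly p (1 / x) * exp (- 1 / x)) has_field_derivative
       flat_exp (flat_exp_deriv p) x) (at x)"
      using 2 by (auto intro!: derivative_eq_intros DERIV_chain2[OF poly_DERIV]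
          simp: flat_exp_def flat_exp_deriv_def field_simps power2_eq_square)
    from has_field_derivative_transform_within_open[OF this, of "{0<..}" "flat_exp p"] 2
    show ?thesis by (auto simp: flat_exp_def)
  next
    case 3
    \<comment> \<open>At 0 the difference quotient belongs to the family again: dividing by the
      increment h multiplies the polynomial by its variable 1/h.\<close>
    have "(flat_exp (pCons 0 p) \<longlongrightarrow> 0) (at 0)"
      by (rule flat_exp_tendsto_0)
    then have "((\<lambda>h. (flat_exp p (0 + h) - flat_exp p 0) / h) \<longlongrightarrow> 0) (at 0)"
      by (rule Lim_transform_eventually) (auto simp: eventually_at_filter flat_exp_def)
    then show ?thesis
      using 3 by (simp add: DERIV_def flat_exp_def)
  qed
qed

text \<open>Smoothness by an invariant class: no formula for the k-th derivative is needed if all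
  functions of a class are differentiable and their derivatives stay in it.\<close>

lemma iterated_deriv_differentiable:
  assumes "f \<in> C"
    and "\<And>f x. f \<in> C \<Longrightarrow> f field_differentiable (at x)"
    and "\<And>f. f \<in> C \<Longrightarrow> deriv f \<in> C"
  shows "((deriv ^^ k) f) field_differentiable (at (x :: real))"
proof -
  have "(deriv ^^ k) f \<in> C"
    by (induction k) (auto intro: assms)
  then show ?thesis by (rule assms)
qed

text \<open>The product of two flat functions switches on at \<open>c\<close> and off at
  \<open>d\<close>. No normalisation is made: for growing \<open>m\<close> the values tend to 1
  inside the interval, so bumps approximate its indicator.\<close>

definition bump :: "real \<Rightarrow> real \<Rightarrow> real \<Rightarrow> real \<Rightarrow> real" where
  "bump m c d x = flat_exp 1 (m * (x - c)) * flat_exp 1 (m * (d - x))"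

fun flat_term :: "real \<times> real \<times> real \<times> real poly \<times> real poly \<Rightarrow> real \<Rightarrow> real" where
  "flat_term (m, c, d, p, q) x = flat_exp p (m * (x - c)) * flat_exp q (m * (d - x))"

text \<open>The product rule turns one product of flat functions into two of the same shape, so
  finite sums of them form the invariant class that \<open>iterated_deriv_differentiable\<close>
  asks for.\<close>

definition flat_sums :: "(real \<Rightarrow> real) set" where
  "flat_sums = range (\<lambda>ts x. \<Sum>t\<leftarrow>ts. flat_term t x)"

lemma flat_exp_smult: "flat_exp (smult r p) x = r * flat_exp p x"
  by (simp add: flat_exp_def)

lemma flat_sums_deriv:
  assumes "f \<in> flat_sums"
  obtains f' where "f' \<in> flat_sums" "\<And>x. (f has_field_derivative f' x) (at x)"
proof -
  obtain ts where ts: "f = (\<lambda>x. \<Sum>t\<leftarrow>ts. flat_term t x)"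
    using assms unfolding flat_sums_def by auto
  define D where "D t = (case t of (m :: real, c :: real, d :: real, p, q) \<Rightarrow>
    [(m, c, d, smult m (flat_exp_deriv p), q), (m, c, d, smult (- m) p, flat_exp_deriv q)])" for t
  have D: "(flat_term t has_field_derivative (\<Sum>s\<leftarrow>D t. flat_term s x)) (at x)" for t x
  proof -
    obtain m c d p q where t: "t = (m, c, d, p, q)" by (metis surj_pair)
    have 1: "((\<lambda>x. flat_exp p (m * (x - c))) has_field_derivative flat_exp (flat_exp_deriv p) (m * (x - c)) * m) (at x)"
      by (rule DERIV_chain2[OF flat_exp_has_derivative]) (auto intro!: derivative_eq_intros)
    have 2: "((\<lambda>x. flat_exp q (m * (d - x))) has_field_derivative flat_exp (flat_exp_deriv q) (m * (d - x)) * (- m)) (at x)"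
      by (rule DERIV_chain2[OF flat_exp_has_derivative]) (auto intro!: derivative_eq_intros)
    have 3: "flat_term t = (\<lambda>x. flat_exp p (m * (x - c)) * flat_exp q (m * (d - x)))"
      by (simp add: t fun_eq_iff)
    show ?thesis
      unfolding 3 using DERIV_mult[OF 1 2] by (simp add: t D_def flat_exp_smult mult_ac del: smult_minus_left)
  qed
  have "((\<lambda>x. \<Sum>t\<leftarrow>ts. flat_term t x) has_field_derivative
      (\<Sum>t\<leftarrow>concat (map D ts). flat_term t x)) (at x)" for x
    by (induction ts) (auto intro!: DERIV_add D)
  then show thesis
    by (intro that[of "\<lambda>x. \<Sum>t\<leftarrow>concat (map D ts). flat_term t x"]) (auto simp: flat_sums_def ts)
qed

lemma flat_sums_smooth:
  assumes "f \<in> flat_sums"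
  shows "((deriv ^^ k) f) field_differentiable (at x)"
proof (rule iterated_deriv_differentiable[OF assms])
  show "f field_differentiable (at x)" if "f \<in> flat_sums" for f x
    using flat_sums_deriv[OF that] by (metis field_differentiable_def)
  show "deriv f \<in> flat_sums" if f: "f \<in> flat_sums" for f
  proof -
    obtain f' where f': "f' \<in> flat_sums" "\<And>x. (f has_field_derivative f' x) (at x)"
      using flat_sums_deriv[OF f] by metis
    then have "deriv f = f'" by (auto intro: DERIV_imp_deriv)
    with f' show ?thesis by simp
  qed
qed

lemma bump_combination_in_flat_sums:
  "(\<lambda>x. r * bump m c d x + s * bump m' c' d' x) \<in> flat_sums"
proof -
  have "(\<lambda>x. r * bump m c d x + s * bump m' c' d' x)
    = (\<lambda>ts x. \<Sum>t\<leftarrow>ts. flat_term t x) [(m, c, d, smult r 1, 1), (m', c', d', smult s 1, 1)]"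
    by (simp only: fun_eq_iff flat_term.simps flat_exp_smult bump_def list.map sum_list.Cons sum_list.Nil) simp
  then show ?thesis unfolding flat_sums_def by blast
qed

lemmas bump_smooth = flat_sums_smooth[OF bump_combination_in_flat_sums[where r=1 and s=0], simplified]

lemma bump_bounds: "0 \<le> bump m c d x" "bump m c d x \<le> 1"
  by (auto simp: bump_def flat_exp_def intro!: mult_le_one)

lemma bump_pos: "0 < m \<Longrightarrow> c < x \<Longrightarrow> x < d \<Longrightarrow> 0 < bump m c d x"
  by (auto simp: bump_def flat_exp_def)

lemma bump_eq_0: "0 < m \<Longrightarrow> x \<notin> {c<..<d} \<Longrightarrow> bump m c d x = 0"
  by (auto simp: bump_def flat_exp_def zero_less_mult_iff)

lemma bump_tendsto_indicator:
  "(\<lambda>n. bump (real (Suc n)) c d x) \<longlonglongrightarrow> indicator {c<..<d} x"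
proof (cases "x \<in> {c<..<d}")
  case True
  have "(\<lambda>n. exp (- (1 / (x - c)) * (1 / real (Suc n))) * exp (- (1 / (d - x)) * (1 / real (Suc n))))
     \<longlonglongrightarrow> exp (- (1 / (x - c)) * 0) * exp (- (1 / (d - x)) * 0)"
    by (intro tendsto_intros LIMSEQ_Suc[OF lim_1_over_n])
  moreover have "bump (real (Suc n)) c d x
     = exp (- (1 / (x - c)) * (1 / real (Suc n))) * exp (- (1 / (d - x)) * (1 / real (Suc n)))" for n
    using True by (auto simp: bump_def flat_exp_def zero_less_mult_iff mult.commute)
  ultimately show ?thesis using True by simp
qed (simp add: bump_eq_0)

lemma bump_test_function:
  assumes "0 < m" "a < c" "d < b"
  shows "bump m c d \<in> test_functions a b"
proof -
  have "\<forall>x. x \<notin> {c..d} \<longrightarrow> bump m c d x = 0"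
    using bump_eq_0[OF assms(1)] by auto
  then show ?thesis
    unfolding test_functions_def using assms(2,3) bump_smooth by blast
qed

lemma bump_continuous: "continuous_on UNIV (bump m c d)"
  using bump_smooth[of 0 m c d]
  by (auto simp: continuous_on_eq_continuous_at intro: field_differentiable_imp_continuous_at)

section \<open>Elementary properties of test functions\<close>

lemma test_function_has_deriv:
  assumes "\<phi> \<in> test_functions a b"
  shows "(\<phi> has_field_derivative deriv \<phi> x) (at x)"
proof -
  have "((deriv ^^ 0) \<phi>) field_differentiable (at x)"
    using assms unfolding test_functions_def by blast
  then show ?thesis
    by (simp add: DERIV_deriv_iff_field_differentiable)
qed

lemma test_function_deriv_continuous:
  assumes "\<phi> \<in> test_functions a b"
  shows "continuous_on UNIV (deriv \<phi>)"
proof -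
  have "((deriv ^^ 1) \<phi>) field_differentiable (at x)" for x
    using assms unfolding test_functions_def by blast
  then show ?thesis
    by (auto simp: continuous_on_eq_continuous_at intro: field_differentiable_imp_continuous_at)
qed

lemma test_functionI:
  assumes "\<And>x. (\<phi> has_field_derivative \<eta> x) (at x)"
    and "\<And>k x. ((deriv ^^ k) \<eta>) field_differentiable (at x)"
    and "a < c" "d < b" "\<And>x. x \<notin> {c..d} \<Longrightarrow> \<phi> x = 0"
  shows "\<phi> \<in> test_functions a b"
proof -
  have "deriv \<phi> = \<eta>" using assms(1) by (auto intro: DERIV_imp_deriv)
  then have "((deriv ^^ k) \<phi>) field_differentiable (at x)" for k x
    using assms(1,2) by (cases k) (auto simp: field_differentiable_def funpow_Suc_right simp del: funpow.simps)
  then show ?thesis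
    unfolding test_functions_def using assms(3-5) by blast
qed

text \<open>The integrals of the cut-off function \<open>g\<close> over Borel sets are countably
  additive and vanish on closed intervals, hence on every Borel set; a density with this property is
  zero almost everywhere.\<close>

lemma AE_zero_if_interval_integrals_zero_aux:
  fixes f :: "real \<Rightarrow> 'a::{banach, second_countable_topology}"
  assumes f: "set_integrable lborel {c<..<d} f"
    and zero: "\<And>c' d'. c \<le> c' \<Longrightarrow> d' \<le> d \<Longrightarrow> c' < d' \<Longrightarrow> (LINT x:{c'<..<d'}|lborel. f x) = 0"
  shows "AE x in lborel. x \<in> {c<..<d} \<longrightarrow> f x = 0"
proof -
  define g where "g x = indicator {c<..<d} x *\<^sub>R f x" for x
  have g: "integrable lborel g"
    using f by (simp add: set_integrable_def g_def[abs_def])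
  have g_zero: "(LINT x:{a..b}|lborel. g x) = 0" for a b
  proof -
    have "(LINT x:{a..b}|lborel. g x) = (LINT x:{max a c<..<min b d}|lborel. f x)"
      unfolding set_lebesgue_integral_def
    proof (rule integral_cong_AE)
      show "AE x in lborel. indicator {a..b} x *\<^sub>R g x = indicator {max a c<..<min b d} x *\<^sub>R f x"
        using AE_lborel_singleton[of a] AE_lborel_singleton[of b]
        by eventually_elim (auto simp: g_def indicator_def)
      have "set_integrable lborel {max a c<..<min b d} f"
        by (rule set_integrable_subset[OF f]) auto
      then show "(\<lambda>x. indicator {max a c<..<min b d} x *\<^sub>R f x) \<in> borel_measurable lborel"
        by (simp add: set_integrable_def borel_measurable_integrable)
    qed (use g in measurable)
    also have "\<dots> = 0"
      using zero[of "max a c" "min b d"]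
      by (cases "max a c < min b d") (auto simp: set_lebesgue_integral_def)
    finally show ?thesis .
  qed
  have g_all: "(LINT x|lborel. g x) = 0"
  proof -
    have "(LINT x|lborel. g x) = (LINT x:{c..d}|lborel. g x)"
      unfolding set_lebesgue_integral_def
      by (rule Bochner_Integration.integral_cong) (auto simp: g_def indicator_def)
    then show ?thesis by (simp add: g_zero)
  qed
  have g_int: "set_integrable lborel A g" if "A \<in> sets borel" for A
    using that g by (simp add: set_integrable_def integrable_mult_indicator)
  have "set_lebesgue_integral lborel A g = 0" if "A \<in> sets lborel" for A
  proof -
    have "A \<in> sets borel" using that by simp
    then show ?thesis
    proof (induction A rule: borel_set_induct)
      case empty
      then show ?case by (simp add: set_lebesgue_integral_def)
    next
      case (compl A)
      have "(LINT x:A \<union> - A|lborel. g x) = (LINT x:A|lborel. g x) + (LINT x:- A|lborel. g x)"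
        using compl(1) by (intro set_integral_Un g_int) auto
      then show ?case
        using compl(2) g_all by (simp add: set_lebesgue_integral_def)
    next
      case (union h)
      have "set_lebesgue_integral lborel (\<Union>i. h i) g = (\<Sum>i. set_lebesgue_integral lborel (h i) g)"
        using union(1,2) by (intro lebesgue_integral_countable_add g_int)
          (auto simp: disjoint_family_on_def)
      then show ?case using union(3) by simp
    qed (rule g_zero)
  qed
  then have "AE x in lborel. g x = 0"
    by (intro sigma_finite_measure.density_zero[OF sigma_finite_lborel] g)
  then show ?thesis
    by eventually_elim (auto simp: g_def)
qed

text \<open>Bumps supported inside (a, b) only control intervals that stay away from the ends. The
  previous lemma is applied on (a + 1/n, b - 1/n), and countably many of these exhaust (a,
  b).\<close>

lemma AE_zero_if_interval_integrals_zero: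
  fixes f :: "real \<Rightarrow> 'a::{banach, second_countable_topology}"
  assumes f: "set_integrable lborel {a<..<b} f"
    and zero: "\<And>c d. a < c \<Longrightarrow> d < b \<Longrightarrow> c < d \<Longrightarrow> (LINT x:{c<..<d}|lborel. f x) = 0"
  shows "AE x in lborel. x \<in> {a<..<b} \<longrightarrow> f x = 0"
proof -
  have "AE x in lborel. x \<in> {a + e<..<b - e} \<longrightarrow> f x = 0" if "0 < e" for e
    using that by (intro AE_zero_if_interval_integrals_zero_aux)
      (auto intro!: set_integrable_subset[OF f] zero)
  from this[of "1 / Suc _"]
  have "AE x in lborel. \<forall>n. x \<in> {a + 1 / Suc n<..<b - 1 / Suc n} \<longrightarrow> f x = 0"
    unfolding AE_all_countable by (intro allI) simp
  then show ?thesis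
  proof eventually_elim
    case (elim x)
    show ?case
    proof
      assume "x \<in> {a<..<b}"
      then obtain n where "1 / real (Suc n) < min (x - a) (b - x)"
        using nat_approx_posE[of "min (x - a) (b - x)"] by auto
      then show "f x = 0" using elim[rule_format, of n] by auto
    qed
  qed
qed

lemma set_integrable_bounded_scaleR:
  fixes f :: "real \<Rightarrow> 'a::{banach, second_countable_topology}" and \<phi> :: "real \<Rightarrow> real"
  assumes "set_integrable lborel A f" "\<phi> \<in> borel_measurable borel" "A \<in> sets borel" "\<And>x. x \<in> A \<Longrightarrow> \<bar>\<phi> x\<bar> \<le> B"
  shows "set_integrable lborel A (\<lambda>x. \<phi> x *\<^sub>R f x)"
  unfolding set_integrable_def
proof (rule Bochner_Integration.integrable_bound)
  show "integrable lborel (\<lambda>x. B *\<^sub>R indicator A x *\<^sub>R f x)"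
    using assms(1) unfolding set_integrable_def by (rule integrable_scaleR_right)
  have "(\<lambda>x. indicator A x *\<^sub>R f x) \<in> borel_measurable lborel"
    using assms(1) unfolding set_integrable_def by (rule borel_measurable_integrable)
  then have "(\<lambda>x. \<phi> x *\<^sub>R (indicator A x *\<^sub>R f x)) \<in> borel_measurable lborel"
    using assms(2) by measurable
  then show "(\<lambda>x. indicator A x *\<^sub>R \<phi> x *\<^sub>R f x) \<in> borel_measurable lborel"
    by (simp add: mult.commute)
  show "AE x in lborel. norm (indicator A x *\<^sub>R \<phi> x *\<^sub>R f x) \<le> norm (B *\<^sub>R indicator A x *\<^sub>R f x)"
  proof (rule AE_I2)
    fix x
    show "norm (indicator A x *\<^sub>R \<phi> x *\<^sub>R f x) \<le> norm (B *\<^sub>R indicator A x *\<^sub>R f x)"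
    proof (cases "x \<in> A")
      case True
      then have "\<bar>\<phi> x\<bar> \<le> \<bar>B\<bar>" using assms(4) by force
      then show ?thesis using True by (simp add: mult_right_mono)
    qed simp
  qed
qed

lemma test_function_continuous:
  assumes "\<phi> \<in> test_functions a b"
  shows "continuous_on A \<phi>" "continuous_on A (deriv \<phi>)"
proof -
  have "continuous_on UNIV \<phi>"
    using test_function_has_deriv[OF assms] by (blast intro: DERIV_continuous_on)
  then show "continuous_on A \<phi>" "continuous_on A (deriv \<phi>)"
    using test_function_deriv_continuous[OF assms] by (auto intro: continuous_on_subset)
qed

lemma test_function_bounded:
  assumes "\<phi> \<in> test_functions a b"
  obtains B where "\<And>x. x \<in> {a..b} \<Longrightarrow> \<bar>\<phi> x\<bar> \<le> B" "\<And>x. x \<in> {a..b} \<Longrightarrow> \<bar>deriv \<phi> x\<bar> \<le> B"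
proof -
  have "bounded (\<phi> ` {a..b})" "bounded (deriv \<phi> ` {a..b})"
    using test_function_continuous[OF assms] by (auto intro!: compact_imp_bounded compact_continuous_image)
  then obtain B1 B2 where "\<forall>x\<in>{a..b}. \<bar>\<phi> x\<bar> \<le> B1" "\<forall>x\<in>{a..b}. \<bar>deriv \<phi> x\<bar> \<le> B2"
    by (auto simp: bounded_iff)
  then show thesis
    by (intro that[of "max B1 B2"]) force+
qed

lemma test_function_measurable:
  assumes "\<phi> \<in> test_functions a b"
  shows "\<phi> \<in> borel_measurable borel" "deriv \<phi> \<in> borel_measurable borel"
  using test_function_continuous[OF assms] by (blast intro: borel_measurable_continuous_onI)+

lemma test_function_integrable_scaleR:
  fixes f :: "real \<Rightarrow> 'a::{banach, second_countable_topology}"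
  assumes "\<phi> \<in> test_functions a b" "set_integrable lborel {a<..<b} f"
  shows "set_integrable lborel {a<..<b} (\<lambda>x. \<phi> x *\<^sub>R f x)"
    "set_integrable lborel {a<..<b} (\<lambda>x. deriv \<phi> x *\<^sub>R f x)"
proof -
  obtain B where B: "\<And>x. x \<in> {a..b} \<Longrightarrow> \<bar>\<phi> x\<bar> \<le> B" "\<And>x. x \<in> {a..b} \<Longrightarrow> \<bar>deriv \<phi> x\<bar> \<le> B"
    using test_function_bounded[OF assms(1)] by metis
  show "set_integrable lborel {a<..<b} (\<lambda>x. \<phi> x *\<^sub>R f x)"
    by (rule set_integrable_bounded_scaleR[OF assms(2) test_function_measurable(1)[OF assms(1)], of B])
      (use B in auto)
  show "set_integrable lborel {a<..<b} (\<lambda>x. deriv \<phi> x *\<^sub>R f x)"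
    by (rule set_integrable_bounded_scaleR[OF assms(2) test_function_measurable(2)[OF assms(1)], of B])
      (use B in auto)
qed

lemma bump_integrable: "integrable lborel (bump (real (Suc n)) c d)"
proof -
  have "set_integrable lborel {c..d} (bump (real (Suc n)) c d)"
    unfolding set_integrable_def
    by (rule borel_integrable_compact) (auto intro: continuous_on_subset[OF bump_continuous])
  moreover have "(\<lambda>x. indicator {c..d} x *\<^sub>R bump (real (Suc n)) c d x) = bump (real (Suc n)) c d"
  proof
    fix x show "indicator {c..d} x *\<^sub>R bump (real (Suc n)) c d x = bump (real (Suc n)) c d x"
      using bump_eq_0[of "real (Suc n)" x c d] by (cases "x \<in> {c<..<d}") auto
  qed
  ultimately show ?thesis by (simp only: set_integrable_def)
qed

lemma bump_integral_pos:
  assumes "c < d"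
  shows "0 < (LINT x|lborel. bump (real (Suc n)) c d x)"
proof -
  have "0 \<noteq> (LINT x|lborel. bump (real (Suc n)) c d x)"
  proof
    assume "0 = (LINT x|lborel. bump (real (Suc n)) c d x)"
    then have "AE x in lborel. bump (real (Suc n)) c d x = 0"
      using integral_nonneg_eq_0_iff_AE[OF bump_integrable] bump_bounds(1) by simp
    then have "AE x in lborel. x \<notin> {c<..<d}"
      by eventually_elim (use bump_pos[of "real (Suc n)" c _ d] in fastforce)
    then have "emeasure lborel {c<..<d} = 0"
      by (subst (asm) AE_iff_measurable[of "{c<..<d}"]) auto
    then show False using assms by simp
  qed
  then show ?thesis
    using Bochner_Integration.integral_nonneg[of lborel "bump (real (Suc n)) c d"] bump_bounds(1) by (simp add: order.strict_iff_order)
qed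

text \<open>A function with compact support is the derivative of a test function if it is smooth and
  has integral zero; \<open>r\<close> balances the masses of the two bumps.\<close>

lemma bump_difference_antiderivative:
  fixes n :: nat
  assumes "a < c" "d < b" "a < c'" "d' < b" "c < d" "c' < d'"
  defines "r \<equiv> (LINT x|lborel. bump (real (Suc n)) c d x) / (LINT x|lborel. bump 1 c' d' x)"
  obtains \<phi> where "\<phi> \<in> test_functions a b" "deriv \<phi> = (\<lambda>x. bump (real (Suc n)) c d x - r * bump 1 c' d' x)"
proof -
  define h where "h x = bump (real (Suc n)) c d x - r * bump 1 c' d' x" for x
  have h_cont: "continuous_on UNIV h"
    unfolding h_def by (intro continuous_intros bump_continuous)
  have "\<exists>F. \<forall>x. - \<infinity> < ereal x \<longrightarrow> ereal x < \<infinity> \<longrightarrow> (F has_vector_derivative h x) (at x)"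
    using h_cont by (intro einterval_antiderivative) (auto simp: continuous_on_eq_continuous_at)
  then obtain F where F: "\<And>x. (F has_field_derivative h x) (at x)"
    by (auto simp: has_real_derivative_iff_has_vector_derivative)
  define lo hi where "lo = min c c'" and "hi = max d d'"
  have lohi: "lo < hi" using assms(5,6) unfolding lo_def hi_def by linarith
  have h0: "h x = 0" if "x \<notin> {lo<..<hi}" for x
  proof -
    have "x \<notin> {c<..<d}" "x \<notin> {c'<..<d'}" using that by (auto simp: lo_def hi_def)
    then show ?thesis by (simp add: h_def bump_eq_0 del: of_nat_Suc greaterThanLessThan_iff)
  qed
  have int1: "integrable lborel (bump 1 c' d')"
    using bump_integrable[of 0 c' d'] by simp
  \<comment> \<open>The interval from \<open>lo\<close> to \<open>hi\<close> contains both supports,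
    so this is the full integral, which is zero by the choice of \<open>r\<close>. Hence F has the
    same constant value on both sides of the interval and F - F lo has compact support.\<close>
  have "F hi - F lo = (LINT x|lborel. indicator {lo..hi} x *\<^sub>R h x)"
    using lohi F h_cont by (intro integral_FTC_atLeastAtMost[symmetric])
      (auto simp: has_real_derivative_iff_has_vector_derivative
        intro: has_vector_derivative_at_within continuous_on_subset)
  also have "\<dots> = (LINT x|lborel. h x)"
  proof (rule Bochner_Integration.integral_cong)
    fix x show "indicator {lo..hi} x *\<^sub>R h x = h x"
      using h0[of x] by (cases "x \<in> {lo<..<hi}") auto
  qed simp
  also have "\<dots> = 0"
    using bump_integral_pos[of c' d' 0] assms(6) bump_integrable[of n c d] int1
    by (simp add: h_def r_def)
  finally have hilo: "F hi = F lo" by simp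
  have left: "F x = F lo" if "x \<le> lo" for x
  proof (cases "x = lo")
    case False
    with that have "x < lo" by simp
    from MVT2[OF this, of F h] F obtain z where "x < z" "z < lo" "F lo - F x = (lo - x) * h z" by blast
    with h0[of z] show ?thesis by simp
  qed simp
  have right: "F x = F hi" if "hi \<le> x" for x
  proof (cases "x = hi")
    case False
    with that have "hi < x" by simp
    from MVT2[OF this, of F h] F obtain z where "hi < z" "z < x" "F x - F hi = (x - hi) * h z" by blast
    with h0[of z] show ?thesis by simp
  qed simp
  have D: "((\<lambda>x. F x - F lo) has_field_derivative h x) (at x)" for x
    using DERIV_diff[OF F[of x] DERIV_const[of "F lo"]] by simp
  have "h = (\<lambda>x. 1 * bump (real (Suc n)) c d x + (- r) * bump 1 c' d' x)"
    by (simp add: h_def fun_eq_iff)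
  then have "h \<in> flat_sums" by (simp only: bump_combination_in_flat_sums)
  then have "(\<lambda>x. F x - F lo) \<in> test_functions a b"
  proof (intro test_functionI[OF D flat_sums_smooth, of a lo hi b])
    show "a < lo" "hi < b" using assms(1-4) by (auto simp: lo_def hi_def)
    show "F x - F lo = 0" if "x \<notin> {lo..hi}" for x
      using that left[of x] right[of x] hilo by (cases "x \<le> lo") auto
  qed
  moreover have "deriv (\<lambda>x. F x - F lo) = h"
    using D by (auto intro: DERIV_imp_deriv)
  ultimately show thesis
    by (intro that) (auto simp: h_def[abs_def] simp del: of_nat_Suc)
qed

text \<open>A bump minus a suitable multiple of one fixed bump \<theta> is the derivative of a test
  function. The hypothesis then says that every bump integrates k - C to zero, and sharpening the
  bumps gives the same for intervals.\<close>

lemma du_Bois_Reymond: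
  fixes k :: "real \<Rightarrow> 'a::{banach, second_countable_topology}"
  assumes "a < b" and k: "set_integrable lborel {a<..<b} k"
    and zero: "\<And>\<phi>. \<phi> \<in> test_functions a b \<Longrightarrow> (LINT x:{a<..<b}|lborel. deriv \<phi> x *\<^sub>R k x) = 0"
  obtains C where "AE x in lborel. x \<in> {a<..<b} \<longrightarrow> k x = C"
proof -
  define c' d' where "c' = (2 * a + b) / 3" and "d' = (a + 2 * b) / 3"
  have cd': "a < c'" "c' < d'" "d' < b" using assms(1) by (auto simp: c'_def d'_def)
  define \<theta> where "\<theta> = bump 1 c' d'"
  have \<theta>_test: "\<theta> \<in> test_functions a b"
    unfolding \<theta>_def using cd' by (intro bump_test_function) auto
  \<comment> \<open>The mean of k with weight \<theta>, the only constant for which the integral of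
    \<theta> (k - C) vanishes.\<close>
  define C where "C = (1 / (LINT x|lborel. \<theta> x)) *\<^sub>R (LINT x:{a<..<b}|lborel. \<theta> x *\<^sub>R k x)"
  have const_int: "set_integrable lborel {a<..<b} (\<lambda>x. C)"
    unfolding set_integrable_def by (intro integrable_scaleR_left integrable_real_indicator) (auto simp: assms(1) less_imp_le)
  have kC: "set_integrable lborel {a<..<b} (\<lambda>x. k x - C)"
    by (rule set_integral_diff(1)[OF k const_int])
  have bump0: "(LINT x:{a<..<b}|lborel. bump (real (Suc n)) c d x *\<^sub>R (k x - C)) = 0"
    if cd: "a < c" "d < b" "c < d" for n c d
  proof -
    define \<eta> where "\<eta> = bump (real (Suc n)) c d"
    define r where "r = (LINT x|lborel. \<eta> x) / (LINT x|lborel. \<theta> x)"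
    have \<eta>_test: "\<eta> \<in> test_functions a b"
      unfolding \<eta>_def using cd by (intro bump_test_function) auto
    obtain \<phi> where \<phi>: "\<phi> \<in> test_functions a b" "deriv \<phi> = (\<lambda>x. \<eta> x - r * \<theta> x)"
      using bump_difference_antiderivative[OF cd(1,2) cd'(1,3) cd(3) cd'(2), of n]
      unfolding r_def \<eta>_def \<theta>_def by blast
    note int = test_function_integrable_scaleR(1)[OF \<eta>_test k] test_function_integrable_scaleR(1)[OF \<theta>_test k]
      test_function_integrable_scaleR(1)[OF \<eta>_test const_int]
    have "0 = (LINT x:{a<..<b}|lborel. deriv \<phi> x *\<^sub>R k x)"
      using zero[OF \<phi>(1)] by simp
    also have "\<dots> = (LINT x:{a<..<b}|lborel. \<eta> x *\<^sub>R k x - r *\<^sub>R (\<theta> x *\<^sub>R k x))"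
      by (simp add: \<phi>(2) algebra_simps)
    also have "\<dots> = (LINT x:{a<..<b}|lborel. \<eta> x *\<^sub>R k x) - r *\<^sub>R (LINT x:{a<..<b}|lborel. \<theta> x *\<^sub>R k x)"
      by (simp only: set_integral_diff(2)[OF int(1) set_integrable_scaleR_right[OF int(2)]] set_integral_scaleR_right)
    also have "r *\<^sub>R (LINT x:{a<..<b}|lborel. \<theta> x *\<^sub>R k x) = (LINT x|lborel. \<eta> x) *\<^sub>R C"
      by (simp add: r_def C_def)
    also have "(LINT x|lborel. \<eta> x) *\<^sub>R C = (LINT x:{a<..<b}|lborel. \<eta> x *\<^sub>R C)"
    proof -
      have "(LINT x:{a<..<b}|lborel. \<eta> x *\<^sub>R C) = (LINT x|lborel. \<eta> x *\<^sub>R C)"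
        unfolding set_lebesgue_integral_def
      proof (rule Bochner_Integration.integral_cong)
        fix x show "indicator {a<..<b} x *\<^sub>R \<eta> x *\<^sub>R C = \<eta> x *\<^sub>R C"
          using bump_eq_0[of "real (Suc n)" x c d] cd by (cases "x \<in> {a<..<b}") (auto simp: \<eta>_def)
      qed simp
      then show ?thesis
        using bump_integrable[of n c d] by (simp add: \<eta>_def)
    qed
    finally show ?thesis
      by (simp only: \<eta>_def[symmetric] scaleR_diff_right set_integral_diff(2)[OF int(1) int(3)] diff_self)
  qed
  have "AE x in lborel. x \<in> {a<..<b} \<longrightarrow> k x - C = 0"
  proof (rule AE_zero_if_interval_integrals_zero[OF kC])
    fix c d assume cd: "a < c" "d < b" "c < d"
    have m: "(\<lambda>x. indicator {a<..<b} x *\<^sub>R (k x - C)) \<in> borel_measurable lborel"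
      using kC unfolding set_integrable_def by (rule borel_measurable_integrable)
    \<comment> \<open>The bumps stay between 0 and 1 and tend to the indicator of (c, d), so the
      norm of k - C on (a, b) dominates.\<close>
    have "(\<lambda>n. LINT x|lborel. bump (real (Suc n)) c d x *\<^sub>R (indicator {a<..<b} x *\<^sub>R (k x - C)))
      \<longlonglongrightarrow> (LINT x|lborel. indicator {c<..<d} x *\<^sub>R (indicator {a<..<b} x *\<^sub>R (k x - C)))"
    proof (rule integral_dominated_convergence)
      show "integrable lborel (\<lambda>x. norm (indicator {a<..<b} x *\<^sub>R (k x - C)))"
        using kC unfolding set_integrable_def by (rule integrable_norm)
      show "AE x in lborel. (\<lambda>n. bump (real (Suc n)) c d x *\<^sub>R indicator {a<..<b} x *\<^sub>R (k x - C))
         \<longlonglongrightarrow> indicator {c<..<d} x *\<^sub>R indicator {a<..<b} x *\<^sub>R (k x - C)"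
        by (intro AE_I2 tendsto_scaleR bump_tendsto_indicator tendsto_const)
      show "AE x in lborel. norm (bump (real (Suc n)) c d x *\<^sub>R indicator {a<..<b} x *\<^sub>R (k x - C))
         \<le> norm (indicator {a<..<b} x *\<^sub>R (k x - C))" for n
      proof (rule AE_I2)
        fix x
        show "norm (bump (real (Suc n)) c d x *\<^sub>R indicator {a<..<b} x *\<^sub>R (k x - C))
         \<le> norm (indicator {a<..<b} x *\<^sub>R (k x - C))"
          using mult_right_mono[OF bump_bounds(2)[of "real (Suc n)" c d x], of "norm (indicator {a<..<b} x *\<^sub>R (k x - C))"]
            bump_bounds(1)[of "real (Suc n)" c d x] by (simp del: of_nat_Suc)
      qed
      have "bump (real (Suc n)) c d \<in> borel_measurable lborel" for n
        using bump_integrable by (rule borel_measurable_integrable)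
      then show "(\<lambda>x. bump (real (Suc n)) c d x *\<^sub>R indicator {a<..<b} x *\<^sub>R (k x - C)) \<in> borel_measurable lborel" for n
        using m by measurable
      show "(\<lambda>x. indicator {c<..<d} x *\<^sub>R indicator {a<..<b} x *\<^sub>R (k x - C)) \<in> borel_measurable lborel"
        using m by measurable
    qed
    moreover have "(LINT x|lborel. bump (real (Suc n)) c d x *\<^sub>R (indicator {a<..<b} x *\<^sub>R (k x - C))) = 0" for n
      using bump0[OF cd, of n] by (simp add: set_lebesgue_integral_def mult.commute del: of_nat_Suc)
    ultimately have "(LINT x|lborel. indicator {c<..<d} x *\<^sub>R (indicator {a<..<b} x *\<^sub>R (k x - C))) = 0"
      by (simp add: LIMSEQ_const_iff del: of_nat_Suc)
    moreover have "(\<lambda>x. indicator {c<..<d} x *\<^sub>R (indicator {a<..<b} x *\<^sub>R (k x - C)))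
        = (\<lambda>x. indicator {c<..<d} x *\<^sub>R (k x - C))"
      using cd by (auto simp: indicator_def fun_eq_iff)
    ultimately show "(LINT x:{c<..<d}|lborel. k x - C) = 0"
      by (simp only: set_lebesgue_integral_def)
  qed
  then show thesis by (intro that[of C]) auto
qed

section \<open>Primitives and weak derivatives\<close>

text \<open>For x \<le> a the interval is empty and the value is 0; unlike an oriented integral it
  does not change sign. All uses start at the left end of an interval.\<close>

definition prim :: "(real \<Rightarrow> 'a::{banach, second_countable_topology}) \<Rightarrow> real \<Rightarrow> real \<Rightarrow> 'a" where
  "prim g a x = (LINT y:{a<..<x}|lborel. g y)"

text \<open>The integrand may depend on the upper limit as well, so this covers both primitives and
  the convolution integral of a mild solution. For s different from t the indicators are eventually
  constant, so dominated convergence only loses the point t.\<close>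

lemma continuous_on_truncated_integral:
  fixes \<Phi> :: "real \<Rightarrow> real \<Rightarrow> 'a::{banach, second_countable_topology}"
  assumes meas: "\<And>t. \<Phi> t \<in> borel_measurable lborel"
    and cont: "\<And>s. continuous_on UNIV (\<lambda>t. \<Phi> t s)"
    and bound: "\<And>t s. norm (\<Phi> t s) \<le> w s" and w: "integrable lborel w"
  shows "continuous_on UNIV (\<lambda>t. LINT s:{a<..<t}|lborel. \<Phi> t s)"
  unfolding continuous_on_sequentially
proof (intro allI impI ballI, unfold o_def)
  fix X :: "nat \<Rightarrow> real" and t assume "(\<forall>n. X n \<in> UNIV) \<and> X \<longlonglongrightarrow> t"
  then have X: "X \<longlonglongrightarrow> t" by simp
  show "(\<lambda>n. LINT s:{a<..<X n}|lborel. \<Phi> (X n) s) \<longlonglongrightarrow> (LINT s:{a<..<t}|lborel. \<Phi> t s)"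
    unfolding set_lebesgue_integral_def
  proof (rule integral_dominated_convergence[OF _ _ w])
    show "(\<lambda>s. indicator {a<..<t} s *\<^sub>R \<Phi> t s) \<in> borel_measurable lborel" for t
      using meas[of t] by measurable
    then show "(\<lambda>s. indicator {a<..<X n} s *\<^sub>R \<Phi> (X n) s) \<in> borel_measurable lborel" for n .
    show "AE s in lborel. norm (indicator {a<..<X n} s *\<^sub>R \<Phi> (X n) s) \<le> w s" for n
      using bound order_trans[OF norm_ge_zero bound] by (intro AE_I2) (auto simp: indicator_def)
    show "AE s in lborel. (\<lambda>n. indicator {a<..<X n} s *\<^sub>R \<Phi> (X n) s)
        \<longlonglongrightarrow> indicator {a<..<t} s *\<^sub>R \<Phi> t s"
      using AE_lborel_singleton[of t]
    proof eventually_elim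
      case (elim s)
      have "(\<lambda>n. indicator {a<..<X n} s :: real) \<longlonglongrightarrow> indicator {a<..<t} s"
      proof (rule tendsto_eventually)
        consider "s < t" | "t < s" using elim by linarith
        then show "\<forall>\<^sub>F n in sequentially. indicator {a<..<X n} s = (indicator {a<..<t} s :: real)"
        proof cases
          case 1
          show ?thesis using order_tendstoD(1)[OF X 1] by eventually_elim (use 1 in \<open>auto simp: indicator_def\<close>)
        next
          case 2
          show ?thesis using order_tendstoD(2)[OF X 2] by eventually_elim (use 2 in \<open>auto simp: indicator_def\<close>)
        qed
      qed
      moreover have "(\<lambda>n. \<Phi> (X n) s) \<longlonglongrightarrow> \<Phi> t s"
        using cont[of s] X by (simp add: continuous_on_sequentially o_def)
      ultimately show ?case by (rule tendsto_scaleR)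
    qed
  qed
qed

lemma prim_continuous:
  assumes "integrable lborel g"
  shows "continuous_on A (prim g a)"
proof -
  have "continuous_on UNIV (prim g a)"
    unfolding prim_def
    using assms by (intro continuous_on_truncated_integral[where w="\<lambda>x. norm (g x)"]) auto
  then show ?thesis by (rule continuous_on_subset) simp
qed

lemma prim_start [simp]: "prim g a a = 0"
  by (simp add: prim_def set_lebesgue_integral_def)

lemma norm_prim_le:
  assumes "integrable lborel g"
  shows "norm (prim g a x) \<le> (LINT y|lborel. norm (g y))"
proof -
  have "norm (prim g a x) \<le> (LINT y|lborel. norm (indicator {a<..<x} y *\<^sub>R g y))"
    unfolding prim_def set_lebesgue_integral_def by (rule integral_norm_bound)
  also have "\<dots> \<le> (LINT y|lborel. norm (g y))"
    using assms by (intro integral_mono integrable_norm integrable_mult_indicator) (auto simp: indicator_def)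
  finally show ?thesis .
qed

lemma prim_cong:
  assumes "\<And>y. a < y \<Longrightarrow> y < x \<Longrightarrow> f y = g y"
  shows "prim f a x = prim g a x"
  unfolding prim_def set_lebesgue_integral_def
  using assms by (intro Bochner_Integration.integral_cong) (auto simp: indicator_def)

lemma prim_indicator: "x \<le> b \<Longrightarrow> prim (\<lambda>x. indicator {a<..<b} x *\<^sub>R f x) a x = prim f a x"
  by (rule prim_cong) simp

text \<open>
  Both sides are the integral of $f(x) g(y)$ over a square, which the diagonal splits into
  two triangles.
\<close>

lemma prim_mult_prim:
  fixes f :: "real \<Rightarrow> real" and g :: "real \<Rightarrow> 'a::{banach, second_countable_topology}"
  assumes f: "integrable lborel f" and g: "integrable lborel g"
  shows "integrable lborel (\<lambda>x. f x *\<^sub>R prim g a x)" "integrable lborel (\<lambda>x. prim f a x *\<^sub>R g x)"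
    and "(LINT x:{a<..<b}|lborel. f x *\<^sub>R prim g a x) + (LINT x:{a<..<b}|lborel. prim f a x *\<^sub>R g x)
      = prim f a b *\<^sub>R prim g a b"
proof -
  have [measurable]: "f \<in> borel_measurable borel" "g \<in> borel_measurable borel"
    using f g by (simp_all add: borel_measurable_integrable)
  have [measurable]: "prim f a \<in> borel_measurable borel" "prim g a \<in> borel_measurable borel"
    using prim_continuous[OF f] prim_continuous[OF g] by (auto intro: borel_measurable_continuous_onI)
  have [simp]: "integrable lborel (\<lambda>x. norm (f x))" "integrable lborel (\<lambda>x. norm (g x))"
    "integrable lborel (\<lambda>x. \<bar>f x\<bar>)"
    using f g by (auto intro: integrable_norm)
  show "integrable lborel (\<lambda>x. f x *\<^sub>R prim g a x)"
  proof (rule Bochner_Integration.integrable_bound)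
    show "integrable lborel (\<lambda>x. norm (f x) * (LINT y|lborel. norm (g y)))" by simp
    have "0 \<le> (LINT y|lborel. norm (g y))" by simp
    then show "AE x in lborel. norm (f x *\<^sub>R prim g a x) \<le> norm (norm (f x) * (LINT y|lborel. norm (g y)))"
      using norm_prim_le[OF g, of a] by (intro AE_I2) (simp add: abs_mult mult_left_mono)
  qed measurable
  show "integrable lborel (\<lambda>x. prim f a x *\<^sub>R g x)"
  proof (rule Bochner_Integration.integrable_bound)
    show "integrable lborel (\<lambda>x. (LINT y|lborel. norm (f y)) * norm (g x))" by simp
    have "0 \<le> (LINT y|lborel. norm (f y))" by simp
    then show "AE x in lborel. norm (prim f a x *\<^sub>R g x) \<le> norm ((LINT y|lborel. norm (f y)) * norm (g x))"
      using norm_prim_le[OF f, of a] by (intro AE_I2) (simp add: abs_mult mult_right_mono)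
  qed measurable
  define f1 g1 where "f1 x = indicator {a<..<b} x *\<^sub>R f x" and "g1 x = indicator {a<..<b} x *\<^sub>R g x" for x
  have [measurable]: "f1 \<in> borel_measurable borel" "g1 \<in> borel_measurable borel"
    unfolding f1_def g1_def by measurable
  have f1: "integrable lborel f1" and g1: "integrable lborel g1"
    unfolding f1_def g1_def using f g by (auto intro!: integrable_mult_indicator[where f=f, simplified] integrable_mult_indicator)
  have [simp]: "integrable lborel (\<lambda>x. \<bar>f1 x\<bar>)" "integrable lborel (\<lambda>x. norm (g1 x))"
    using f1 g1 by (auto intro: integrable_norm)
  define h where "h Q x y = indicator {(x, y). Q x y} (x, y) *\<^sub>R (f1 x *\<^sub>R g1 y)" for Q :: "real \<Rightarrow> real \<Rightarrow> bool" and x y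
  have h_int: "integrable (lborel \<Otimes>\<^sub>M lborel) (\<lambda>(x, y). h Q x y)"
    if [measurable]: "Measurable.pred (borel \<Otimes>\<^sub>M borel) (\<lambda>(x, y). Q x y)" for Q
  proof -
    have m: "(\<lambda>(x, y). f1 x *\<^sub>R g1 y) \<in> borel_measurable (lborel \<Otimes>\<^sub>M lborel)"
      by measurable
    have "integrable (lborel \<Otimes>\<^sub>M lborel) (\<lambda>(x, y). f1 x *\<^sub>R g1 y)"
    proof (rule lborel_pair.Fubini_integrable[OF m])
      show "integrable lborel (\<lambda>x. LINT y|lborel. norm (case (x, y) of (x, y) \<Rightarrow> f1 x *\<^sub>R g1 y))"
        by simp
      show "AE x in lborel. integrable lborel (\<lambda>y. case (x, y) of (x, y) \<Rightarrow> f1 x *\<^sub>R g1 y)"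
        using g1 by simp
    qed
    then have "integrable (lborel \<Otimes>\<^sub>M lborel) (\<lambda>z. indicator {(x, y). Q x y} z *\<^sub>R (case z of (x, y) \<Rightarrow> f1 x *\<^sub>R g1 y))"
    proof (rule integrable_mult_indicator[rotated])
      show "{(x, y). Q x y} \<in> sets (lborel \<Otimes>\<^sub>M lborel)"
        using that by (simp add: pred_def space_pair_measure case_prod_beta')
    qed
    then show ?thesis
      by (simp add: h_def case_prod_beta')
  qed
  define L U where "L = h (\<lambda>x y. y < x)" and "U = h (\<lambda>x y. x < y)"
  have L: "integrable (lborel \<Otimes>\<^sub>M lborel) (\<lambda>(x, y). L x y)" and U: "integrable (lborel \<Otimes>\<^sub>M lborel) (\<lambda>(x, y). U x y)"
    unfolding L_def U_def by (rule h_int; measurable)+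
  have Lx: "(LINT y|lborel. L x y) = f1 x *\<^sub>R prim g a x" for x
  proof -
    have "L x y = f1 x *\<^sub>R (indicator {a<..<x} y *\<^sub>R g y)" for y
      by (auto simp: L_def h_def f1_def g1_def indicator_def)
    then show ?thesis by (simp add: prim_def set_lebesgue_integral_def del: scaleR_scaleR)
  qed
  have Uy: "(LINT x|lborel. U x y) = prim f a y *\<^sub>R g1 y" for y
  proof -
    have "U x y = (indicator {a<..<y} x *\<^sub>R f x) *\<^sub>R g1 y" for x
      by (auto simp: U_def h_def f1_def g1_def indicator_def)
    then show ?thesis
      using integrable_mult_indicator[OF _ f, of "{a<..<y}"]
      by (simp add: prim_def set_lebesgue_integral_def del: scaleR_scaleR)
  qed
  have sec: "integrable lborel (L x)" "integrable lborel (U x)" for x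
  proof -
    have "L x = (\<lambda>y. indicator {..<x} y *\<^sub>R (f1 x *\<^sub>R g1 y))" "U x = (\<lambda>y. indicator {x<..} y *\<^sub>R (f1 x *\<^sub>R g1 y))"
      by (auto simp: L_def U_def h_def indicator_def fun_eq_iff)
    then show "integrable lborel (L x)" "integrable lborel (U x)"
      using integrable_mult_indicator[OF _ integrable_scaleR_right[OF g1, of "f1 x"], of "{..<x}"]
        integrable_mult_indicator[OF _ integrable_scaleR_right[OF g1, of "f1 x"], of "{x<..}"] by simp_all
  qed
  have "prim f a b *\<^sub>R prim g a b = (LINT x|lborel. f1 x *\<^sub>R (LINT y|lborel. g1 y))"
    using f1 by (simp add: prim_def set_lebesgue_integral_def f1_def[symmetric] g1_def[symmetric] del: real_scaleR_def)
  also have "\<dots> = (LINT x|lborel. (LINT y|lborel. L x y) + (LINT y|lborel. U x y))"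
  proof (rule Bochner_Integration.integral_cong)
    fix x
    have "f1 x *\<^sub>R (LINT y|lborel. g1 y) = (LINT y|lborel. f1 x *\<^sub>R g1 y)" by simp
    also have "\<dots> = (LINT y|lborel. L x y + U x y)"
    proof (rule integral_cong_AE)
      show "AE y in lborel. f1 x *\<^sub>R g1 y = L x y + U x y"
        using AE_lborel_singleton[of x] by eventually_elim (auto simp: L_def U_def h_def indicator_def)
    qed (use sec in measurable)
    also have "\<dots> = (LINT y|lborel. L x y) + (LINT y|lborel. U x y)"
      using sec by (rule Bochner_Integration.integral_add)
    finally show "f1 x *\<^sub>R (LINT y|lborel. g1 y) = (LINT y|lborel. L x y) + (LINT y|lborel. U x y)" .
  qed simp
  also have "\<dots> = (LINT x|lborel. LINT y|lborel. L x y) + (LINT x|lborel. LINT y|lborel. U x y)"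
    using lborel_pair.integrable_fst'[OF L] lborel_pair.integrable_fst'[OF U] by simp
  also have "(LINT x|lborel. LINT y|lborel. U x y) = (LINT y|lborel. LINT x|lborel. U x y)"
    by (rule lborel_pair.Fubini_integral[OF U, symmetric])
  finally show "(LINT x:{a<..<b}|lborel. f x *\<^sub>R prim g a x) + (LINT x:{a<..<b}|lborel. prim f a x *\<^sub>R g x)
      = prim f a b *\<^sub>R prim g a b"
    by (simp add: Lx Uy set_lebesgue_integral_def f1_def g1_def mult.commute)
qed

lemma prim_deriv:
  assumes "\<And>x. (\<phi> has_field_derivative \<phi>' x) (at x)" "continuous_on UNIV \<phi>'" "a \<le> x"
  shows "prim \<phi>' a x = \<phi> x - \<phi> (a :: real)"
proof -
  have "prim \<phi>' a x = (LINT y|lborel. indicator {a..x} y *\<^sub>R \<phi>' y)"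
    unfolding prim_def set_lebesgue_integral_def
  proof (rule integral_cong_AE)
    have [measurable]: "\<phi>' \<in> borel_measurable borel"
      using assms(2) by (rule borel_measurable_continuous_onI)
    show "(\<lambda>y. indicator {a<..<x} y *\<^sub>R \<phi>' y) \<in> borel_measurable lborel"
      "(\<lambda>y. indicator {a..x} y *\<^sub>R \<phi>' y) \<in> borel_measurable lborel" by measurable
    show "AE y in lborel. indicator {a<..<x} y *\<^sub>R \<phi>' y = indicator {a..x} y *\<^sub>R \<phi>' y"
      using AE_lborel_singleton[of a] AE_lborel_singleton[of x]
      by eventually_elim (auto simp: indicator_def)
  qed
  also have "\<dots> = \<phi> x - \<phi> a"
    using assms by (intro integral_FTC_atLeastAtMost)
      (auto simp: has_real_derivative_iff_has_vector_derivative
        intro: has_vector_derivative_at_within continuous_on_subset)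
  finally show ?thesis .
qed

lemma test_function_endpoints:
  assumes "\<phi> \<in> test_functions a b"
  shows "\<phi> a = 0" "\<phi> b = 0"
  using assms by (auto simp: test_functions_def)

text \<open>This is \<open>prim_mult_prim\<close> with f = \<phi>', whose primitive is \<phi>: the
  boundary term disappears because \<phi> vanishes at both ends, and for the same reason the
  constant contributes nothing.\<close>

lemma prim_has_weak_derivative:
  fixes g :: "real \<Rightarrow> 'a::{banach, second_countable_topology}"
  assumes "a < b" "set_integrable lborel {a<..<b} g"
  shows "has_weak_derivative (\<lambda>x. C + prim g a x) g a b"
proof -
  define G where "G x = indicator {a<..<b} x *\<^sub>R g x" for x
  have G: "integrable lborel G" using assms(2) by (simp add: G_def[abs_def] set_integrable_def)
  have "set_integrable lborel {a..b} (\<lambda>x. C + prim G a x)"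
    unfolding set_integrable_def
    by (rule borel_integrable_compact) (auto intro!: continuous_intros prim_continuous G)
  then have "set_integrable lborel {a<..<b} (\<lambda>x. C + prim G a x)"
    by (rule set_integrable_subset) auto
  then have int: "set_integrable lborel {a<..<b} (\<lambda>x. C + prim g a x)"
    by (rule set_integrable_cong[THEN iffD1, rotated -1]) (auto simp: G_def[abs_def] prim_indicator)
  moreover have "(LINT x:{a<..<b}|lborel. deriv \<phi> x *\<^sub>R (C + prim g a x)) = - (LINT x:{a<..<b}|lborel. \<phi> x *\<^sub>R g x)"
    if \<phi>: "\<phi> \<in> test_functions a b" for \<phi>
  proof -
    define f where "f x = indicator {a<..<b} x *\<^sub>R deriv \<phi> x" for x
    have "integrable lborel (\<lambda>x. indicator {a..b} x *\<^sub>R deriv \<phi> x)"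
      by (rule borel_integrable_compact) (auto intro: test_function_continuous[OF \<phi>])
    then have "set_integrable lborel {a<..<b} (deriv \<phi>)"
      by (intro set_integrable_subset[of lborel "{a..b}" _ "{a<..<b}", unfolded set_integrable_def[of _ "{a..b}"]]) auto
    then have f: "integrable lborel f"
      by (simp add: f_def[abs_def] set_integrable_def)
    have prim_f: "prim f a x = \<phi> x" if "a \<le> x" "x \<le> b" for x
    proof -
      have "prim f a x = prim (deriv \<phi>) a x"
        using that by (simp add: f_def[abs_def] prim_indicator del: real_scaleR_def)
      also have "\<dots> = \<phi> x - \<phi> a"
        using that test_function_has_deriv[OF \<phi>] test_function_continuous[OF \<phi>] by (intro prim_deriv) auto
      finally show ?thesis using test_function_endpoints[OF \<phi>] by simp
    qed
    have 1: "(LINT x:{a<..<b}|lborel. deriv \<phi> x *\<^sub>R prim g a x) = (LINT x:{a<..<b}|lborel. f x *\<^sub>R prim G a x)"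
      by (rule set_lebesgue_integral_cong) (auto simp: f_def G_def[abs_def] prim_indicator)
    have 2: "(LINT x:{a<..<b}|lborel. \<phi> x *\<^sub>R g x) = (LINT x:{a<..<b}|lborel. prim f a x *\<^sub>R G x)"
      by (rule set_lebesgue_integral_cong) (auto simp: prim_f G_def)
    have "(LINT x:{a<..<b}|lborel. deriv \<phi> x *\<^sub>R C) = prim f a b *\<^sub>R C"
    proof -
      have "(LINT x:{a<..<b}|lborel. deriv \<phi> x *\<^sub>R C) = (LINT x|lborel. f x *\<^sub>R C)"
        unfolding set_lebesgue_integral_def f_def by (rule Bochner_Integration.integral_cong) auto
      also have "\<dots> = (LINT x|lborel. f x) *\<^sub>R C" using f by simp
      also have "(LINT x|lborel. f x) = prim f a b"
        unfolding prim_def set_lebesgue_integral_def f_def by (rule Bochner_Integration.integral_cong) (auto simp: indicator_def)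
      finally show ?thesis .
    qed
    then have 3: "(LINT x:{a<..<b}|lborel. deriv \<phi> x *\<^sub>R C) = 0"
      using prim_f[of b] assms(1) test_function_endpoints[OF \<phi>] by simp
    have C: "set_integrable lborel {a<..<b} (\<lambda>x. C)"
      unfolding set_integrable_def
      by (intro integrable_scaleR_left integrable_real_indicator) (auto simp: assms(1) less_imp_le)
    have "set_integrable lborel {a<..<b} (prim g a)"
      using set_integral_diff(1)[OF int C] by simp
    from set_integral_add(2)[OF test_function_integrable_scaleR(2)[OF \<phi> C] test_function_integrable_scaleR(2)[OF \<phi> this]]
    have "(LINT x:{a<..<b}|lborel. deriv \<phi> x *\<^sub>R (C + prim g a x))
      = (LINT x:{a<..<b}|lborel. deriv \<phi> x *\<^sub>R prim g a x)"
      by (simp add: 3 scaleR_add_right)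
    also have "\<dots> = - (LINT x:{a<..<b}|lborel. \<phi> x *\<^sub>R g x)"
      using prim_mult_prim(3)[OF f G, of a b] prim_f[of b] assms(1) test_function_endpoints[OF \<phi>]
      by (simp add: 1 2 eq_neg_iff_add_eq_0)
    finally show ?thesis .
  qed
  ultimately show ?thesis
    using assms(2) by (auto simp: has_weak_derivative_def)
qed

text \<open>The measure \<open>lborel\<close> is not complete, so equality almost everywhere does
  not transfer measurability; hence the two measurability assumptions.\<close>

lemma has_weak_derivative_AE_cong:
  assumes f: "has_weak_derivative f g a b" and eq: "AE x in lborel. x \<in> {a<..<b} \<longrightarrow> f x = f' x"
    "AE x in lborel. x \<in> {a<..<b} \<longrightarrow> g x = g' x"
    and meas: "set_borel_measurable lborel {a<..<b} f'" "set_borel_measurable lborel {a<..<b} g'"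
  shows "has_weak_derivative f' g' a b"
proof -
  have c: "set_integrable lborel {a<..<b} h \<longleftrightarrow> set_integrable lborel {a<..<b} h'"
     "(LINT x:{a<..<b}|lborel. \<phi> x *\<^sub>R h x) = (LINT x:{a<..<b}|lborel. \<phi> x *\<^sub>R h' x)"
    if h: "AE x in lborel. x \<in> {a<..<b} \<longrightarrow> h x = h' x"
      and m [unfolded set_borel_measurable_def, measurable]: "set_borel_measurable lborel {a<..<b} h" "set_borel_measurable lborel {a<..<b} h'"
      and \<phi> [measurable]: "\<phi> \<in> borel_measurable borel" for h h' and \<phi> :: "real \<Rightarrow> real"
  proof -
    show "set_integrable lborel {a<..<b} h \<longleftrightarrow> set_integrable lborel {a<..<b} h'"
      unfolding set_integrable_def
      by (rule integrable_cong_AE)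
        (use m h in \<open>auto simp: set_borel_measurable_def elim!: eventually_mono split: split_indicator\<close>)
    have *: "(\<lambda>x. indicator {a<..<b} x *\<^sub>R \<phi> x *\<^sub>R h x) = (\<lambda>x. \<phi> x *\<^sub>R indicator {a<..<b} x *\<^sub>R h x)"
      "(\<lambda>x. indicator {a<..<b} x *\<^sub>R \<phi> x *\<^sub>R h' x) = (\<lambda>x. \<phi> x *\<^sub>R indicator {a<..<b} x *\<^sub>R h' x)"
      by (simp_all add: mult.commute)
    show "(LINT x:{a<..<b}|lborel. \<phi> x *\<^sub>R h x) = (LINT x:{a<..<b}|lborel. \<phi> x *\<^sub>R h' x)"
      unfolding set_lebesgue_integral_def *
    proof (intro integral_cong_AE)
      show "AE x in lborel. \<phi> x *\<^sub>R indicator {a<..<b} x *\<^sub>R h x = \<phi> x *\<^sub>R indicator {a<..<b} x *\<^sub>R h' x"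
        using h by eventually_elim (auto simp: indicator_def)
    qed measurable
  qed
  have m: "set_borel_measurable lborel {a<..<b} f" "set_borel_measurable lborel {a<..<b} g"
    using f by (auto simp: has_weak_derivative_def set_integrable_def set_borel_measurable_def)
  note cf = c[OF eq(1) m(1) meas(1)] and cg = c[OF eq(2) m(2) meas(2)]
  show ?thesis
    unfolding has_weak_derivative_def
  proof (intro conjI ballI)
    show "set_integrable lborel {a<..<b} f'" "set_integrable lborel {a<..<b} g'"
      using f cf(1)[OF borel_measurable_const[of 0]] cg(1)[OF borel_measurable_const[of 0]]
      by (auto simp: has_weak_derivative_def)
    fix \<phi> assume \<phi>: "\<phi> \<in> test_functions a b"
    then show "(LINT x:{a<..<b}|lborel. deriv \<phi> x *\<^sub>R f' x) = - (LINT x:{a<..<b}|lborel. \<phi> x *\<^sub>R g' x)"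
      using f cf(2)[OF test_function_measurable(2)[OF \<phi>]] cg(2)[OF test_function_measurable(1)[OF \<phi>]]
      by (simp add: has_weak_derivative_def)
  qed
qed

text \<open>The function f and the primitive of g have the same weak derivative g, so their
  difference has weak derivative zero and is constant by \<open>du_Bois_Reymond\<close>.\<close>

theorem has_weak_derivative_imp_prim:
  fixes f g :: "real \<Rightarrow> 'a::{banach, second_countable_topology}"
  assumes "a < b" and fg: "has_weak_derivative f g a b"
  obtains C where "AE x in lborel. x \<in> {a<..<b} \<longrightarrow> f x = C + prim g a x"
proof -
  have f: "set_integrable lborel {a<..<b} f" and g: "set_integrable lborel {a<..<b} g"
    using fg by (auto simp: has_weak_derivative_def)
  have p: "has_weak_derivative (\<lambda>x. 0 + prim g a x) g a b"
    by (rule prim_has_weak_derivative[OF assms(1) g])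
  then have pint: "set_integrable lborel {a<..<b} (prim g a)"
    by (auto simp: has_weak_derivative_def)
  have "(LINT x:{a<..<b}|lborel. deriv \<phi> x *\<^sub>R (f x - prim g a x)) = 0" if \<phi>: "\<phi> \<in> test_functions a b" for \<phi>
    using set_integral_diff(2)[OF test_function_integrable_scaleR(2)[OF \<phi> f] test_function_integrable_scaleR(2)[OF \<phi> pint]]
      fg p \<phi> by (simp add: has_weak_derivative_def scaleR_diff_right)
  then obtain C where "AE x in lborel. x \<in> {a<..<b} \<longrightarrow> f x - prim g a x = C"
    using du_Bois_Reymond[OF assms(1) set_integral_diff(1)[OF f pint]] by metis
  then show thesis
    by (intro that[of C]) (auto elim!: eventually_mono simp: algebra_simps)
qed

section \<open>Primitives of continuous functions with values in a Banach space\<close>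

lemma continuous_set_integrable_Ioo:
  fixes z :: "real \<Rightarrow> 'a::{banach, second_countable_topology}"
  assumes "continuous_on UNIV z"
  shows "set_integrable lborel {a<..<b} z"
proof -
  have "set_integrable lborel {a..b} z"
    unfolding set_integrable_def
    by (rule borel_integrable_compact) (auto intro: continuous_on_subset[OF assms])
  then show ?thesis by (rule set_integrable_subset) auto
qed

lemma prim_split:
  fixes z :: "real \<Rightarrow> 'a::{banach, second_countable_topology}"
  assumes "set_integrable lborel {a<..<t} z" "a \<le> s" "s \<le> t"
  shows "prim z a t = prim z a s + prim z s t"
proof -
  have i: "set_integrable lborel {a<..<s} z" "set_integrable lborel {s<..<t} z"
    using assms(2,3) by (auto intro!: set_integrable_subset[OF assms(1)])
  have [measurable]: "(\<lambda>x. indicator {a<..<t} x *\<^sub>R z x) \<in> borel_measurable borel"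
     "(\<lambda>x. indicator {a<..<s} x *\<^sub>R z x) \<in> borel_measurable borel"
     "(\<lambda>x. indicator {s<..<t} x *\<^sub>R z x) \<in> borel_measurable borel"
    using assms(1) i by (auto simp: set_integrable_def dest: borel_measurable_integrable)
  have "prim z a t = (LINT x|lborel. indicator {a<..<s} x *\<^sub>R z x + indicator {s<..<t} x *\<^sub>R z x)"
    unfolding prim_def set_lebesgue_integral_def
  proof (rule integral_cong_AE)
    show "AE x in lborel. indicator {a<..<t} x *\<^sub>R z x = indicator {a<..<s} x *\<^sub>R z x + indicator {s<..<t} x *\<^sub>R z x"
      using AE_lborel_singleton[of s] by eventually_elim (use assms in \<open>auto simp: indicator_def\<close>)
  qed measurable
  also have "\<dots> = prim z a s + prim z s t"
    using i unfolding prim_def set_lebesgue_integral_def set_integrable_def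
    by (rule Bochner_Integration.integral_add)
  finally show ?thesis .
qed

lemma prim_const: "s \<le> t \<Longrightarrow> prim (\<lambda>_. c) s t = (t - s) *\<^sub>R c"
  by (simp add: prim_def set_lebesgue_integral_def)

lemma prim_diff_fun:
  assumes "set_integrable lborel {s<..<t} f" "set_integrable lborel {s<..<t} g"
  shows "prim (\<lambda>x. f x - g x) s t = prim f s t - prim g s t"
  unfolding prim_def by (rule set_integral_diff(2)[OF assms])

lemma prim_add_fun:
  assumes "set_integrable lborel {s<..<t} f" "set_integrable lborel {s<..<t} g"
  shows "prim (\<lambda>x. f x + g x) s t = prim f s t + prim g s t"
  unfolding prim_def by (rule set_integral_add(2)[OF assms])

lemma norm_prim_bound:
  fixes z :: "real \<Rightarrow> 'a::{banach, second_countable_topology}"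
  assumes z: "set_integrable lborel {s<..<t} z" and "s \<le> t" and le: "\<And>r. s < r \<Longrightarrow> r < t \<Longrightarrow> norm (z r) \<le> B"
  shows "norm (prim z s t) \<le> B * (t - s)"
proof -
  have B: "integrable lborel (\<lambda>x. indicator {s<..<t} x * B)"
    using assms(2) by (intro integrable_mult_left integrable_real_indicator) auto
  have "norm (prim z s t) \<le> (LINT x|lborel. norm (indicator {s<..<t} x *\<^sub>R z x))"
    unfolding prim_def set_lebesgue_integral_def by (rule integral_norm_bound)
  also have "\<dots> \<le> (LINT x|lborel. indicator {s<..<t} x * B)"
    using z B le by (intro integral_mono integrable_norm) (auto simp: set_integrable_def indicator_def)
  also have "\<dots> = B * (t - s)" using assms(2) by simp
  finally show ?thesis .
qed

text \<open>The derivative is one-sided at \<open>a\<close>: to the left of \<open>a\<close> the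
  primitive is identically zero, so a two-sided derivative would fail there unless z a = 0.\<close>

lemma prim_has_vector_derivative:
  fixes z :: "real \<Rightarrow> 'a::{banach, second_countable_topology}"
  assumes z: "continuous_on UNIV z" and "a \<le> t"
  shows "(prim z a has_vector_derivative z t) (at t within {a..})"
  unfolding has_vector_derivative_def has_derivative_within_alt2
proof (intro conjI allI impI bounded_linear_scaleR_left)
  fix e :: real assume e: "0 < e"
  have "isCont z t" using z by (simp add: continuous_on_eq_continuous_at)
  then obtain d where d: "0 < d" "\<And>r. dist r t < d \<Longrightarrow> dist (z r) (z t) < e"
    using e unfolding continuous_at_eps_delta by blast
  note int = continuous_set_integrable_Ioo[OF z]
  have intc: "set_integrable lborel {u<..<v} (\<lambda>r. z t)" for u v :: real
    by (rule continuous_set_integrable_Ioo) simp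
  have key: "norm (prim z u v - (v - u) *\<^sub>R z t) \<le> e * (v - u)"
    if "u \<le> v" "\<And>r. u < r \<Longrightarrow> r < v \<Longrightarrow> dist r t < d" for u v
  proof -
    have "prim z u v - (v - u) *\<^sub>R z t = prim (\<lambda>r. z r - z t) u v"
      by (simp add: prim_diff_fun[OF int intc] prim_const[OF that(1)])
    also have "norm \<dots> \<le> e * (v - u)"
      using that d(2) by (intro norm_prim_bound set_integral_diff(1)[OF int intc])
        (auto simp: dist_norm less_imp_le)
    finally show ?thesis .
  qed
  have "\<forall>\<^sub>F s in at t within {a..}. s \<in> {a..} \<and> dist s t < d"
    using d(1) by (auto simp: eventually_at)
  then show "\<forall>\<^sub>F s in at t within {a..}. norm (prim z a s - prim z a t - (s - t) *\<^sub>R z t) \<le> e * norm (s - t)"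
  proof eventually_elim
    case (elim s)
    show ?case
    proof (cases "s \<le> t")
      case True
      have "norm (prim z s t - (t - s) *\<^sub>R z t) \<le> e * (t - s)"
        using True elim by (intro key) (auto simp: dist_real_def)
      moreover have "prim z a s - prim z a t - (s - t) *\<^sub>R z t = - (prim z s t - (t - s) *\<^sub>R z t)"
        using prim_split[OF int, of a s t] True elim by (simp add: algebra_simps)
      ultimately show ?thesis using True by (simp add: norm_minus_commute)
    next
      case False
      have "norm (prim z t s - (s - t) *\<^sub>R z t) \<le> e * (s - t)"
        using False elim by (intro key) (auto simp: dist_real_def)
      moreover have "prim z a s - prim z a t = prim z t s"
        using prim_split[OF int, of a t s] False assms(2) by simp
      ultimately show ?thesis using False by simp
    qed
  qed
qed

lemma prim_vector_derivative_eq: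
  fixes z :: "real \<Rightarrow> 'a::{banach, second_countable_topology}"
  assumes z: "continuous_on UNIV z" and y: "\<And>t. a \<le> t \<Longrightarrow> (y has_vector_derivative z t) (at t within {a..})"
    and "a \<le> t"
  shows "prim z a t = y t - y a"
proof -
  have "((\<lambda>t. prim z a t - y t) has_vector_derivative 0) (at t within {a..})" if "t \<in> {a..}" for t
    using has_vector_derivative_diff[OF prim_has_vector_derivative[OF z, of a t] y[of t]] that by simp
  then obtain c where "\<And>t. t \<in> {a..} \<Longrightarrow> prim z a t - y t = c"
    by (rule has_vector_derivative_zero_constant[of "{a..}", rotated]) auto
  from this[of t] this[of a] assms(3) have "prim z a t - y t = c" "prim z a a - y a = c" by auto
  then have "prim z a t - y t = prim z a a - y a" by (simp only:)
  then show ?thesis by (simp add: algebra_simps)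
qed

lemma prim_shift:
  fixes z :: "real \<Rightarrow> 'a::{banach, second_countable_topology}"
  shows "prim (\<lambda>s. z (s - r)) r t = prim z 0 (t - r)"
proof -
  have "prim z 0 (t - r) = \<bar>1\<bar> *\<^sub>R (LINT x|lborel. indicator {0<..<t - r} (- r + 1 * x) *\<^sub>R z (- r + 1 * x))"
    unfolding prim_def set_lebesgue_integral_def by (rule lborel_integral_real_affine) simp
  also have "\<dots> = prim (\<lambda>s. z (s - r)) r t"
    unfolding prim_def set_lebesgue_integral_def
    by (auto simp: indicator_def intro!: Bochner_Integration.integral_cong)
  finally show ?thesis ..
qed

lemma integrable_lborel_pair_scaleR:
  fixes f :: "real \<Rightarrow> real" and g :: "real \<Rightarrow> 'a::{banach, second_countable_topology}"
  assumes f: "integrable lborel f" and g: "integrable lborel g"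
  shows "integrable (lborel \<Otimes>\<^sub>M lborel) (\<lambda>(x, y). f x *\<^sub>R g y)"
proof (rule lborel_pair.Fubini_integrable)
  have [measurable]: "f \<in> borel_measurable borel" "g \<in> borel_measurable borel"
    using f g by (simp_all add: borel_measurable_integrable)
  show "(\<lambda>(x, y). f x *\<^sub>R g y) \<in> borel_measurable (lborel \<Otimes>\<^sub>M lborel)"
    by measurable
  show "integrable lborel (\<lambda>x. LINT y|lborel. norm (case (x, y) of (x, y) \<Rightarrow> f x *\<^sub>R g y))"
    using integrable_norm[OF f] by simp
  show "AE x in lborel. integrable lborel (\<lambda>y. case (x, y) of (x, y) \<Rightarrow> f x *\<^sub>R g y)"
    using g by simp
qed

text \<open>The points of U that are mapped outside C form an open null set, which is empty. This
  turns statements for almost every time or place into statements for all of them.\<close>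

lemma continuous_AE_in_closed:
  fixes f :: "real \<Rightarrow> 'a::topological_space"
  assumes "open U" "continuous_on U f" "closed C" and AE: "AE x in lborel. x \<in> U \<longrightarrow> f x \<in> C" and "x \<in> U"
  shows "f x \<in> C"
proof (rule ccontr)
  assume x: "f x \<notin> C"
  define W where "W = U \<inter> f -` (- C)"
  have W: "open W" unfolding W_def using assms(1-3) by (intro continuous_open_preimage) auto
  have "AE x in lborel. x \<notin> W" using AE by eventually_elim (auto simp: W_def)
  then have "W \<in> null_sets lborel" using W by (subst AE_iff_null_sets) auto
  then have "W \<in> null_sets lebesgue" by (rule null_sets_completionI)
  moreover have "x \<in> W" using x assms(5) by (simp add: W_def)
  ultimately show False
    using open_not_negligible[OF W] by (auto simp: negligible_iff_null_sets)
qed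

section \<open>The semigroup generated by a resolvent family\<close>

text \<open>\<open>A\<close> is the graph of the generator and \<open>J h\<close> stands for $(1 - hA)^{-1}$.\<close>

locale resolvent_family =
  fixes A :: "('h::banach \<times> 'h) set" and J :: "real \<Rightarrow> 'h \<Rightarrow> 'h" and M :: real
  assumes J_0: "J 0 x = x"
    and J_linear: "0 \<le> h \<Longrightarrow> linear (J h)"
    and J_graph: "0 < h \<Longrightarrow> (J h y, (1 / h) *\<^sub>R (J h y - y)) \<in> A"
    and graph_J: "0 < h \<Longrightarrow> (x, z) \<in> A \<Longrightarrow> J h (x - h *\<^sub>R z) = x"
    and J_power_bound: "0 \<le> h \<Longrightarrow> norm ((J h ^^ n) y) \<le> M * norm y"
    and M_nonneg: "0 \<le> M"
    and dense: "closure (Domain A) = UNIV"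
begin

lemma J_bound: "0 \<le> h \<Longrightarrow> norm (J h y) \<le> M * norm y"
  using J_power_bound[of h 1 y] by simp

lemma J_add: "0 \<le> h \<Longrightarrow> J h (x + y) = J h x + J h y"
  and J_diff: "0 \<le> h \<Longrightarrow> J h (x - y) = J h x - J h y"
  and J_scaleR: "0 \<le> h \<Longrightarrow> J h (r *\<^sub>R x) = r *\<^sub>R J h x"
  using J_linear[of h] by (auto simp: linear_add linear_diff linear_scale)

lemma J_power_add: "0 \<le> h \<Longrightarrow> (J h ^^ n) (x + y) = (J h ^^ n) x + (J h ^^ n) y"
  and J_power_diff: "0 \<le> h \<Longrightarrow> (J h ^^ n) (x - y) = (J h ^^ n) x - (J h ^^ n) y"
  and J_power_scaleR: "0 \<le> h \<Longrightarrow> (J h ^^ n) (r *\<^sub>R x) = r *\<^sub>R (J h ^^ n) x"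
  by (induction n) (auto simp: J_add J_diff J_scaleR)

text \<open>One implicit Euler step advances x by h times J h (A x). With the bounded operator in
  front, the identity also makes sense for h = 0.\<close>

lemma J_step:
  assumes "0 \<le> h" "(x, z) \<in> A"
  shows "J h x - x = h *\<^sub>R J h z"
proof (cases "h = 0")
  case False
  then have "J h (x - h *\<^sub>R z) = x" using assms by (intro graph_J) auto
  then show ?thesis using assms(1) by (simp add: J_diff J_scaleR algebra_simps)
qed (simp add: J_0)

text \<open>The resolvent identity (k - h) J h (J k y) = k J k y - h J h y keeps its form when h and
  k are exchanged: both sides change sign and only the order of the resolvents differs.\<close>

lemma J_commute:
  assumes "0 \<le> h" "0 \<le> k"
  shows "J h (J k y) = J k (J h y)"
proof (cases "h = 0 \<or> k = 0")
  case False
  then have hk: "0 < h" "0 < k" using assms by auto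
  have e1: "J h (J k y) - J k y = (h / k) *\<^sub>R (J h (J k y) - J h y)"
    using J_step[OF assms(1) J_graph[OF hk(2), of y]] assms(1) by (simp add: J_diff J_scaleR)
  have e2: "J k (J h y) - J h y = (k / h) *\<^sub>R (J k (J h y) - J k y)"
    using J_step[OF assms(2) J_graph[OF hk(1), of y]] assms(2) by (simp add: J_diff J_scaleR)
  show ?thesis
  proof (cases "h = k")
    case neq: False
    have "(k - h) *\<^sub>R J h (J k y) = k *\<^sub>R J k y - h *\<^sub>R J h y"
      using arg_cong[OF e1, of "\<lambda>v. k *\<^sub>R v"] hk by (simp add: algebra_simps)
    also have "\<dots> = (k - h) *\<^sub>R J k (J h y)"
      using arg_cong[OF e2, of "\<lambda>v. h *\<^sub>R v"] hk by (simp add: algebra_simps)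
    finally have "(k - h) *\<^sub>R J h (J k y) = (k - h) *\<^sub>R J k (J h y)" .
    then show ?thesis using neq by simp
  qed simp
qed (auto simp: J_0)

lemma J_power_commute:
  assumes "0 \<le> h" "0 \<le> k"
  shows "(J h ^^ m) (J k y) = J k ((J h ^^ m) y)" "(J h ^^ m) ((J k ^^ n) y) = (J k ^^ n) ((J h ^^ m) y)"
proof -
  show 1: "(J h ^^ m) (J k y) = J k ((J h ^^ m) y)" for y
    by (induction m) (auto simp: J_commute[OF assms])
  show "(J h ^^ m) ((J k ^^ n) y) = (J k ^^ n) ((J h ^^ m) y)"
    by (induction n) (auto simp: 1)
qed

lemma J_graph_pair:
  assumes "0 \<le> h" "(x, z) \<in> A"
  shows "(J h x, J h z) \<in> A"
proof (cases "h = 0")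
  case False
  with assms J_graph[of h x] J_step[OF assms] show ?thesis by simp
qed (use assms in \<open>simp add: J_0\<close>)

lemma J_power_graph_pair: "0 \<le> h \<Longrightarrow> (x, z) \<in> A \<Longrightarrow> ((J h ^^ n) x, (J h ^^ n) z) \<in> A"
  by (induction n) (auto intro: J_graph_pair)

lemma J_power_step:
  assumes "0 \<le> h" "(x, z) \<in> A"
  shows "norm ((J h ^^ n) x - x) \<le> real n * h * (M * norm z)"
proof (induction n)
  case (Suc n)
  have "(J h ^^ Suc n) x - x = ((J h ^^ n) (J h x) - (J h ^^ n) x) + ((J h ^^ n) x - x)"
    by (simp add: funpow_Suc_right del: funpow.simps)
  also have "(J h ^^ n) (J h x) - (J h ^^ n) x = h *\<^sub>R (J h ^^ Suc n) z"
    using J_step[OF assms] assms(1)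
    by (simp add: funpow_Suc_right J_power_diff[symmetric] J_power_scaleR del: funpow.simps)
  also have "norm (h *\<^sub>R (J h ^^ Suc n) z + ((J h ^^ n) x - x)) \<le> h * (M * norm z) + real n * h * (M * norm z)"
    using J_power_bound[OF assms(1), of "Suc n" z] assms(1)
    by (intro norm_triangle_mono Suc) (simp add: mult_left_mono)
  finally show ?case by (simp add: algebra_simps)
qed simp

text \<open>A first-order expansion in time of the Euler scheme. With n steps, the step sizes h and
  k reach the times n h and n k; the error is quadratic in the time difference, up to a term with an
  extra factor k that vanishes when the steps are refined.\<close>

lemma J_power_minus_J_power:
  assumes h: "0 \<le> h" "0 \<le> k" and x: "(x, z) \<in> A" "(z, w) \<in> A"
  shows "norm ((J h ^^ n) x - (J k ^^ n) x - (real n * (h - k)) *\<^sub>R (J k ^^ n) z)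
      \<le> (real n * \<bar>h - k\<bar>)\<^sup>2 * (M * (M * (M * norm w))) + real n * \<bar>h - k\<bar> * k * (M * (M * norm w))"
proof -
  \<comment> \<open>Both J h (y - h v) and J k (y - k v) equal y. What remains is the resolvent
    identity.\<close>
  have diff1: "J h y - J k y = (h - k) *\<^sub>R J h (J k v)" if "(y, v) \<in> A" for y v
  proof -
    have "J h y - J k y = J h (y - h *\<^sub>R v) - J k (y - k *\<^sub>R v) + (h *\<^sub>R J h v - k *\<^sub>R J k v)"
      using h by (simp add: J_diff J_scaleR)
    also have "J h (y - h *\<^sub>R v) = J k (y - k *\<^sub>R v)"
      using graph_J[of h y v] graph_J[of k y v] h that by (cases "h = 0"; cases "k = 0") (auto simp: J_0)
    also have "h *\<^sub>R J h v - k *\<^sub>R J k v = (h - k) *\<^sub>R J h (J k v)"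
    proof (cases "h = 0 \<or> k = 0")
      case True then show ?thesis by (auto simp: J_0)
    next
      case False
      then have hk: "0 < h" "0 < k" using h by auto
      have "J h (J k v) - J k v = (h / k) *\<^sub>R (J h (J k v) - J h v)"
        using J_step[OF h(1) J_graph[OF hk(2), of v]] h by (simp add: J_diff J_scaleR)
      from arg_cong[OF this, of "\<lambda>v. k *\<^sub>R v"] show ?thesis
        using hk by (simp add: algebra_simps)
    qed
    finally show ?thesis by simp
  qed
  have prod_bound: "norm ((J h ^^ i) ((J k ^^ j) y)) \<le> M * (M * norm y)" for i j y
  proof -
    have "norm ((J h ^^ i) ((J k ^^ j) y)) \<le> M * norm ((J k ^^ j) y)"
      by (rule J_power_bound[OF h(1)])
    also have "\<dots> \<le> M * (M * norm y)"
      by (intro mult_left_mono J_power_bound[OF h(2)] M_nonneg)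
    finally show ?thesis .
  qed
  \<comment> \<open>Replacing J h by J k one factor at a time; each exchange costs a factor h - k
    and one application of A, by \<open>diff1\<close>.\<close>
  have tele: "(J h ^^ n) y - (J k ^^ n) y = (\<Sum>i<n. (h - k) *\<^sub>R (J h ^^ (n - i)) ((J k ^^ Suc i) v))"
    if "(y, v) \<in> A" for n y v
  proof (induction n)
    case (Suc n)
    have "(J h ^^ Suc n) y - (J k ^^ Suc n) y
        = J h ((J h ^^ n) y - (J k ^^ n) y) + (J h ((J k ^^ n) y) - J k ((J k ^^ n) y))"
      using h by (simp add: J_diff)
    also have "J h ((J k ^^ n) y) - J k ((J k ^^ n) y) = (h - k) *\<^sub>R J h (J k ((J k ^^ n) v))"
      by (intro diff1 J_power_graph_pair h that)
    also have "J h ((J h ^^ n) y - (J k ^^ n) y) = (\<Sum>i<n. (h - k) *\<^sub>R (J h ^^ (Suc n - i)) ((J k ^^ Suc i) v))"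
      unfolding Suc linear_sum[OF J_linear[OF h(1)]]
      using h by (intro sum.cong) (auto simp: J_scaleR Suc_diff_le)
    finally show ?case by simp
  qed simp
  have lip: "norm ((J h ^^ n) y - (J k ^^ n) y) \<le> real n * \<bar>h - k\<bar> * (M * (M * norm v))" if "(y, v) \<in> A" for n y v
  proof -
    have "norm ((J h ^^ n) y - (J k ^^ n) y) \<le> (\<Sum>i<n. \<bar>h - k\<bar> * (M * (M * norm v)))"
      unfolding tele[OF that] by (intro sum_norm_le) (simp add: mult_left_mono prod_bound del: funpow.simps)
    then show ?thesis by (simp add: mult_ac)
  qed
  have "(J h ^^ n) x - (J k ^^ n) x - (real n * (h - k)) *\<^sub>R (J k ^^ n) z
    = (\<Sum>i<n. (h - k) *\<^sub>R ((J h ^^ (n - i)) ((J k ^^ Suc i) z) - (J k ^^ n) z))"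
    by (simp add: tele[OF x(1)] sum_subtractf scaleR_diff_right sum_constant_scaleR)
  also have "norm \<dots> \<le> (\<Sum>i<n. \<bar>h - k\<bar> * (real n * \<bar>h - k\<bar> * (M * (M * (M * norm w))) + k * (M * (M * norm w))))"
  proof (rule sum_norm_le)
    fix i assume "i \<in> {..<n}"
    then have i: "i < n" by simp
    \<comment> \<open>The mixed product has n + 1 factors. First its powers of J h are traded for
      powers of J k, at the cost \<open>lip\<close> for the pair (z, w); then the one surplus factor
      J k is dropped, at the cost of a single step of size k.\<close>
    have "(J h ^^ (n - i)) ((J k ^^ Suc i) z) - (J k ^^ n) z
      = ((J h ^^ (n - i)) ((J k ^^ Suc i) z) - (J k ^^ (n - i)) ((J k ^^ Suc i) z)) + ((J k ^^ Suc n) z - (J k ^^ n) z)"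
    proof -
      have "(J k ^^ (n - i)) ((J k ^^ Suc i) z) = (J k ^^ Suc n) z"
        using i by (simp only: funpow_add[symmetric, THEN fun_cong, unfolded o_def]) simp
      then show ?thesis by simp
    qed
    also have "norm \<dots> \<le> real (n - i) * \<bar>h - k\<bar> * (M * (M * norm ((J k ^^ Suc i) w))) + k * (M * (M * norm w))"
    proof (rule norm_triangle_mono)
      show "norm ((J h ^^ (n - i)) ((J k ^^ Suc i) z) - (J k ^^ (n - i)) ((J k ^^ Suc i) z))
        \<le> real (n - i) * \<bar>h - k\<bar> * (M * (M * norm ((J k ^^ Suc i) w)))"
        by (intro lip J_power_graph_pair h x)
      have "(J k ^^ Suc n) z - (J k ^^ n) z = k *\<^sub>R (J h ^^ 0) ((J k ^^ Suc n) w)"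
        using J_step[OF h(2) x(2)] h(2)
        by (simp add: funpow_Suc_right J_power_diff[symmetric] J_power_scaleR del: funpow.simps(2))
      then show "norm ((J k ^^ Suc n) z - (J k ^^ n) z) \<le> k * (M * (M * norm w))"
        using h(2) prod_bound[of 0 "Suc n" w] by (simp add: mult_left_mono del: funpow.simps(2))
    qed
    also have "\<dots> \<le> real n * \<bar>h - k\<bar> * (M * (M * (M * norm w))) + k * (M * (M * norm w))"
    proof (rule add_right_mono)
      show "real (n - i) * \<bar>h - k\<bar> * (M * (M * norm ((J k ^^ Suc i) w))) \<le> real n * \<bar>h - k\<bar> * (M * (M * (M * norm w)))"
      proof -
        have "M * (M * norm ((J k ^^ Suc i) w)) \<le> M * (M * (M * norm w))"
          by (intro mult_left_mono J_power_bound[OF h(2)] M_nonneg)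
        moreover have "0 \<le> M * (M * norm ((J k ^^ Suc i) w))"
          using M_nonneg by simp
        moreover have "real (n - i) * \<bar>h - k\<bar> \<le> real n * \<bar>h - k\<bar>"
          by (intro mult_right_mono) auto
        ultimately show ?thesis
          using h by (intro mult_mono[of "real (n - i) * \<bar>h - k\<bar>"]) simp_all
      qed
    qed
    finally have "norm ((J h ^^ (n - i)) ((J k ^^ Suc i) z) - (J k ^^ n) z)
       \<le> real n * \<bar>h - k\<bar> * (M * (M * (M * norm w))) + k * (M * (M * norm w))" .
    then show "norm ((h - k) *\<^sub>R ((J h ^^ (n - i)) ((J k ^^ Suc i) z) - (J k ^^ n) z))
      \<le> \<bar>h - k\<bar> * (real n * \<bar>h - k\<bar> * (M * (M * (M * norm w))) + k * (M * (M * norm w)))"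
      by (simp add: mult_left_mono)
  qed
  finally show "norm ((J h ^^ n) x - (J k ^^ n) x - (real n * (h - k)) *\<^sub>R (J k ^^ n) z)
      \<le> (real n * \<bar>h - k\<bar>)\<^sup>2 * (M * (M * (M * norm w))) + real n * \<bar>h - k\<bar> * k * (M * (M * norm w))"
    by (simp add: power2_eq_square algebra_simps)
qed


text \<open>
  The exponential formula is used along dyadic step sizes only: halving a step \<open>h\<close> changes one
  Euler step by $O(h^2)$ on the domain of $A^2$, so the total changes form a geometric series.
\<close>

definition euler :: "nat \<Rightarrow> real \<Rightarrow> 'h \<Rightarrow> 'h" where
  "euler n t = J (t / 2 ^ n) ^^ (2 ^ n)"

definition domain_2 :: "'h set" where
  "domain_2 = {x. \<exists>z w. (x, z) \<in> A \<and> (z, w) \<in> A}"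

text \<open>Both sides expand as x + h A x plus multiples of h^2 applied to A^2 x, so only
  remainders are left. Their coefficients 1, 1/2 and 1/4 add up to less than 2.\<close>

lemma J_halving:
  assumes h: "0 \<le> h" and x: "(x, z) \<in> A" "(z, w) \<in> A"
  shows "norm (J h x - J (h / 2) (J (h / 2) x)) \<le> 2 * h\<^sup>2 * (M * norm w)"
proof -
  let ?k = "h / 2"
  have k: "0 \<le> ?k" using h by simp
  have 1: "J h x = x + h *\<^sub>R z + h\<^sup>2 *\<^sub>R J h w"
    using J_step[OF h x(1)] J_step[OF h x(2)]
    by (simp add: algebra_simps power2_eq_square eq_diff_eq)
  have z: "J ?k z = z + ?k *\<^sub>R J ?k w"
    using J_step[OF k x(2)] by (simp add: algebra_simps)
  have x': "J ?k x = x + ?k *\<^sub>R J ?k z"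
    using J_step[OF k x(1)] by (simp add: algebra_simps)
  have 2: "J ?k (J ?k x) = x + ?k *\<^sub>R J ?k z + ?k *\<^sub>R J ?k (J ?k z)"
    using x' arg_cong[OF x', of "J ?k"] k by (simp add: J_add J_scaleR)
  also have "\<dots> = x + h *\<^sub>R z + (h\<^sup>2 / 2) *\<^sub>R J ?k w + (h\<^sup>2 / 4) *\<^sub>R J ?k (J ?k w)"
  proof -
    have "J ?k (J ?k z) = z + ?k *\<^sub>R J ?k w + ?k *\<^sub>R J ?k (J ?k w)"
      using z arg_cong[OF z, of "J ?k"] k by (simp add: J_add J_scaleR)
    moreover have "?k *\<^sub>R z + ?k *\<^sub>R z = h *\<^sub>R z"
      by (simp flip: scaleR_add_left)
    moreover have "(?k * ?k) *\<^sub>R v + (?k * ?k) *\<^sub>R v = (h\<^sup>2 / 2) *\<^sub>R v" for v :: 'h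
      by (simp flip: scaleR_add_left add: power2_eq_square)
    ultimately show ?thesis
      by (simp add: z scaleR_add_right power2_eq_square algebra_simps)
  qed
  finally have "J h x - J ?k (J ?k x) = h\<^sup>2 *\<^sub>R (J h w - (1/2) *\<^sub>R J ?k w - (1/4) *\<^sub>R J ?k (J ?k w))"
    by (simp add: 1 algebra_simps)
  also have "norm \<dots> \<le> h\<^sup>2 * (M * norm w + (1/2) * (M * norm w) + (1/4) * (M * norm w))"
    unfolding norm_scaleR
    using J_bound[OF h, of w] J_bound[OF k, of w] J_power_bound[OF k, of 2 w]
    by (intro mult_mono order_trans[OF norm_triangle_ineq4] add_mono) (auto simp: numeral_2_eq_2 M_nonneg)
  also have "\<dots> \<le> 2 * h\<^sup>2 * (M * norm w)"
    using M_nonneg by (simp add: algebra_simps mult_nonneg_nonneg)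
  finally show ?thesis .
qed

lemma euler_Cauchy_step:
  assumes t: "0 \<le> t" and x: "(x, z) \<in> A" "(z, w) \<in> A"
  shows "norm (euler (Suc n) t x - euler n t x) \<le> 2 * t\<^sup>2 * (M * (M * (M * norm w))) * (1 / 2) ^ n"
proof -
  define h where "h = t / 2 ^ n"
  have h: "0 \<le> h" "0 \<le> h / 2" using t by (auto simp: h_def)
  let ?P = "J h" and ?Q = "\<lambda>y. J (h / 2) (J (h / 2) y)"
  have Q_power: "(?Q ^^ m) y = (J (h / 2) ^^ (2 * m)) y" for m y
    by (induction m) auto
  have Q_diff: "?Q (y - y') = ?Q y - ?Q y'" for y y'
    using h by (simp add: J_diff)
  have Q_power_add: "(?Q ^^ m) (y + y') = (?Q ^^ m) y + (?Q ^^ m) y'" for m y y'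
    using h by (simp add: Q_power J_power_add)
  \<comment> \<open>The outer power \<open>j\<close> is part of the induction: a defect created in
    one step is propagated by all later half steps together, which costs M once instead of once per
    step.\<close>
  have "norm ((?Q ^^ j) ((?P ^^ m) x - (?Q ^^ m) x)) \<le> real m * (M * (2 * h\<^sup>2 * (M * (M * norm w))))" for m j
  proof (induction m arbitrary: j)
    case 0
    have "(?Q ^^ j) 0 = 0"
      using h(2) J_power_scaleR[OF h(2), of "2 * j" 0 0] by (simp add: Q_power)
    then show ?case by simp
  next
    case (Suc m)
    let ?y = "(?P ^^ m) x"
    have "(?P ^^ Suc m) x - (?Q ^^ Suc m) x = ?Q (?y - (?Q ^^ m) x) + (?P ?y - ?Q ?y)"
      using Q_diff[of ?y "(?Q ^^ m) x"] by simp
    then have "(?Q ^^ j) ((?P ^^ Suc m) x - (?Q ^^ Suc m) x)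
      = (?Q ^^ Suc j) (?y - (?Q ^^ m) x) + (?Q ^^ j) (?P ?y - ?Q ?y)"
      by (simp add: Q_power_add funpow_Suc_right del: funpow.simps(2))
    also have "norm \<dots> \<le> real m * (M * (2 * h\<^sup>2 * (M * (M * norm w)))) + M * (2 * h\<^sup>2 * (M * (M * norm w)))"
    proof (intro norm_triangle_mono Suc)
      have "norm ((?Q ^^ j) (?P ?y - ?Q ?y)) \<le> M * norm (?P ?y - ?Q ?y)"
        unfolding Q_power by (rule J_power_bound[OF h(2)])
      also have "norm (?P ?y - ?Q ?y) \<le> 2 * h\<^sup>2 * (M * norm ((?P ^^ m) w))"
        by (rule J_halving[OF h(1) J_power_graph_pair[OF h(1) x(1)] J_power_graph_pair[OF h(1) x(2)]])
      also have "norm ((?P ^^ m) w) \<le> M * norm w"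
        by (rule J_power_bound[OF h(1)])
      finally show "norm ((?Q ^^ j) (?P ?y - ?Q ?y)) \<le> M * (2 * h\<^sup>2 * (M * (M * norm w)))"
        using M_nonneg by (simp add: mult_left_mono)
    qed
    finally show ?case by (simp add: algebra_simps)
  qed
  from this[of 0 "2 ^ n"]
  have "norm (euler n t x - euler (Suc n) t x) \<le> 2 ^ n * (M * (2 * h\<^sup>2 * (M * (M * norm w))))"
    unfolding euler_def power_Suc Q_power by (simp add: h_def mult.commute)
  also have "\<dots> = 2 * t\<^sup>2 * (M * (M * (M * norm w))) * (1 / 2) ^ n"
    by (simp add: h_def power_divide power2_eq_square field_simps)
  finally show ?thesis by (simp add: norm_minus_commute)
qed

lemma euler_linear: "0 \<le> t \<Longrightarrow> euler n t (x + y) = euler n t x + euler n t y"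
  "0 \<le> t \<Longrightarrow> euler n t (x - y) = euler n t x - euler n t y"
  "0 \<le> t \<Longrightarrow> euler n t (r *\<^sub>R x) = r *\<^sub>R euler n t x"
  by (simp_all add: euler_def J_power_add J_power_diff J_power_scaleR)

lemma euler_bound: "0 \<le> t \<Longrightarrow> norm (euler n t x) \<le> M * norm x"
  by (simp add: euler_def J_power_bound)

lemma J_in_domain_2: "0 < h \<Longrightarrow> (x, z) \<in> A \<Longrightarrow> J h x \<in> domain_2"
  unfolding domain_2_def using J_graph_pair[of h x z] J_graph[of h z] by (auto simp: less_imp_le)

text \<open>For x in the domain, J h x lies in the domain of A^2 and tends to x as h tends to 0,
  since J h x - x is of order h.\<close>

lemma domain_2_dense: "closure domain_2 = UNIV"
proof -
  have "x \<in> closure domain_2" if xz: "(x, z) \<in> A" for x z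
  proof -
    have "(\<lambda>n. J (1 / real (Suc n)) x - x) \<longlonglongrightarrow> 0"
    proof (rule Lim_null_comparison)
      show "\<forall>\<^sub>F n in sequentially. norm (J (1 / real (Suc n)) x - x) \<le> 1 / real (Suc n) * (M * norm z)"
        using J_power_step[OF _ xz, of "1 / real (Suc _)" 1] by simp
      show "(\<lambda>n. 1 / real (Suc n) * (M * norm z)) \<longlonglongrightarrow> 0"
        using tendsto_mult[OF LIMSEQ_Suc[OF lim_1_over_n] tendsto_const, of "M * norm z"] by simp
    qed
    then have "(\<lambda>n. J (1 / real (Suc n)) x) \<longlonglongrightarrow> x"
      by (rule LIM_zero_cancel)
    moreover have "J (1 / real (Suc n)) x \<in> domain_2" for n
      by (rule J_in_domain_2[OF _ xz]) simp
    ultimately show ?thesis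
      unfolding closure_sequential by (intro exI[of _ "\<lambda>n. J (1 / real (Suc n)) x"]) simp
  qed
  then have "Domain A \<subseteq> closure domain_2" by blast
  then have "closure (Domain A) \<subseteq> closure domain_2" by (rule closure_minimal) simp
  then show ?thesis using dense by auto
qed

end

text \<open>The common Lipschitz constant carries the Cauchy property over by an argument with e /
  3. No sign of M is assumed, hence \<bar>M\<bar> + 1 in the choice of \<open>d\<close>.\<close>

lemma convergent_from_dense:
  fixes F :: "nat \<Rightarrow> 'a::real_normed_vector \<Rightarrow> 'b::banach"
  assumes "\<And>n x y. norm (F n x - F n y) \<le> M * norm (x - y)" "closure D = UNIV"
    and "\<And>x. x \<in> D \<Longrightarrow> convergent (\<lambda>n. F n x)"
  shows "convergent (\<lambda>n. F n x)"
proof -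
  have "Cauchy (\<lambda>n. F n x)"
  proof (rule metric_CauchyI)
    fix e :: real assume e: "0 < e"
    define d where "d = e / (3 * (\<bar>M\<bar> + 1))"
    have d: "0 < d" using e by (auto simp: d_def intro!: divide_pos_pos mult_pos_pos)
    then obtain y where y: "y \<in> D" "norm (x - y) < d"
      using assms(2) closure_approachable[of x D] by (metis UNIV_I dist_norm norm_minus_commute)
    have "M * norm (x - y) \<le> (\<bar>M\<bar> + 1) * norm (x - y)" by (intro mult_right_mono) auto
    also have "\<dots> < (\<bar>M\<bar> + 1) * d" using y(2) by (intro mult_strict_left_mono) auto
    also have "\<dots> = e / 3" by (simp add: d_def field_simps)
    finally have small: "norm (F n x - F n y) < e / 3" for n using assms(1)[of n x y] by linarith
    have "Cauchy (\<lambda>n. F n y)" using assms(3)[OF y(1)] by (rule convergent_Cauchy)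
    then obtain N where N: "\<forall>m\<ge>N. \<forall>n\<ge>N. dist (F m y) (F n y) < e / 3"
      using e unfolding Cauchy_def by (metis divide_pos_pos zero_less_numeral)
    have "dist (F m x) (F n x) < e" if "m \<ge> N" "n \<ge> N" for m n
    proof -
      have "dist (F m x) (F n x) \<le> dist (F m x) (F m y) + dist (F m y) (F n y) + dist (F n x) (F n y)"
        using dist_triangle[of "F m x" "F n x" "F m y"] dist_triangle[of "F m y" "F n x" "F n y"]
        by (simp add: dist_commute)
      also have "\<dots> < e / 3 + e / 3 + e / 3"
        using small[of m] small[of n] N that unfolding dist_norm by (intro add_strict_mono) auto
      finally show ?thesis by simp
    qed
    then show "\<exists>M. \<forall>m\<ge>M. \<forall>n\<ge>M. dist (F m x) (F n x) < e" by blast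
  qed
  then show ?thesis by (rule Cauchy_convergent)
qed

text \<open>Approximating x from the dense set gives a uniform limit of continuous functions,
  because the Lipschitz constant does not depend on t.\<close>

lemma continuous_on_from_dense:
  fixes F :: "'t::metric_space \<Rightarrow> 'a::real_normed_vector \<Rightarrow> 'b::real_normed_vector"
  assumes "\<And>t x y. t \<in> T \<Longrightarrow> norm (F t x - F t y) \<le> M * norm (x - y)" "closure D = UNIV"
    and "\<And>x. x \<in> D \<Longrightarrow> continuous_on T (\<lambda>t. F t x)"
  shows "continuous_on T (\<lambda>t. F t x)"
proof -
  have "x \<in> closure D" using assms(2) by simp
  then obtain X where X: "\<And>n. X n \<in> D" "X \<longlonglongrightarrow> x" unfolding closure_sequential by blast
  have "(\<lambda>n. M * norm (X n - x)) \<longlonglongrightarrow> M * norm (x - x)"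
    by (intro tendsto_intros X)
  then have lim: "(\<lambda>n. M * norm (X n - x)) \<longlonglongrightarrow> 0" by simp
  have "uniform_limit T (\<lambda>n t. F t (X n)) (\<lambda>t. F t x) sequentially"
  proof (rule uniform_limitI)
    fix e :: real assume "0 < e"
    with order_tendstoD(2)[OF lim] have "\<forall>\<^sub>F n in sequentially. M * norm (X n - x) < e" by blast
    then show "\<forall>\<^sub>F n in sequentially. \<forall>t\<in>T. dist (F t (X n)) (F t x) < e"
    proof eventually_elim
      case (elim n)
      show ?case
      proof
        fix t assume "t \<in> T"
        with assms(1)[of t "X n" x] elim show "dist (F t (X n)) (F t x) < e"
          by (simp add: dist_norm)
      qed
    qed
  qed
  then show ?thesis
    by (rule uniform_limit_theorem[rotated]) (auto intro!: always_eventually assms(3) X(1))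
qed

context resolvent_family
begin

lemma euler_convergent:
  assumes "0 \<le> t"
  shows "convergent (\<lambda>n. euler n t x)"
proof (rule convergent_from_dense[OF _ domain_2_dense])
  show "norm (euler n t x - euler n t y) \<le> M * norm (x - y)" for n x y
    using euler_bound[OF assms] by (simp add: euler_linear(2)[OF assms, symmetric])
  fix x assume "x \<in> domain_2"
  then obtain z w where x: "(x, z) \<in> A" "(z, w) \<in> A" by (auto simp: domain_2_def)
  have "summable (\<lambda>n. euler (Suc n) t x - euler n t x)"
    by (rule summable_comparison_test'[OF _ euler_Cauchy_step[OF assms x]])
      (intro summable_mult summable_geometric, simp)
  then have "convergent (\<lambda>n. (\<Sum>i<n. euler (Suc i) t x - euler i t x))"
    by (simp add: summable_iff_convergent)
  then have "convergent (\<lambda>n. euler n t x - euler 0 t x)"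
    unfolding sum_lessThan_telescope[of "\<lambda>n. euler n t x"] .
  then show "convergent (\<lambda>n. euler n t x)"
    using convergent_add[OF _ convergent_const[of "euler 0 t x"]] by fastforce
qed

text \<open>Extended by the identity to negative times, so that no case distinctions are needed.\<close>

definition S :: "real \<Rightarrow> 'h \<Rightarrow> 'h" where
  "S t x = lim (\<lambda>n. euler n (max 0 t) x)"

lemma S_lim: "0 \<le> t \<Longrightarrow> (\<lambda>n. euler n t x) \<longlonglongrightarrow> S t x"
  using euler_convergent[of t x] by (simp add: S_def convergent_LIMSEQ_iff max_def)

lemma S_max: "S (max 0 t) x = S t x"
  by (simp add: S_def)

lemma S_lim': "(\<lambda>n. euler n (max 0 t) x) \<longlonglongrightarrow> S t x"
  using S_lim[of "max 0 t" x] by (simp add: S_max)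

lemma S_add: "S t (x + y) = S t x + S t y"
  using tendsto_add[OF S_lim'[of t x] S_lim'[of t y]] S_lim'[of t "x + y"]
  by (simp add: euler_linear LIMSEQ_unique)

lemma S_scaleR: "S t (r *\<^sub>R x) = r *\<^sub>R S t x"
  using tendsto_scaleR[OF tendsto_const S_lim'[of t x], of r] S_lim'[of t "r *\<^sub>R x"]
  by (simp add: euler_linear LIMSEQ_unique)

lemma S_bound: "norm (S t x) \<le> M * norm x"
  by (rule LIMSEQ_le_const2[OF tendsto_norm[OF S_lim'[of t]]]) (auto intro!: exI euler_bound)

lemma S_bounded_linear: "bounded_linear (S t)"
  by (rule bounded_linear_intro[where K=M]) (auto simp: S_add S_scaleR S_bound mult.commute)

lemma J_bounded_linear: "0 \<le> h \<Longrightarrow> bounded_linear (J h)"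
  by (rule bounded_linear_intro[where K=M]) (auto simp: J_add J_scaleR J_bound mult.commute)

lemma S_diff: "S t (x - y) = S t x - S t y"
  using bounded_linear.linear[OF S_bounded_linear] by (rule linear_diff)

lemma S_0: "S 0 x = x"
proof -
  have "(J 0 ^^ m) x = x" for m by (induction m) (auto simp: J_0)
  then have "euler n 0 x = x" for n by (simp add: euler_def)
  then show ?thesis using S_lim[of 0 x] by (simp add: LIMSEQ_const_iff)
qed

lemma S_J_commute:
  assumes "0 \<le> h"
  shows "S t (J h x) = J h (S t x)"
proof -
  have "(\<lambda>n. J h (euler n (max 0 t) x)) \<longlonglongrightarrow> J h (S t x)"
    by (rule bounded_linear.tendsto[OF J_bounded_linear[OF assms] S_lim'])
  then have "(\<lambda>n. euler n (max 0 t) (J h x)) \<longlonglongrightarrow> J h (S t x)"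
    using assms by (simp add: euler_def J_power_commute)
  then show ?thesis using S_lim' LIMSEQ_unique by blast
qed

text \<open>The limit of \<open>J_power_minus_J_power\<close> with 2^n steps of sizes t / 2^n and s
  / 2^n. Multiplied by 2^n these are the times t and s, while the term with the isolated step size s
  / 2^n disappears.\<close>

lemma S_increment:
  assumes t: "0 \<le> s" "0 \<le> t" and x: "(x, z) \<in> A" "(z, w) \<in> A"
  shows "norm (S t x - S s x - (t - s) *\<^sub>R S s z) \<le> (t - s)\<^sup>2 * (M * (M * (M * norm w)))"
proof -
  let ?b = "\<lambda>n. (t - s)\<^sup>2 * (M * (M * (M * norm w))) + \<bar>t - s\<bar> * (s / 2 ^ n) * (M * (M * norm w))"
  have "norm (euler n t x - euler n s x - (t - s) *\<^sub>R euler n s z) \<le> ?b n" for n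
  proof -
    have "real (2 ^ n) * (t / 2 ^ n - s / 2 ^ n) = t - s"
      "real (2 ^ n) * \<bar>t / 2 ^ n - s / 2 ^ n\<bar> = \<bar>t - s\<bar>"
      by (simp_all add: field_simps abs_divide flip: diff_divide_distrib)
    then show ?thesis
      using J_power_minus_J_power[of "t / 2 ^ n" "s / 2 ^ n" x z w "2 ^ n"] t x
      by (simp only: euler_def) simp
  qed
  moreover have "(\<lambda>n. norm (euler n t x - euler n s x - (t - s) *\<^sub>R euler n s z))
      \<longlonglongrightarrow> norm (S t x - S s x - (t - s) *\<^sub>R S s z)"
    using t by (intro tendsto_intros S_lim)
  moreover have "?b \<longlonglongrightarrow> (t - s)\<^sup>2 * (M * (M * (M * norm w))) + \<bar>t - s\<bar> * 0 * (M * (M * norm w))"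
    by (intro tendsto_add tendsto_mult tendsto_const LIMSEQ_divide_realpow_zero) simp
  ultimately show ?thesis
    using LIMSEQ_le[of _ _ ?b] by force
qed

text \<open>The remainder in \<open>S_increment\<close> is quadratic. The restriction to the domain
  of A^2 is removed later in integrated form, in \<open>V_resolvent\<close> and
  \<open>V_generator\<close>.\<close>

lemma S_has_vector_derivative:
  assumes "0 \<le> s" and x: "(x, z) \<in> A" "(z, w) \<in> A"
  shows "((\<lambda>t. S t x) has_vector_derivative S s z) (at s within {0..})"
  unfolding has_vector_derivative_def has_derivative_within_alt2
proof (intro conjI allI impI bounded_linear_scaleR_left)
  fix e :: real assume e: "0 < e"
  define B where "B = M * (M * (M * norm w)) + 1"
  have B: "0 < B" using M_nonneg by (auto simp: B_def intro!: add_nonneg_pos)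
  have "\<forall>\<^sub>F t in at s within {0..}. t \<in> {0..} \<and> dist t s < e / B"
    using e B by (auto simp: eventually_at intro!: exI[of _ "e / B"])
  then show "\<forall>\<^sub>F t in at s within {0..}. norm (S t x - S s x - (t - s) *\<^sub>R S s z) \<le> e * norm (t - s)"
  proof eventually_elim
    case (elim t)
    have "norm (S t x - S s x - (t - s) *\<^sub>R S s z) \<le> (t - s)\<^sup>2 * (M * (M * (M * norm w)))"
      using elim assms by (intro S_increment) auto
    also have "\<dots> \<le> (t - s)\<^sup>2 * B" by (intro mult_left_mono) (auto simp: B_def)
    also have "\<dots> = \<bar>t - s\<bar> * (\<bar>t - s\<bar> * B)" by (simp add: power2_eq_square abs_mult_self_eq)
    also have "\<dots> \<le> \<bar>t - s\<bar> * e"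
      using elim B by (intro mult_left_mono) (auto simp: dist_real_def field_simps)
    finally show ?case by (simp add: mult.commute)
  qed
qed

lemma S_continuous: "continuous_on UNIV (\<lambda>t. S t x)"
proof -
  have "continuous_on {0..} (\<lambda>t. S t x)"
  proof (rule continuous_on_from_dense[OF _ domain_2_dense])
    show "norm (S t x - S t y) \<le> M * norm (x - y)" for t x y
      using S_bound by (simp add: S_diff[symmetric])
    fix x assume "x \<in> domain_2"
    then obtain z w where "(x, z) \<in> A" "(z, w) \<in> A" by (auto simp: domain_2_def)
    then show "continuous_on {0..} (\<lambda>t. S t x)"
      by (auto simp: continuous_on_eq_continuous_within
        intro!: has_vector_derivative_continuous S_has_vector_derivative)
  qed
  then have "continuous_on UNIV (\<lambda>t. S (max 0 t) x)"
    by (rule continuous_on_compose2) (auto intro!: continuous_intros)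
  then show ?thesis by (simp add: S_max)
qed

text \<open>Strong continuity and the uniform bound give continuity in both arguments. It is what
  makes the integrand S (t - s) (G s) of the mild solution measurable.\<close>

lemma S_jointly_continuous: "continuous_on UNIV (\<lambda>(t, x). S t x)"
  unfolding continuous_on_sequentially
proof (intro allI impI ballI, unfold o_def)
  fix X :: "nat \<Rightarrow> real \<times> 'h" and a assume "(\<forall>n. X n \<in> UNIV) \<and> X \<longlonglongrightarrow> a"
  then have "X \<longlonglongrightarrow> a" by simp
  then have X: "(\<lambda>n. fst (X n)) \<longlonglongrightarrow> fst a" "(\<lambda>n. snd (X n)) \<longlonglongrightarrow> snd a"
    by (auto intro: tendsto_fst tendsto_snd)
  have "(\<lambda>n. S (fst (X n)) (snd (X n) - snd a)) \<longlonglongrightarrow> 0"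
  proof (rule Lim_null_comparison)
    show "(\<lambda>n. M * norm (snd (X n) - snd a)) \<longlonglongrightarrow> 0"
      using tendsto_mult[OF tendsto_const tendsto_norm[OF tendsto_diff[OF X(2) tendsto_const]], of M "snd a"] by simp
  qed (simp add: S_bound)
  moreover have "(\<lambda>n. S (fst (X n)) (snd a)) \<longlonglongrightarrow> S (fst a) (snd a)"
    using S_continuous[of "snd a"] X(1) by (simp add: continuous_on_sequentially o_def)
  ultimately have "(\<lambda>n. S (fst (X n)) (snd (X n) - snd a) + S (fst (X n)) (snd a)) \<longlonglongrightarrow> 0 + S (fst a) (snd a)"
    by (rule tendsto_add)
  then show "(\<lambda>n. case X n of (t, x) \<Rightarrow> S t x) \<longlonglongrightarrow> (case a of (t, x) \<Rightarrow> S t x)"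
    by (simp add: S_diff case_prod_beta')
qed

end

section \<open>Inhomogeneous evolution equations\<close>

locale separable_resolvent_family = resolvent_family A J M
  for A :: "('h::{banach, second_countable_topology} \<times> 'h) set" and J M
begin

text \<open>The integrated semigroup. It maps every vector into the domain of A, which S alone does
  not, and it appears when the order of integration is exchanged in the primitive of a mild
  solution.\<close>

definition V :: "real \<Rightarrow> 'h \<Rightarrow> 'h" where
  "V t y = prim (\<lambda>s. S s y) 0 t"

lemma S_int: "set_integrable lborel {a<..<b} (\<lambda>s. S s y)"
  by (rule continuous_set_integrable_Ioo[OF S_continuous])

lemma V_bound: "norm (V t y) \<le> M * norm y * max 0 t"
proof (cases "0 \<le> t")
  case True
  then have "norm (V t y) \<le> M * norm y * (t - 0)"
    unfolding V_def by (intro norm_prim_bound S_int) (auto simp: S_bound)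
  then show ?thesis using True by simp
next
  case False
  then show ?thesis by (simp add: V_def prim_def set_lebesgue_integral_def)
qed

lemma V_bounded_linear: "bounded_linear (V t)"
proof (rule bounded_linear_intro[where K="M * max 0 t"])
  show "V t (x + y) = V t x + V t y" for x y
    unfolding V_def S_add by (rule prim_add_fun[OF S_int S_int])
  show "V t (r *\<^sub>R x) = r *\<^sub>R V t x" for r x
    unfolding V_def S_scaleR prim_def by simp
  show "norm (V t x) \<le> norm x * (M * max 0 t)" for x
    using V_bound[of t x] by (simp add: mult_ac)
qed

lemma V_J_commute:
  assumes "0 \<le> h"
  shows "V t (J h y) = J h (V t y)"
proof -
  have "V t (J h y) = (LINT s|lborel. J h (indicator {0<..<t} s *\<^sub>R S s y))"
    unfolding V_def prim_def set_lebesgue_integral_def using assms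
    by (simp add: S_J_commute J_scaleR)
  also have "\<dots> = J h (V t y)"
    unfolding V_def prim_def set_lebesgue_integral_def
    using S_int[of 0 t y] J_bounded_linear[OF assms]
    by (intro integral_bounded_linear) (auto simp: set_integrable_def)
  finally show ?thesis .
qed

text \<open>
  This says that \<open>V t y\<close> lies in the domain of $A$ with $A V(t) y = S(t) y - y$. Stated through the bounded
  operator \<open>J 1\<close>, it holds for all \<open>y\<close> by density and can be integrated.
\<close>

lemma V_resolvent: 
  assumes "0 \<le> t"
  shows "V t y = J 1 (V t y - S t y + y)"
proof -
  have blJ: "bounded_linear (J 1)" by (rule J_bounded_linear) simp
  define D where "D y = V t y - J 1 (V t y - S t y + y)" for y
  have "bounded_linear D"
    unfolding D_def
    by (intro bounded_linear_sub bounded_linear_compose[OF blJ] bounded_linear_add V_bounded_linear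
        S_bounded_linear bounded_linear_ident)
  then have "closed (D -` {0})"
    by (intro continuous_closed_vimage) (auto simp: bounded_linear.continuous linear_continuous_at)
  moreover have "D y = 0" if yz: "(y, z) \<in> A" for y z
  proof -
    \<comment> \<open>For y in the domain, \<open>J 1 y\<close> lies in the domain of A^2 with A (J
      1 y) = J 1 y - y = J 1 z, so the derivative formula for S applies to it.\<close>
    have g: "(J 1 y, J 1 y - y) \<in> A" "(J 1 z, J 1 z - z) \<in> A"
      using J_graph[of 1 y] J_graph[of 1 z] by simp_all
    have Jz: "J 1 y - y = J 1 z" using J_step[OF _ yz, of 1] by simp
    have "V t (J 1 y - y) = S t (J 1 y) - S 0 (J 1 y)"
      unfolding V_def
      using g assms Jz by (intro prim_vector_derivative_eq S_continuous S_has_vector_derivative) auto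
    then have "J 1 (V t y) - V t y = J 1 (S t y) - J 1 y"
      using bounded_linear.linear[OF V_bounded_linear, of t]
      by (simp add: S_0 S_J_commute V_J_commute linear_diff)
    then show ?thesis
      by (simp add: D_def J_diff J_add algebra_simps)
  qed
  then have "Domain A \<subseteq> D -` {0}" by blast
  ultimately have "closure (Domain A) \<subseteq> D -` {0}" by (simp add: closure_minimal)
  then show ?thesis using dense by (auto simp: D_def)
qed

text \<open>An element of the domain is a value of the resolvent, x = J 1 (x - z). This reduces the
  claim to \<open>V_resolvent\<close> for x - z and so passes from the domain of A^2 to that of
  A.\<close>

lemma V_generator:
  assumes "0 \<le> t" "(x, z) \<in> A"
  shows "V t z = S t x - x"
proof -
  have xz: "J 1 (x - z) = x" using graph_J[OF _ assms(2), of 1] by simp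
  have "V t z = V t (J 1 (x - z) - (x - z))" by (simp add: xz)
  also have "\<dots> = J 1 (V t (x - z)) - V t (x - z)"
    using bounded_linear.linear[OF V_bounded_linear, of t] by (simp add: V_J_commute linear_diff)
  also have "\<dots> = J 1 (S t (x - z)) - J 1 (x - z)"
    using V_resolvent[OF assms(1), of "x - z"] by (simp add: J_add J_diff algebra_simps)
  also have "\<dots> = S t x - x"
    by (simp add: S_J_commute[symmetric] xz)
  finally show ?thesis .
qed

text \<open>Duhamel's formula, the variation of constants for z' = A z + G with initial value
  z0.\<close>

definition mild :: "'h \<Rightarrow> (real \<Rightarrow> 'h) \<Rightarrow> real \<Rightarrow> 'h" where
  "mild z0 G t = S t z0 + prim (\<lambda>s. S (t - s) (G s)) 0 t"

context
  fixes G :: "real \<Rightarrow> 'h"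
  assumes G: "integrable lborel G"
begin

lemma G_measurable [measurable]: "G \<in> borel_measurable borel"
  using G by (simp add: borel_measurable_integrable)

lemma S_measurable [measurable (raw)]:
  assumes [measurable]: "f \<in> borel_measurable N" "g \<in> borel_measurable N"
  shows "(\<lambda>x. S (f x) (g x)) \<in> borel_measurable N"
proof -
  have "(\<lambda>(t, x). S t x) \<in> borel_measurable (borel \<Otimes>\<^sub>M borel)"
    using borel_measurable_continuous_onI[OF S_jointly_continuous] by (simp add: borel_prod)
  then have "(\<lambda>x. case (f x, g x) of (t, x) \<Rightarrow> S t x) \<in> borel_measurable N"
    by (rule measurable_compose[rotated]) measurable
  then show ?thesis by simp
qed

lemma convolution_integrable: "integrable lborel (\<lambda>s. S (t - s) (G s))"
  by (rule Bochner_Integration.integrable_bound[where f="\<lambda>s. M * norm (G s)"])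
    (use G S_bound M_nonneg in auto)

lemma mild_continuous: "continuous_on UNIV (mild z0 G)"
  unfolding mild_def prim_def
proof (intro continuous_on_add S_continuous continuous_on_truncated_integral[where w="\<lambda>s. M * norm (G s)"])
  show "continuous_on UNIV (\<lambda>t. S (t - s) (G s))" for s
    by (rule continuous_on_compose2[OF S_continuous]) (auto intro!: continuous_intros)
qed (use G S_bound in auto)

lemma mild_bound: "norm (mild z0 G t) \<le> M * (norm z0 + (LINT s|lborel. norm (G s)))"
proof -
  have "norm (prim (\<lambda>s. S (t - s) (G s)) 0 t) \<le> (LINT s|lborel. norm (S (t - s) (G s)))"
    by (rule norm_prim_le[OF convolution_integrable])
  also have "\<dots> \<le> (LINT s|lborel. M * norm (G s))"
    using G S_bound by (intro integral_mono integrable_norm convolution_integrable) auto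
  finally have "norm (prim (\<lambda>s. S (t - s) (G s)) 0 t) \<le> M * (LINT s|lborel. norm (G s))" by simp
  with S_bound[of t z0] show ?thesis
    unfolding mild_def by (simp add: distrib_left norm_triangle_mono)
qed

text \<open>Fubini on the triangle 0 < r < s < t: integrating S (s - r) (G r) over s first gives V
  (t - r) (G r). Both claims come from the integrability of the same function
  \<open>h\<close>.\<close>

lemma V_convolution_integrable: "set_integrable lborel {0<..<t} (\<lambda>s. V (t - s) (G s))"
  and prim_convolution: "0 \<le> t \<Longrightarrow> prim (\<lambda>s. prim (\<lambda>r. S (s - r) (G r)) 0 s) 0 t = prim (\<lambda>r. V (t - r) (G r)) 0 t"
proof -
  define h where "h s r = indicator {(s, r). 0 < r \<and> r < s \<and> s < t} (s, r) *\<^sub>R S (s - r) (G r)" for s r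
  have [measurable]: "(\<lambda>(s, r). h s r) \<in> borel_measurable (borel \<Otimes>\<^sub>M borel)"
  proof -
    have "Measurable.pred (borel \<Otimes>\<^sub>M borel) (\<lambda>x. 0 < snd x \<and> snd x < fst x \<and> fst x < t)"
      by measurable
    then have [measurable]: "{(s, r). 0 < r \<and> r < s \<and> s < t} \<in> sets (borel \<Otimes>\<^sub>M borel)"
      by (simp add: pred_def space_pair_measure case_prod_unfold)
    show ?thesis unfolding h_def by measurable
  qed
  have h: "integrable (lborel \<Otimes>\<^sub>M lborel) (\<lambda>(s, r). h s r)"
  proof (rule Bochner_Integration.integrable_bound)
    show "integrable (lborel \<Otimes>\<^sub>M lborel) (\<lambda>(s, r). indicator {0<..<t} s *\<^sub>R (M * norm (G r)))"
      using G by (intro integrable_lborel_pair_scaleR) (cases "0 \<le> t"; auto)+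
    show "AE x in lborel \<Otimes>\<^sub>M lborel. norm (case x of (s, r) \<Rightarrow> h s r)
      \<le> norm (case x of (s, r) \<Rightarrow> indicator {0<..<t} s *\<^sub>R (M * norm (G r)))"
      using S_bound M_nonneg by (intro AE_I2) (auto simp: h_def indicator_def)
  qed measurable
  have inner1: "(LINT r|lborel. h s r) = indicator {0<..<t} s *\<^sub>R prim (\<lambda>r. S (s - r) (G r)) 0 s" for s
  proof -
    have "h s r = indicator {0<..<t} s *\<^sub>R indicator {0<..<s} r *\<^sub>R S (s - r) (G r)" for r
      by (auto simp: h_def indicator_def)
    then show ?thesis by (simp add: prim_def set_lebesgue_integral_def del: scaleR_scaleR)
  qed
  have inner2: "(LINT s|lborel. h s r) = indicator {0<..<t} r *\<^sub>R V (t - r) (G r)" for r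
  proof -
    have "h s r = indicator {0<..<t} r *\<^sub>R indicator {r<..<t} s *\<^sub>R S (s - r) (G r)" for s
      by (auto simp: h_def indicator_def)
    then have "(LINT s|lborel. h s r) = indicator {0<..<t} r *\<^sub>R prim (\<lambda>s. S (s - r) (G r)) r t"
      by (simp add: prim_def set_lebesgue_integral_def del: scaleR_scaleR)
    then show ?thesis by (simp add: V_def prim_shift[of "\<lambda>s. S s (G r)"])
  qed
  have "integrable lborel (\<lambda>r. LINT s|lborel. h s r)"
    using lborel_pair.integrable_snd[OF h] .
  then show "set_integrable lborel {0<..<t} (\<lambda>s. V (t - s) (G s))"
    by (simp add: set_integrable_def inner2)
  show "prim (\<lambda>s. prim (\<lambda>r. S (s - r) (G r)) 0 s) 0 t = prim (\<lambda>r. V (t - r) (G r)) 0 t"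
    using lborel_pair.Fubini_integral[OF h]
    by (simp add: inner1 inner2) (simp add: prim_def set_lebesgue_integral_def)
qed

text \<open>The primitive splits into S t w0, V t F0 and the convolution of V with G. Each of the
  three is J 1 applied to itself minus its expected image under A; adding these identities gives W =
  J 1 (W - A W), which places the pair in the graph. The initial value w1 + F0 of z is the value
  w'(0) dictated by the equation.\<close>

theorem mild_primitive_in_graph:
  fixes F0 :: 'h
  assumes t: "0 \<le> t" and w: "(w0, w1) \<in> A"
  defines "z \<equiv> mild (w1 + F0) G"
  shows "(w0 + prim z 0 t, z t - (F0 + prim G 0 t)) \<in> A"
proof -
  let ?U = "prim (\<lambda>s. S (t - s) (G s)) 0 t" and ?W = "prim (\<lambda>s. V (t - s) (G s)) 0 t"
  define W where "W = w0 + prim z 0 t"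
  have lin: "linear (V t)" "linear (S t)" "linear (J 1)"
    using bounded_linear.linear[OF V_bounded_linear] bounded_linear.linear[OF S_bounded_linear] J_linear by auto
  have c: "continuous_on UNIV (\<lambda>s. prim (\<lambda>r. S (s - r) (G r)) 0 s)"
    using continuous_on_diff[OF mild_continuous[of 0] S_continuous[of 0]] by (simp add: mild_def)
  have "prim z 0 t = V t (w1 + F0) + prim (\<lambda>s. prim (\<lambda>r. S (s - r) (G r)) 0 s) 0 t"
    unfolding z_def mild_def V_def
    by (rule prim_add_fun[OF S_int continuous_set_integrable_Ioo[OF c]])
  then have "prim z 0 t = V t (w1 + F0) + ?W"
    by (simp only: prim_convolution[OF t])
  then have W: "W = S t w0 + V t F0 + ?W"
    using V_generator[OF t w] lin(1) by (simp add: W_def linear_add)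
  have blJ: "bounded_linear (J 1)" by (rule J_bounded_linear) simp
  have conv: "?W = J 1 (?W - ?U + prim G 0 t)"
  proof -
    have i1: "set_integrable lborel {0<..<t} (\<lambda>s. S (t - s) (G s))" "set_integrable lborel {0<..<t} G"
      using convolution_integrable G by (auto simp: set_integrable_def intro!: integrable_mult_indicator)
    have i2: "set_integrable lborel {0<..<t} (\<lambda>s. V (t - s) (G s) - S (t - s) (G s))"
      by (rule set_integral_diff(1)[OF V_convolution_integrable i1(1)])
    have i3: "set_integrable lborel {0<..<t} (\<lambda>s. V (t - s) (G s) - S (t - s) (G s) + G s)"
      by (rule set_integral_add(1)[OF i2 i1(2)])
    \<comment> \<open>\<open>V_resolvent\<close> is used under the integral at time t - s for each
      s, and then the bounded operator \<open>J 1\<close> is pulled out.\<close>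
    have "?W = (LINT s|lborel. J 1 (indicator {0<..<t} s *\<^sub>R (V (t - s) (G s) - S (t - s) (G s) + G s)))"
      unfolding prim_def set_lebesgue_integral_def
      by (intro Bochner_Integration.integral_cong)
        (auto simp: indicator_def V_resolvent[symmetric] linear_0[OF lin(3)])
    also have "\<dots> = J 1 (prim (\<lambda>s. V (t - s) (G s) - S (t - s) (G s) + G s) 0 t)"
      unfolding prim_def set_lebesgue_integral_def
      using i3 by (intro integral_bounded_linear[OF blJ]) (simp add: set_integrable_def)
    also have "prim (\<lambda>s. V (t - s) (G s) - S (t - s) (G s) + G s) 0 t = ?W - ?U + prim G 0 t"
      by (simp add: prim_add_fun[OF i2 i1(2)] prim_diff_fun[OF V_convolution_integrable i1(1)])
    finally show ?thesis .
  qed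
  have "w0 = J 1 (w0 - w1)" using graph_J[OF _ w, of 1] by simp
  then have "S t w0 = J 1 (S t w0 - S t w1)"
    by (metis S_J_commute S_diff zero_le_one)
  with V_resolvent[OF t, of F0] conv
  have "W = J 1 (S t w0 - S t w1) + J 1 (V t F0 - S t F0 + F0) + J 1 (?W - ?U + prim G 0 t)"
    unfolding W by simp
  also have "\<dots> = J 1 (W - (z t - (F0 + prim G 0 t)))"
    unfolding linear_add[OF lin(3), symmetric] W z_def mild_def
    by (rule arg_cong[of _ _ "J 1"]) (simp add: linear_add[OF lin(2)] algebra_simps)
  finally have J: "J 1 (W - (z t - (F0 + prim G 0 t))) = W" ..
  from J_graph[of 1 "W - (z t - (F0 + prim G 0 t))"] show ?thesis
    unfolding J by (simp add: W_def)
qed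

end
end

section \<open>Damped skew-adjoint systems\<close>

text \<open>The projection theorem: a minimising sequence for the distance from y to R converges,
  and y minus its limit is orthogonal to R.\<close>

lemma closed_subspace_orthogonal:
  fixes R :: "'h::{real_inner, complete_space} set"
  assumes R: "subspace R" "closed R" and "R \<noteq> UNIV"
  obtains n where "n \<noteq> 0" "\<And>x. x \<in> R \<Longrightarrow> inner n x = 0"
proof -
  obtain y where y: "y \<notin> R" using assms(3) by blast
  have R0: "R \<noteq> {}" using R(1) subspace_0 by blast
  define d where "d = infdist y R"
  have d: "d \<le> dist y x" if "x \<in> R" for x
    unfolding d_def using that by (rule infdist_le)
  have d0: "0 \<le> d" by (simp add: d_def infdist_nonneg)
  have "\<exists>x\<in>R. (dist y x)\<^sup>2 < d\<^sup>2 + 1 / Suc n" for n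
  proof (rule ccontr)
    assume *: "\<not> ?thesis"
    have "sqrt (d\<^sup>2 + 1 / Suc n) \<le> (INF x\<in>R. dist y x)"
    proof (intro cINF_greatest R0)
      fix x assume "x \<in> R"
      with * have "d\<^sup>2 + 1 / Suc n \<le> (dist y x)\<^sup>2" by (meson not_le)
      then show "sqrt (d\<^sup>2 + 1 / Suc n) \<le> dist y x"
        by (intro real_le_lsqrt) auto
    qed
    then have "sqrt (d\<^sup>2 + 1 / Suc n) \<le> d"
      using R0 by (simp add: d_def infdist_notempty)
    then have "d\<^sup>2 + 1 / Suc n \<le> d\<^sup>2"
      by (rule sqrt_le_D)
    then show False by simp
  qed
  then obtain X where X: "\<And>n. X n \<in> R" "\<And>n. (dist y (X n))\<^sup>2 < d\<^sup>2 + 1 / Suc n" by metis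
  have close: "(dist (X m) (X n))\<^sup>2 \<le> 2 / Suc m + 2 / Suc n" for m n
  proof -
    \<comment> \<open>The midpoint lies in R, hence at distance at least \<open>d\<close> from y.
      The parallelogram law then bounds the distance of two approximants by their excess over
      d^2.\<close>
    have mid: "(1/2) *\<^sub>R (X m + X n) \<in> R"
      using R(1) X(1) by (intro subspace_scale subspace_add)
    have "(dist (X m) (X n))\<^sup>2 + 4 * (dist y ((1/2) *\<^sub>R (X m + X n)))\<^sup>2
        = 2 * (dist y (X m))\<^sup>2 + 2 * (dist y (X n))\<^sup>2"
      by (simp add: dist_norm power2_norm_eq_inner inner_diff inner_add inner_commute algebra_simps)
    moreover have "d\<^sup>2 \<le> (dist y ((1/2) *\<^sub>R (X m + X n)))\<^sup>2"
      using d[OF mid] d0 by (rule power_mono)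
    ultimately show ?thesis using X(2)[of m] X(2)[of n] by simp
  qed
  have "Cauchy X"
  proof (rule metric_CauchyI)
    fix e :: real assume e: "0 < e"
    obtain N where N: "1 / real (Suc N) < e\<^sup>2 / 4"
      using nat_approx_posE[of "e\<^sup>2 / 4"] e by auto
    have "dist (X m) (X n) < e" if "m \<ge> N" "n \<ge> N" for m n
    proof -
      have "1 / real (Suc m) \<le> 1 / real (Suc N)" "1 / real (Suc n) \<le> 1 / real (Suc N)"
        using that by (simp_all add: frac_le)
      then have "(dist (X m) (X n))\<^sup>2 < e\<^sup>2"
        using close[of m n] N by simp
      then show ?thesis using e by (intro power2_less_imp_less[of "dist (X m) (X n)" e]) auto
    qed
    then show "\<exists>M. \<forall>m\<ge>M. \<forall>n\<ge>M. dist (X m) (X n) < e" by blast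
  qed
  then obtain x where x: "X \<longlonglongrightarrow> x" using Cauchy_convergent convergent_def by blast
  have xR: "x \<in> R" by (rule closed_sequentially[OF R(2)]) (use X(1) x in auto)
  have l1: "(\<lambda>n. d\<^sup>2 + 1 / Suc n) \<longlonglongrightarrow> d\<^sup>2 + 0"
    by (intro tendsto_add tendsto_const LIMSEQ_Suc[OF lim_1_over_n])
  have l2: "(\<lambda>n. (dist y (X n))\<^sup>2) \<longlonglongrightarrow> (dist y x)\<^sup>2"
    by (intro tendsto_intros x)
  have "(dist y x)\<^sup>2 \<le> d\<^sup>2 + 0"
    by (rule LIMSEQ_le[OF l2 l1]) (intro exI allI impI less_imp_le X(2))
  then have "(dist y x)\<^sup>2 \<le> d\<^sup>2" by simp
  then have yx: "dist y x \<le> d" using d0 by (rule power2_le_imp_le)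
  define n where "n = y - x"
  have "inner n z = 0" if z: "z \<in> R" for z
  proof (cases "z = 0")
    case False
    \<comment> \<open>The minimiser of the squared norm of n - t z. If n were not orthogonal to z,
      this shift would bring a point of R closer to y.\<close>
    define t where "t = inner n z / inner z z"
    have zz: "0 < inner z z" using False by simp
    have "x + t *\<^sub>R z \<in> R" using xR z R(1) by (intro subspace_add subspace_scale)
    then have "dist y x \<le> dist y (x + t *\<^sub>R z)" using yx d order_trans by blast
    then have "(norm n)\<^sup>2 \<le> (norm (n - t *\<^sub>R z))\<^sup>2"
      by (simp add: n_def dist_norm algebra_simps power_mono)
    also have "\<dots> = (norm n)\<^sup>2 - 2 * t * inner n z + t * t * inner z z"
      unfolding power2_norm_eq_inner by (simp add: inner_diff inner_commute algebra_simps)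
    also have "\<dots> = (norm n)\<^sup>2 - (inner n z)\<^sup>2 / inner z z"
      using zz by (simp add: t_def power2_eq_square field_simps)
    finally have "(inner n z)\<^sup>2 / inner z z \<le> 0" by simp
    then show ?thesis using zz by (simp add: divide_le_0_iff)
  qed simp
  moreover have "n \<noteq> 0" using y xR by (auto simp: n_def)
  ultimately show thesis by (rule that[rotated])
qed

lemma subspace_closure:
  fixes R :: "'h::real_normed_vector set"
  assumes "subspace R"
  shows "subspace (closure R)"
  unfolding subspace_def
proof (intro conjI ballI allI)
  show "0 \<in> closure R" using subspace_0[OF assms] closure_subset by blast
  show "x + y \<in> closure R" if xy: "x \<in> closure R" "y \<in> closure R" for x y
  proof -
    obtain X Y where "\<And>n. X n \<in> R" "X \<longlonglongrightarrow> x" "\<And>n. Y n \<in> R" "Y \<longlonglongrightarrow> y"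
      using xy unfolding closure_sequential by blast
    then show ?thesis
      unfolding closure_sequential using subspace_add[OF assms]
      by (intro exI[of _ "\<lambda>n. X n + Y n"]) (auto intro: tendsto_add)
  qed
  show "k *\<^sub>R x \<in> closure R" if x: "x \<in> closure R" for k x
  proof -
    obtain X where "\<And>n. X n \<in> R" "X \<longlonglongrightarrow> x"
      using x unfolding closure_sequential by blast
    then show ?thesis
      unfolding closure_sequential using subspace_scale[OF assms]
      by (intro exI[of _ "\<lambda>n. k *\<^sub>R X n"]) (auto intro: tendsto_scaleR)
  qed
qed

lemma dense_if_orthogonal_trivial:
  fixes R :: "'h::{real_inner, complete_space} set"
  assumes "subspace R" "\<And>n. (\<And>x. x \<in> R \<Longrightarrow> inner n x = 0) \<Longrightarrow> n = 0"
  shows "closure R = UNIV"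
proof (rule ccontr)
  assume "closure R \<noteq> UNIV"
  then obtain n where n: "n \<noteq> 0" "\<And>x. x \<in> closure R \<Longrightarrow> inner n x = 0"
    using closed_subspace_orthogonal[OF subspace_closure[OF assms(1)] closed_closure] by metis
  have "n = 0"
    by (rule assms(2)) (use n(2) closure_subset in blast)
  with n(1) show False ..
qed

text \<open>
  Each relation is the negative of the adjoint of the other. In the application they are the
  graphs of the edgewise derivative on $H(\mathrm{div})$ and on $H^1_0$.
\<close>

locale skew_adjoint_pair =
  fixes D1 D2 :: "('k::{real_inner, banach, second_countable_topology} \<times> 'k) set"
  assumes D1_iff: "(u, r) \<in> D1 \<longleftrightarrow> (\<forall>(p, q)\<in>D2. inner u q + inner r p = 0)"
    and D2_iff: "(p, q) \<in> D2 \<longleftrightarrow> (\<forall>(u, r)\<in>D1. inner u q + inner r p = 0)"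
    and D1_single: "(0, n) \<in> D1 \<Longrightarrow> n = 0"
    and D2_single: "(0, n) \<in> D2 \<Longrightarrow> n = 0"
begin

lemma pairing: "(u, r) \<in> D1 \<Longrightarrow> (p, q) \<in> D2 \<Longrightarrow> inner u q + inner r p = 0"
  using D1_iff[of u r] by blast

lemma subspace_D1: "subspace D1"
  unfolding subspace_def
proof (intro conjI ballI allI)
  show "0 \<in> D1" by (auto simp: zero_prod_def D1_iff)
  show "x + y \<in> D1" if "x \<in> D1" "y \<in> D1" for x y
  proof (cases x, cases y)
    fix u r v s assume xy: "x = (u, r)" "y = (v, s)"
    have "inner (u + v) q + inner (r + s) p = 0" if pq: "(p, q) \<in> D2" for p q
      using pairing[of u r, OF _ pq] pairing[of v s, OF _ pq] \<open>x \<in> D1\<close> \<open>y \<in> D1\<close> xy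
      by (simp add: inner_add)
    then show ?thesis using xy by (auto simp: D1_iff[of "u + v"])
  qed
  show "k *\<^sub>R x \<in> D1" if "x \<in> D1" for k x
  proof (cases x)
    fix u r assume x: "x = (u, r)"
    have "inner (k *\<^sub>R u) q + inner (k *\<^sub>R r) p = 0" if pq: "(p, q) \<in> D2" for p q
      using pairing[of u r, OF _ pq] \<open>x \<in> D1\<close> x by (simp flip: distrib_left)
    then show ?thesis using x by (auto simp: D1_iff[of "k *\<^sub>R u"])
  qed
qed

lemma closed_D1: "closed D1"
  unfolding closed_sequential_limits
proof (intro allI impI, elim conjE)
  fix X l assume X: "\<forall>n. X n \<in> D1" "X \<longlonglongrightarrow> l"
  have "inner (fst l) q + inner (snd l) p = 0" if pq: "(p, q) \<in> D2" for p q
  proof -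
    have "(\<lambda>n. inner (fst (X n)) q + inner (snd (X n)) p) \<longlonglongrightarrow> inner (fst l) q + inner (snd l) p"
      by (intro tendsto_intros X)
    moreover have "inner (fst (X n)) q + inner (snd (X n)) p = 0" for n
      using X(1) pairing[OF _ pq, of "fst (X n)" "snd (X n)"] by simp
    ultimately show ?thesis by (simp add: LIMSEQ_const_iff)
  qed
  then show "l \<in> D1" by (cases l) (auto simp: D1_iff)
qed

text \<open>A vector n orthogonal to the domain of D1 satisfies (0, n) \<in> D2, so density of one
  domain is the single-valuedness of the other relation.\<close>

lemma dense_D1: "closure (Domain D1) = UNIV"
proof (rule dense_if_orthogonal_trivial)
  have "Domain D1 = fst ` D1" by (auto simp: Domain_fst)
  then show "subspace (Domain D1)"
    using linear_subspace_image[OF linear_fst subspace_D1] by simp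
  show "n = 0" if "\<And>x. x \<in> Domain D1 \<Longrightarrow> inner n x = 0" for n
    using that by (intro D2_single) (auto simp: D2_iff inner_commute)
qed

end

text \<open>The hypotheses are symmetric in the two relations, so each fact about D1 is available
  for D2 under the prefix \<open>swap\<close>.\<close>

sublocale skew_adjoint_pair \<subseteq> swap: skew_adjoint_pair D2 D1
proof
  show "((u, r) \<in> D2) = (\<forall>(p, q)\<in>D1. inner u q + inner r p = 0)" for u r
    unfolding D2_iff by (auto simp: inner_commute add.commute)
  show "((p, q) \<in> D1) = (\<forall>(u, r)\<in>D2. inner u q + inner r p = 0)" for p q
    unfolding D1_iff by (auto simp: inner_commute add.commute)
qed (auto intro: D1_single D2_single)

text \<open>\<open>b\<close> and \<open>c\<close> are the weights of the energy, and
  \<open>a\<close> is the damping. \<open>bi\<close> and \<open>ci\<close> solve the equations for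
  the time derivatives; injectivity of \<open>b\<close> and \<open>c\<close> is contained in the
  coercivity.\<close>

locale damped_system = skew_adjoint_pair D1 D2
  for D1 D2 :: "('k::{real_inner, banach, second_countable_topology} \<times> 'k) set" +
  fixes a b c bi ci :: "'k \<Rightarrow> 'k" and C0 C1 :: real
  assumes bounded_linear: "bounded_linear a" "bounded_linear b" "bounded_linear c"
      "bounded_linear bi" "bounded_linear ci"
    and symmetric: "inner (a x) y = inner x (a y)" "inner (b x) y = inner x (b y)"
      "inner (c x) y = inner x (c y)"
    and a_nonneg: "0 \<le> inner (a x) x"
    and coercive: "C0 * inner x x \<le> inner (b x) x" "C0 * inner x x \<le> inner (c x) x"
    and upper: "inner (b x) x \<le> C1 * inner x x" "inner (c x) x \<le> C1 * inner x x"
    and inverse: "b (bi x) = x" "c (ci x) = x"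
    and C: "0 < C0" "0 < C1"
begin

lemmas lin = bounded_linear[THEN bounded_linear.linear]

text \<open>The generator without division by the coefficients: writing ' for the derivative in D1
  and D2, the conditions are b z + u' = 0 and c y + p' + a u = 0.\<close>

definition gen :: "(('k \<times> 'k) \<times> ('k \<times> 'k)) set" where
  "gen = {((u, p), (y, z)). (u, - b z) \<in> D1 \<and> (p, - c y - a u) \<in> D2}"

definition energy :: "'k \<times> 'k \<Rightarrow> 'k \<times> 'k \<Rightarrow> real" where
  "energy w z = inner (c (fst w)) (fst z) + inner (b (snd w)) (snd z)"

lemma energy_diff: "energy (w - w') z = energy w z - energy w' z"
  "energy z (w - w') = energy z w - energy z w'"
  and energy_scaleR: "energy (k *\<^sub>R w) z = k * energy w z" "energy z (k *\<^sub>R w) = k * energy z w"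
  and energy_commute: "energy w z = energy z w"
  using lin symmetric
  by (auto simp: energy_def linear_add linear_diff linear_scale inner_add inner_diff algebra_simps
      inner_commute)

lemma energy_lower: "C0 * (norm w)\<^sup>2 \<le> energy w w"
  using coercive(2)[of "fst w"] coercive(1)[of "snd w"]
  by (simp add: energy_def power2_norm_eq_inner inner_prod_def algebra_simps)

lemma energy_upper: "energy w w \<le> C1 * (norm w)\<^sup>2"
  using upper(2)[of "fst w"] upper(1)[of "snd w"]
  by (simp add: energy_def power2_norm_eq_inner inner_prod_def algebra_simps)

lemma energy_nonneg: "0 \<le> energy w w"
  using energy_lower[of w] C by (meson less_imp_le mult_nonneg_nonneg order_trans zero_le_power2)

lemma energy_zero: "energy w w \<le> 0 \<Longrightarrow> w = 0"
  using energy_lower[of w] C(1) by (smt (verit) mult_pos_pos norm_eq_zero zero_less_power2)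

text \<open>The two derivative terms cancel by \<open>pairing\<close>, and what remains of the
  energy product is minus the damping \<open>inner (a u) u\<close>.\<close>

lemma dissipative: "(w, z) \<in> gen \<Longrightarrow> energy z w \<le> 0"
proof (cases w, cases z)
  fix u p y q assume wz: "(w, z) \<in> gen" "w = (u, p)" "z = (y, q)"
  then have "inner u (- c y - a u) + inner (- b q) p = 0"
    by (intro pairing) (auto simp: gen_def)
  then show ?thesis
    using a_nonneg[of u] wz by (simp add: energy_def inner_diff inner_commute)
qed

lemma subspace_gen: "subspace gen"
proof -
  have 1: "linear (\<lambda>x :: ('k \<times> 'k) \<times> ('k \<times> 'k). (fst (fst x), - b (snd (snd x))))"
    using lin by (intro linearI) (auto simp: linear_add linear_scale)
  have 2: "linear (\<lambda>x :: ('k \<times> 'k) \<times> ('k \<times> 'k). (snd (fst x), - c (fst (snd x)) - a (fst (fst x))))"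
    using lin by (intro linearI) (auto simp: linear_add linear_scale algebra_simps)
  have "gen = (\<lambda>x. (fst (fst x), - b (snd (snd x)))) -` D1
      \<inter> (\<lambda>x. (snd (fst x), - c (fst (snd x)) - a (fst (fst x)))) -` D2"
    by (auto simp: gen_def)
  then show ?thesis
    using linear_subspace_vimage[OF 1 subspace_D1] linear_subspace_vimage[OF 2 swap.subspace_D1]
    by (simp add: subspace_inter)
qed

text \<open>The equation is multiplied by the weights and read on quadruples ((u, r), (p, q)) of
  functions and their derivatives. There L is a bounded operator on the whole space, restricted to
  the closed subspace D1 \<times> D2, so a lower bound for L is enough for a closed range.\<close>

lemma range_condition:
  assumes h: "0 < h"
  shows "\<exists>w. (w, (1 / h) *\<^sub>R (w - y)) \<in> gen"
proof -
  define L :: "('k \<times> 'k) \<times> ('k \<times> 'k) \<Rightarrow> 'k \<times> 'k" where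
    "L x = (case x of ((u, r), (p, q)) \<Rightarrow> (c u + h *\<^sub>R (q + a u), b p + h *\<^sub>R r))" for x
  have L_blin: "bounded_linear L"
    unfolding L_def case_prod_beta'
    by (intro bounded_linear_Pair bounded_linear_add
        bounded_linear_compose[OF bounded_linear_scaleR_right]
        bounded_linear_compose[OF bounded_linear(1)] bounded_linear_compose[OF bounded_linear(2)]
        bounded_linear_compose[OF bounded_linear(3)]
        bounded_linear_compose[OF bounded_linear_fst] bounded_linear_compose[OF bounded_linear_snd]
        bounded_linear_fst bounded_linear_snd)
  have sub: "subspace (D1 \<times> D2)"
    by (intro subspace_Times subspace_D1 swap.subspace_D1)
  obtain Ka where Ka: "0 \<le> Ka" "\<And>x. norm (a x) \<le> norm x * Ka" using bounded_linear.nonneg_bounded[OF bounded_linear(1)] by blast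
  obtain Kb where Kb: "0 \<le> Kb" "\<And>x. norm (b x) \<le> norm x * Kb" using bounded_linear.nonneg_bounded[OF bounded_linear(2)] by blast
  obtain Kc where Kc: "0 \<le> Kc" "\<And>x. norm (c x) \<le> norm x * Kc" using bounded_linear.nonneg_bounded[OF bounded_linear(3)] by blast
  \<comment> \<open>The estimate must cover the derivatives too: coercivity gives u and p with the
    factor 1 / C0, and the two equations, divided by h, then give q and r with the bounds
    \<open>Ka\<close>, \<open>Kb\<close> and \<open>Kc\<close>.\<close>
  define K where "K = (2 * h + Kb + Kc + h * Ka) / (h * C0) + 2 / h"
  have below: "norm x \<le> K * norm (L x)" if xD: "x \<in> D1 \<times> D2" for x
  proof -
    obtain u r p q where x: "x = ((u, r), (p, q))" by (metis surj_pair)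
    define f g where "f = c u + h *\<^sub>R (q + a u)" and "g = b p + h *\<^sub>R r"
    have Lx: "L x = (f, g)" by (simp add: L_def x f_def g_def)
    \<comment> \<open>This identity removes q and r from the product of L x with (u, p), so the
      energy estimate for u and p involves no derivatives.\<close>
    have up: "inner u q + inner r p = 0" using xD x by (intro pairing) auto
    have "C0 * (norm (u, p))\<^sup>2 \<le> energy (u, p) (u, p)" by (rule energy_lower)
    also have "\<dots> \<le> energy (u, p) (u, p) + h * inner (a u) u + h * (inner u q + inner r p)"
      using up a_nonneg[of u] h by simp
    also have "\<dots> = inner (f, g) (u, p)"
      by (simp add: energy_def f_def g_def inner_add inner_commute algebra_simps)
    also have "\<dots> \<le> norm (f, g) * norm (u, p)" by (rule norm_cauchy_schwarz)
    finally have "C0 * norm (u, p) * norm (u, p) \<le> norm (f, g) * norm (u, p)"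
      by (simp add: power2_eq_square mult.assoc)
    then have nup: "C0 * norm (u, p) \<le> norm (L x)"
      unfolding Lx by (cases "norm (u, p) = 0") (auto simp: mult_le_cancel_right)
    have nu: "norm u \<le> norm (L x) / C0" "norm p \<le> norm (L x) / C0"
      using order_trans[OF mult_left_mono[OF norm_fst_le[of u p]] nup] C(1)
        order_trans[OF mult_left_mono[OF norm_snd_le[of p u]] nup]
      by (simp_all add: pos_le_divide_eq mult.commute)
    have nf: "norm f \<le> norm (L x)" "norm g \<le> norm (L x)"
      unfolding Lx by (simp_all add: norm_fst_le norm_snd_le)
    have "h *\<^sub>R q = f - c u - h *\<^sub>R a u" by (simp add: f_def algebra_simps)
    then have "h * norm q = norm (f - c u - h *\<^sub>R a u)" using h by (metis abs_of_pos norm_scaleR)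
    also have "\<dots> \<le> norm (L x) + norm (L x) / C0 * Kc + h * (norm (L x) / C0 * Ka)"
    proof (intro order_trans[OF norm_triangle_ineq4] add_mono nf)
      show "norm (c u) \<le> norm (L x) / C0 * Kc"
        by (rule order_trans[OF Kc(2) mult_right_mono[OF nu(1) Kc(1)]])
      have "norm (a u) \<le> norm (L x) / C0 * Ka"
        by (rule order_trans[OF Ka(2) mult_right_mono[OF nu(1) Ka(1)]])
      then show "norm (h *\<^sub>R a u) \<le> h * (norm (L x) / C0 * Ka)"
        unfolding norm_scaleR using h by (simp only: abs_of_pos) (intro mult_left_mono, auto)
    qed
    finally have nq: "norm q \<le> (norm (L x) + norm (L x) / C0 * Kc + h * (norm (L x) / C0 * Ka)) / h"
      using h by (simp add: pos_le_divide_eq mult.commute)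
    have "h *\<^sub>R r = g - b p" by (simp add: g_def)
    then have "h * norm r = norm (g - b p)" using h by (metis abs_of_pos norm_scaleR)
    also have "\<dots> \<le> norm (L x) + norm (L x) / C0 * Kb"
      using h nf(2) order_trans[OF Kb(2) mult_right_mono[OF nu(2) Kb(1)]]
      by (intro order_trans[OF norm_triangle_ineq4] add_mono) auto
    finally have nr: "norm r \<le> (norm (L x) + norm (L x) / C0 * Kb) / h"
      using h by (simp add: pos_le_divide_eq mult.commute)
    have "norm x \<le> (norm u + norm r) + (norm p + norm q)"
      unfolding x by (intro order_trans[OF norm_Pair_le] add_mono norm_Pair_le)
    also have "\<dots> \<le> (norm (L x) / C0 + (norm (L x) + norm (L x) / C0 * Kb) / h) +
        (norm (L x) / C0 + (norm (L x) + norm (L x) / C0 * Kc + h * (norm (L x) / C0 * Ka)) / h)"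
      by (intro add_mono nu nq nr)
    also have "\<dots> = K * norm (L x)"
      using h C by (simp add: K_def field_simps)
    finally show ?thesis .
  qed
  have K: "0 < K"
    using h C Ka Kb Kc unfolding K_def by (intro add_nonneg_pos divide_nonneg_pos) auto
  have "complete (L ` (D1 \<times> D2))"
  proof (rule complete_isometric_image[OF _ sub L_blin])
    show "0 < 1 / K" using K by simp
    show "\<forall>x\<in>D1 \<times> D2. 1 / K * norm x \<le> norm (L x)"
      using below K by (simp add: field_simps)
    show "complete (D1 \<times> D2)"
      by (intro closed_Times closed_D1 swap.closed_D1 complete_eq_closed[THEN iffD2])
  qed
  then have clo: "closed (L ` (D1 \<times> D2))" by (rule complete_imp_closed)
  have "L ` (D1 \<times> D2) = UNIV"
  proof (rule ccontr)
    assume "L ` (D1 \<times> D2) \<noteq> UNIV"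
    then obtain n where n: "n \<noteq> 0" "\<And>x. x \<in> L ` (D1 \<times> D2) \<Longrightarrow> inner n x = 0"
      using closed_subspace_orthogonal[OF linear_subspace_image[OF bounded_linear.linear[OF L_blin] sub] clo]
      by metis
    obtain \<phi> \<psi> where n': "n = (\<phi>, \<psi>)" by force
    \<comment> \<open>Varying (u, r) and (p, q) separately shows that two pairs built from \<phi>
      and \<psi> annihilate D1 and D2. Since the relations are negative adjoints of each other,
      these pairs belong to D2 and D1, and pairing them with each other leaves only the energy of n
      and the damping.\<close>
    have 1: "inner u (c \<phi> + h *\<^sub>R a \<phi>) + inner r (h *\<^sub>R \<psi>) = 0" if "(u, r) \<in> D1" for u r
    proof -
      have "((u, r), (0, 0)) \<in> D1 \<times> D2" using that subspace_0[OF swap.subspace_D1] by (simp add: zero_prod_def)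
      then have "inner n (L ((u, r), (0, 0))) = 0" by (intro n) blast
      then show ?thesis
        using lin symmetric[of u \<phi>]
        by (simp add: L_def n' linear_0 inner_add algebra_simps inner_commute)
    qed
    have 2: "inner p (b \<psi>) + inner q (h *\<^sub>R \<phi>) = 0" if "(p, q) \<in> D2" for p q
    proof -
      have "((0, 0), (p, q)) \<in> D1 \<times> D2" using that subspace_0[OF subspace_D1] by (simp add: zero_prod_def)
      then have "inner n (L ((0, 0), (p, q))) = 0" by (intro n) blast
      then show ?thesis
        using lin symmetric[of p \<psi>]
        by (simp add: L_def n' linear_0 inner_add algebra_simps inner_commute)
    qed
    have "(h *\<^sub>R \<psi>, c \<phi> + h *\<^sub>R a \<phi>) \<in> D2" unfolding D2_iff using 1 by blast
    moreover have "(h *\<^sub>R \<phi>, b \<psi>) \<in> D1" unfolding D1_iff using 2 by (auto simp: inner_commute add.commute)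
    ultimately have "inner (h *\<^sub>R \<phi>) (c \<phi> + h *\<^sub>R a \<phi>) + inner (b \<psi>) (h *\<^sub>R \<psi>) = 0"
      by (intro pairing)
    then have "h * (energy n n + h * inner (a \<phi>) \<phi>) = 0"
      by (simp add: energy_def n' inner_add algebra_simps inner_commute)
    moreover have "0 \<le> h * inner (a \<phi>) \<phi>" using h a_nonneg[of \<phi>] by simp
    ultimately have "energy n n \<le> 0" using h by (simp add: add_eq_0_iff)
    then show False using energy_zero n(1) by blast
  qed
  then have "(c (fst y), b (snd y)) \<in> L ` (D1 \<times> D2)" by (simp only: UNIV_I)
  then obtain x where x: "x \<in> D1 \<times> D2" "L x = (c (fst y), b (snd y))" by (metis imageE)
  obtain u r p q where x': "x = ((u, r), (p, q))" by (metis surj_pair)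
  have eqs: "c u + h *\<^sub>R (q + a u) = c (fst y)" "b p + h *\<^sub>R r = b (snd y)"
    using x(2) by (auto simp: L_def x')
  have "r = - b ((1 / h) *\<^sub>R (p - snd y))"
  proof -
    have "h *\<^sub>R r = b (snd y) - b p" using eqs(2) by (simp add: algebra_simps)
    then have "(1 / h) *\<^sub>R h *\<^sub>R r = (1 / h) *\<^sub>R (b (snd y) - b p)" by simp
    then show ?thesis using h lin by (simp add: linear_diff linear_scale algebra_simps)
  qed
  moreover have "q = - c ((1 / h) *\<^sub>R (u - fst y)) - a u"
  proof -
    have "h *\<^sub>R (q + a u) = c (fst y) - c u" using eqs(1) by (simp add: algebra_simps)
    then have "(1 / h) *\<^sub>R h *\<^sub>R (q + a u) = (1 / h) *\<^sub>R (c (fst y) - c u)" by simp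
    then show ?thesis using h lin by (simp add: linear_diff linear_scale algebra_simps eq_diff_eq)
  qed
  ultimately have "((u, p), (1 / h) *\<^sub>R ((u, p) - y)) \<in> gen"
    using x(1) x' by (cases y) (auto simp: gen_def)
  then show ?thesis by blast
qed

section \<open>From the range condition to the resolvent family\<close>

lemma resolvent_unique:
  assumes "0 < h" "(w, (1 / h) *\<^sub>R (w - y)) \<in> gen" "(w', (1 / h) *\<^sub>R (w' - y)) \<in> gen"
  shows "w = w'"
proof -
  have "(w, (1 / h) *\<^sub>R (w - y)) - (w', (1 / h) *\<^sub>R (w' - y)) \<in> gen"
    using subspace_gen assms(2,3) by (rule subspace_diff)
  then have "(w - w', (1 / h) *\<^sub>R (w - w')) \<in> gen"
    by (simp add: algebra_simps)
  from dissipative[OF this] have "energy (w - w') (w - w') \<le> 0"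
    using assms(1) by (simp add: energy_scaleR divide_le_0_iff)
  then show ?thesis using energy_zero[of "w - w'"] by simp
qed

definition J :: "real \<Rightarrow> 'k \<times> 'k \<Rightarrow> 'k \<times> 'k" where
  "J h y = (if h = 0 then y else THE w. (w, (1 / h) *\<^sub>R (w - y)) \<in> gen)"

lemma J_graph: "0 < h \<Longrightarrow> (J h y, (1 / h) *\<^sub>R (J h y - y)) \<in> gen"
proof -
  assume h: "0 < h"
  have "\<exists>!w. (w, (1 / h) *\<^sub>R (w - y)) \<in> gen"
    using range_condition[OF h] resolvent_unique[OF h] by blast
  from theI'[OF this] show ?thesis using h by (simp add: J_def)
qed

lemma J_eqI: "0 < h \<Longrightarrow> (w, (1 / h) *\<^sub>R (w - y)) \<in> gen \<Longrightarrow> J h y = w"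
  using J_graph resolvent_unique by blast

text \<open>Dissipativity bounds the energy of J h y by its mixed product with y, and the
  nonnegative energy of y - J h y bounds the mixed product by the mean of the two energies.\<close>

lemma J_energy:
  assumes "0 \<le> h"
  shows "energy (J h y) (J h y) \<le> energy y y"
proof (cases "h = 0")
  case False
  then have h: "0 < h" using assms by simp
  from dissipative[OF J_graph[OF h, of y]] h have "energy (J h y) (J h y) \<le> energy y (J h y)"
    by (simp add: energy_scaleR energy_diff divide_le_0_iff)
  moreover have "0 \<le> energy (y - J h y) (y - J h y)" by (rule energy_nonneg)
  then have "2 * energy y (J h y) \<le> energy y y + energy (J h y) (J h y)"
    using energy_commute[of "J h y" y] by (simp add: energy_diff)
  ultimately show ?thesis by simp
qed (simp add: J_def)

sublocale separable_resolvent_family gen J "sqrt (C1 / C0)"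
proof (intro separable_resolvent_family.intro resolvent_family.intro)
  show "J 0 x = x" for x by (simp add: J_def)
  show "linear (J h)" if "0 \<le> h" for h
  proof (cases "h = 0")
    case False
    then have h: "0 < h" using that by simp
    show ?thesis
    proof (rule linearI)
      show "J h (x + y) = J h x + J h y" for x y
        using subspace_add[OF subspace_gen J_graph[OF h, of x] J_graph[OF h, of y]]
        by (intro J_eqI[OF h]) (simp add: algebra_simps)
      show "J h (k *\<^sub>R x) = k *\<^sub>R J h x" for k x
        using subspace_scale[OF subspace_gen J_graph[OF h, of x], of k]
        by (intro J_eqI[OF h]) (simp add: algebra_simps)
    qed
  next
    case True
    then have "J h = (\<lambda>x. x)" by (simp add: J_def fun_eq_iff)
    then show ?thesis using linear_ident by simp
  qed
  show "(J h y, (1 / h) *\<^sub>R (J h y - y)) \<in> gen" if "0 < h" for h y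
    using J_graph[OF that] .
  show "J h (x - h *\<^sub>R z) = x" if "0 < h" "(x, z) \<in> gen" for h x z
    using that by (intro J_eqI) auto
  show "norm ((J h ^^ n) y) \<le> sqrt (C1 / C0) * norm y" if "0 \<le> h" for h n y
  proof -
    \<comment> \<open>All n steps are taken in the energy before it is compared with the norm, so
      the factor C1 / C0 occurs once for every n.\<close>
    have "energy ((J h ^^ n) y) ((J h ^^ n) y) \<le> energy y y"
      by (induction n) (auto intro: order_trans[OF J_energy[OF that]])
    then have "C0 * (norm ((J h ^^ n) y))\<^sup>2 \<le> C1 * (norm y)\<^sup>2"
      using energy_lower[of "(J h ^^ n) y"] energy_upper[of y] by linarith
    then have "(norm ((J h ^^ n) y))\<^sup>2 \<le> C1 / C0 * (norm y)\<^sup>2"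
      using C by (simp add: field_simps)
    from real_sqrt_le_mono[OF this] show ?thesis
      by (simp only: real_sqrt_mult real_sqrt_abs abs_norm_cancel)
  qed
  show "0 \<le> sqrt (C1 / C0)" using C by simp
  \<comment> \<open>The two equations can be solved for the time derivatives by \<open>ci\<close>
    and \<open>bi\<close>, so (u, p) lies in the domain whenever both components have a
    derivative.\<close>
  have "Domain D1 \<times> Domain D2 \<subseteq> Domain gen"
  proof safe
    fix u r p q assume "(u, r) \<in> D1" "(p, q) \<in> D2"
    then have "((u, p), (ci (- q - a u), bi (- r))) \<in> gen"
      by (simp add: gen_def inverse)
    then show "(u, p) \<in> Domain gen" by blast
  qed
  from closure_mono[OF this] show "closure (Domain gen) = UNIV"
    by (simp add: closure_Times dense_D1 swap.dense_D1 top.extremum_unique)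
qed

lemma energy_has_derivative:
  assumes "(w has_vector_derivative w') (at t within X)"
  shows "((\<lambda>t. energy (w t) (w t)) has_field_derivative 2 * energy w' (w t)) (at t within X)"
proof -
  have d: "((\<lambda>t. fst (w t)) has_vector_derivative fst w') (at t within X)"
    "((\<lambda>t. snd (w t)) has_vector_derivative snd w') (at t within X)"
    using assms by (auto intro: bounded_linear.has_vector_derivative[OF bounded_linear_fst]
        bounded_linear.has_vector_derivative[OF bounded_linear_snd])
  have "((\<lambda>t. energy (w t) (w t)) has_vector_derivative
     (inner (c (fst (w t))) (fst w') + inner (c (fst w')) (fst (w t))) +
     (inner (b (snd (w t))) (snd w') + inner (b (snd w')) (snd (w t)))) (at t within X)"
    unfolding energy_def
    by (intro has_vector_derivative_add bounded_bilinear.has_vector_derivative[OF bounded_bilinear_inner]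
        bounded_linear.has_vector_derivative[OF bounded_linear(2)]
        bounded_linear.has_vector_derivative[OF bounded_linear(3)] d)
  moreover have "(inner (c (fst (w t))) (fst w') + inner (c (fst w')) (fst (w t))) +
     (inner (b (snd (w t))) (snd w') + inner (b (snd w')) (snd (w t))) = 2 * energy w' (w t)"
    using symmetric(2)[of "snd (w t)" "snd w'"] symmetric(3)[of "fst (w t)" "fst w'"]
    by (simp add: energy_def inner_commute)
  ultimately show ?thesis
    by (simp add: has_real_derivative_iff_has_vector_derivative)
qed

text \<open>The equation is only known for almost every t, but the derivative of the energy is
  continuous, so its sign is known at every interior t and the energy decreases from 0.\<close>

theorem energy_uniqueness:
  assumes deriv: "\<And>t. t \<in> {0..T} \<Longrightarrow> (w has_vector_derivative w' t) (at t within {0..T})"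
    and cont: "continuous_on {0..T} w'"
    and gen: "AE t in lborel. t \<in> {0<..<T} \<longrightarrow> (w t, w' t) \<in> gen"
    and "w 0 = 0" and t: "t \<in> {0..T}"
  shows "w t = 0"
proof -
  define e where "e t = 2 * energy (w' t) (w t)" for t
  have wcont: "continuous_on {0..T} w"
    using has_vector_derivative_continuous[OF deriv] by (simp add: continuous_on_eq_continuous_within)
  have e_cont: "continuous_on {0..T} e"
    unfolding e_def energy_def using cont wcont
    by (intro continuous_intros bounded_linear.continuous_on[OF bounded_linear(2)] bounded_linear.continuous_on[OF bounded_linear(3)])
  have e_nonpos: "e s \<le> 0" if s: "s \<in> {0<..<T}" for s
  proof -
    have "e s \<in> {..0}"
    proof (rule continuous_AE_in_closed[OF _ _ _ _ s])
      show "continuous_on {0<..<T} e" by (rule continuous_on_subset[OF e_cont]) auto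
      show "AE r in lborel. r \<in> {0<..<T} \<longrightarrow> e r \<in> {..0}"
        using gen by eventually_elim (use dissipative in \<open>auto simp: e_def\<close>)
    qed auto
    then show ?thesis by simp
  qed
  have "energy (w t) (w t) \<le> energy (w 0) (w 0)"
  proof (rule DERIV_nonpos_imp_decreasing_open[where f="\<lambda>t. energy (w t) (w t)" and a=0 and b=t])
    show "0 \<le> t" using t by simp
    show "\<exists>y. ((\<lambda>t. energy (w t) (w t)) has_field_derivative y) (at s) \<and> y \<le> 0" if "0 < s" "s < t" for s
    proof -
      have s: "s \<in> {0<..<T}" using that t by auto
      then have "(w has_vector_derivative w' s) (at s within {0..T})" by (intro deriv) auto
      then have "((\<lambda>t. energy (w t) (w t)) has_field_derivative e s) (at s within {0..T})"
        unfolding e_def by (rule energy_has_derivative)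
      then have "((\<lambda>t. energy (w t) (w t)) has_field_derivative e s) (at s)"
        using s by (simp add: at_within_Icc_at)
      then show ?thesis using e_nonpos[OF s] by blast
    qed
    have "continuous_on {0..T} (\<lambda>t. energy (w t) (w t))"
      by (rule DERIV_continuous_on[OF energy_has_derivative[OF deriv]])
    then show "continuous_on {0..t} (\<lambda>t. energy (w t) (w t))"
      by (rule continuous_on_subset) (use t in auto)
  qed
  also have "energy (w 0) (w 0) = 0"
    using assms(4) lin by (simp add: energy_def linear_0)
  finally show ?thesis by (rule energy_zero)
qed

section \<open>Existence for the damped system with sources\<close>

lemma integral_Pair:
  fixes f :: "'s \<Rightarrow> 'x::{banach, second_countable_topology}" and g :: "'s \<Rightarrow> 'y::{banach, second_countable_topology}"
  assumes "integrable N f" "integrable N g"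
  shows "integrable N (\<lambda>x. (f x, g x))" "(LINT x|N. (f x, g x)) = (LINT x|N. f x, LINT x|N. g x)"
proof -
  have bl: "bounded_linear (\<lambda>x. (x, 0) :: 'x \<times> 'y)" "bounded_linear (\<lambda>y. (0, y) :: 'x \<times> 'y)"
    by (intro bounded_linear_Pair bounded_linear_ident bounded_linear_zero)+
  have "integrable N (\<lambda>x. (f x, 0) + (0, g x))"
    by (rule Bochner_Integration.integrable_add[OF integrable_bounded_linear[OF bl(1) assms(1)]
          integrable_bounded_linear[OF bl(2) assms(2)]])
  then show int: "integrable N (\<lambda>x. (f x, g x))" by simp
  show "(LINT x|N. (f x, g x)) = (LINT x|N. f x, LINT x|N. g x)"
    using integral_fst[OF int] integral_snd[OF int] by (simp add: prod_eq_iff)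
qed

text \<open>\<open>K\<close> is chosen before the data and the time. The bound is one for the mild
  solution started at A w0 plus the initial source; p0 enters A w0 only through its derivative q0,
  which is why the norm of p0 does not occur.\<close>

theorem inhomogeneous_solution:
  "\<exists>K\<ge>0. \<forall>u0 r0 p0 q0 f0 g0 F G. (u0, r0) \<in> D1 \<longrightarrow> (p0, q0) \<in> D2 \<longrightarrow> integrable lborel F \<longrightarrow> integrable lborel G \<longrightarrow>
    (\<exists>u u' p p'. u 0 = u0 \<and> p 0 = p0 \<and> continuous_on UNIV u' \<and> continuous_on UNIV p' \<and>
      (\<forall>t\<ge>0. (u has_vector_derivative u' t) (at t within {0..}) \<and>
        (p has_vector_derivative p' t) (at t within {0..}) \<and>
        (u t, g0 + prim G 0 t - b (p' t)) \<in> D1 \<and>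
        (p t, f0 + prim F 0 t - c (u' t) - a (u t)) \<in> D2) \<and>
      (\<forall>t. norm (u' t, p' t) \<le> K * (norm u0 + norm r0 + norm q0 + norm f0 + norm g0 +
         (LINT s|lborel. norm (F s)) + (LINT s|lborel. norm (G s)))))"
proof -
  obtain Ka where Ka: "0 \<le> Ka" "\<And>x. norm (a x) \<le> norm x * Ka" using bounded_linear.nonneg_bounded[OF bounded_linear(1)] by blast
  obtain Kb where Kb: "0 \<le> Kb" "\<And>x. norm (bi x) \<le> norm x * Kb" using bounded_linear.nonneg_bounded[OF bounded_linear(4)] by blast
  obtain Kc where Kc: "0 \<le> Kc" "\<And>x. norm (ci x) \<le> norm x * Kc" using bounded_linear.nonneg_bounded[OF bounded_linear(5)] by blast
  \<comment> \<open>One constant that dominates the norms of \<open>bi\<close>, of \<open>ci\<close>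
    and of \<open>ci\<close> composed with \<open>a\<close>.\<close>
  define B where "B = (Kb + Kc) * (1 + Ka)"
  define K where "K = sqrt (C1 / C0) * B"
  have B: "0 \<le> B" "Kb \<le> B" "Kc \<le> B" "Kc * Ka \<le> B"
    using Ka Kb Kc by (auto simp: B_def algebra_simps)
  have K: "0 \<le> K" using B C by (simp add: K_def)
  show ?thesis
  proof (intro exI[of _ K] conjI K allI impI)
    fix u0 r0 p0 q0 f0 g0 :: 'k and F G :: "real \<Rightarrow> 'k"
    assume D: "(u0, r0) \<in> D1" "(p0, q0) \<in> D2" and F: "integrable lborel F" and G: "integrable lborel G"
    define w1 where "w1 = (ci (- q0 - a u0), bi (- r0))"
    define \<Phi>0 where "\<Phi>0 = (ci f0, bi g0)"
    define \<Phi> where "\<Phi> s = (ci (F s), bi (G s))" for s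
    have \<Phi>: "integrable lborel \<Phi>"
      unfolding \<Phi>_def
      by (rule integral_Pair(1)[OF integrable_bounded_linear[OF bounded_linear(5) F]
            integrable_bounded_linear[OF bounded_linear(4) G]])
    define z where "z = mild (w1 + \<Phi>0) \<Phi>"
    define w where "w t = (u0, p0) + prim z 0 t" for t
    have z_cont: "continuous_on UNIV z" unfolding z_def by (rule mild_continuous[OF \<Phi>])
    have wd: "(w has_vector_derivative z t) (at t within {0..})" if "0 \<le> t" for t
      unfolding w_def using has_vector_derivative_add[OF has_vector_derivative_const prim_has_vector_derivative[OF z_cont that]] by simp
    have "((u0, p0), w1) \<in> gen" using D by (simp add: gen_def w1_def inverse)
    then have wg: "(w t, z t - (\<Phi>0 + prim \<Phi> 0 t)) \<in> gen" if "0 \<le> t" for t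
      unfolding w_def z_def by (rule mild_primitive_in_graph[OF \<Phi> that])
    have prim_\<Phi>: "prim \<Phi> 0 t = (ci (prim F 0 t), bi (prim G 0 t))" for t
    proof -
      have i: "integrable lborel (\<lambda>s. indicator {0<..<t} s *\<^sub>R F s)" "integrable lborel (\<lambda>s. indicator {0<..<t} s *\<^sub>R G s)"
        using F G by (auto intro!: integrable_mult_indicator)
      have "prim \<Phi> 0 t = (LINT s|lborel. (ci (indicator {0<..<t} s *\<^sub>R F s), bi (indicator {0<..<t} s *\<^sub>R G s)))"
        unfolding prim_def set_lebesgue_integral_def \<Phi>_def using lin by (simp add: linear_scale)
      also have "\<dots> = (LINT s|lborel. ci (indicator {0<..<t} s *\<^sub>R F s), LINT s|lborel. bi (indicator {0<..<t} s *\<^sub>R G s))"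
        by (rule integral_Pair(2)[OF integrable_bounded_linear[OF bounded_linear(5) i(1)]
              integrable_bounded_linear[OF bounded_linear(4) i(2)]])
      also have "\<dots> = (ci (prim F 0 t), bi (prim G 0 t))"
        unfolding prim_def set_lebesgue_integral_def
        by (simp only: integral_bounded_linear[OF bounded_linear(5) i(1)]
              integral_bounded_linear[OF bounded_linear(4) i(2)])
      finally show ?thesis .
    qed
    have bound: "norm (z t) \<le> K * (norm u0 + norm r0 + norm q0 + norm f0 + norm g0 +
         (LINT s|lborel. norm (F s)) + (LINT s|lborel. norm (G s)))" (is "_ \<le> K * ?N") for t
    proof -
      have nc: "norm (ci x) \<le> B * norm x" "norm (bi x) \<le> B * norm x" for x
        using Kc(2)[of x] Kb(2)[of x] B mult_left_mono[of Kc B "norm x"] mult_left_mono[of Kb B "norm x"]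
        by (auto simp: mult.commute)
      have "norm (ci (a u0)) \<le> norm (a u0) * Kc" by (rule Kc(2))
      also have "\<dots> \<le> norm u0 * Ka * Kc" using Ka Kc by (intro mult_right_mono)
      also have "\<dots> \<le> B * norm u0" using mult_right_mono[OF B(4), of "norm u0"] by (simp add: mult_ac)
      finally have nca: "norm (ci (a u0)) \<le> B * norm u0" .
      have "norm w1 \<le> norm (ci (- q0 - a u0)) + norm (bi (- r0))"
        unfolding w1_def by (rule norm_Pair_le)
      also have "norm (ci (- q0 - a u0)) \<le> norm (ci (- q0)) + norm (ci (a u0))"
        using lin by (simp add: linear_diff norm_triangle_ineq4)
      finally have 1: "norm w1 \<le> B * norm q0 + B * norm u0 + B * norm r0"
        using nc(1)[of "- q0"] nc(2)[of "- r0"] nca by simp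
      have 2: "norm \<Phi>0 \<le> B * norm f0 + B * norm g0"
        unfolding \<Phi>0_def using norm_Pair_le[of "ci f0" "bi g0"] nc(1)[of f0] nc(2)[of g0] by simp
      have "(LINT s|lborel. norm (\<Phi> s)) \<le> (LINT s|lborel. B * norm (F s) + B * norm (G s))"
      proof (rule integral_mono)
        show "norm (\<Phi> s) \<le> B * norm (F s) + B * norm (G s)" for s
          unfolding \<Phi>_def using norm_Pair_le[of "ci (F s)" "bi (G s)"] nc(1)[of "F s"] nc(2)[of "G s"] by simp
      qed (use \<Phi> F G in auto)
      also have "\<dots> = B * (LINT s|lborel. norm (F s)) + B * (LINT s|lborel. norm (G s))"
        using F G by simp
      finally have 3: "(LINT s|lborel. norm (\<Phi> s)) \<le> B * (LINT s|lborel. norm (F s)) + B * (LINT s|lborel. norm (G s))" .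
      have "norm (z t) \<le> sqrt (C1 / C0) * (norm (w1 + \<Phi>0) + (LINT s|lborel. norm (\<Phi> s)))"
        unfolding z_def by (rule mild_bound[OF \<Phi>])
      also have "norm (w1 + \<Phi>0) + (LINT s|lborel. norm (\<Phi> s)) \<le> B * ?N"
        using 1 2 3 norm_triangle_ineq[of w1 \<Phi>0] by (simp add: algebra_simps)
      finally show ?thesis
        using C by (simp add: K_def mult.assoc mult_left_mono)
    qed
    show "\<exists>u u' p p'. u 0 = u0 \<and> p 0 = p0 \<and> continuous_on UNIV u' \<and> continuous_on UNIV p' \<and>
      (\<forall>t\<ge>0. (u has_vector_derivative u' t) (at t within {0..}) \<and>
        (p has_vector_derivative p' t) (at t within {0..}) \<and>
        (u t, g0 + prim G 0 t - b (p' t)) \<in> D1 \<and>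
        (p t, f0 + prim F 0 t - c (u' t) - a (u t)) \<in> D2) \<and>
      (\<forall>t. norm (u' t, p' t) \<le> K * ?N)"
    proof (intro exI conjI allI impI)
      show "fst (w 0) = u0" "snd (w 0) = p0" by (simp_all add: w_def)
      show "continuous_on UNIV (\<lambda>t. fst (z t))" "continuous_on UNIV (\<lambda>t. snd (z t))"
        using z_cont by (auto intro: continuous_intros)
      show "norm (fst (z t), snd (z t)) \<le> K * ?N" for t using bound by simp
      fix t :: real assume t: "0 \<le> t"
      show "((\<lambda>t. fst (w t)) has_vector_derivative fst (z t)) (at t within {0..})"
        "((\<lambda>t. snd (w t)) has_vector_derivative snd (z t)) (at t within {0..})"
        using wd[OF t] by (auto intro: bounded_linear.has_vector_derivative[OF bounded_linear_fst]
            bounded_linear.has_vector_derivative[OF bounded_linear_snd])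
      show "(fst (w t), g0 + prim G 0 t - b (snd (z t))) \<in> D1"
        "(snd (w t), f0 + prim F 0 t - c (fst (z t)) - a (fst (w t))) \<in> D2"
        using wg[OF t] lin
        by (auto simp: gen_def prim_\<Phi> \<Phi>0_def case_prod_beta' linear_diff linear_add inverse algebra_simps)
    qed
  qed
qed

end

section \<open>Traces and integration by parts on an edge\<close>

lemma square_integrable_set_integrable:
  assumes "square_integrable f"
  shows "set_integrable lborel {a<..<b} f"
proof -
  have "integrable lborel (\<lambda>x. indicator (UNIV \<inter> {a..b}) x * f x)"
    by (intro integrable_mult_L2 square_integrable_indicator assms) simp
  then have "set_integrable lborel {a..b} f" by (simp add: set_integrable_def)
  then show ?thesis by (rule set_integrable_subset) auto
qed

lemma continuous_AE_eq:
  fixes h h' :: "real \<Rightarrow> real"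
  assumes "a < b" "continuous_on {a..b} h" "continuous_on {a..b} h'"
    and AE: "AE x in lborel. x \<in> {a..b} \<longrightarrow> h x = h' x" and x: "x \<in> {a..b}"
  shows "h x = h' x"
proof -
  have c: "continuous_on {a..b} (\<lambda>x. h x - h' x)" using assms by (intro continuous_intros)
  have "h x - h' x \<in> {0}" if "x \<in> {a<..<b}" for x
  proof (rule continuous_AE_in_closed[OF _ _ _ _ that])
    show "continuous_on {a<..<b} (\<lambda>x. h x - h' x)" by (rule continuous_on_subset[OF c]) auto
    show "AE x in lborel. x \<in> {a<..<b} \<longrightarrow> h x - h' x \<in> {0}" using AE by eventually_elim auto
  qed auto
  moreover have "closure {a<..<b} = {a..b}" using assms(1) by simp
  ultimately have "h x - h' x = 0"
    using continuous_constant_on_closure[of "{a<..<b}" "\<lambda>x. h x - h' x" 0 x] x c by simp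
  then show ?thesis by simp
qed

definition continuous_rep :: "real \<Rightarrow> (real \<Rightarrow> real) \<Rightarrow> (real \<Rightarrow> real) \<Rightarrow> bool" where
  "continuous_rep L f h \<longleftrightarrow> continuous_on {0..L} h \<and> (AE x in lborel. x \<in> {0..L} \<longrightarrow> f x = h x)"

lemma continuous_rep_unique:
  assumes "0 < L" "continuous_rep L f h" "continuous_rep L f h'" "x \<in> {0..L}"
  shows "h x = h' x"
proof (rule continuous_AE_eq[OF assms(1) _ _ _ assms(4)])
  show "AE x in lborel. x \<in> {0..L} \<longrightarrow> h x = h' x"
    using assms(2,3) unfolding continuous_rep_def by (auto elim: eventually_elim2)
qed (use assms in \<open>auto simp: continuous_rep_def\<close>)

lemma weak_derivative_continuous_rep:
  assumes "0 < L" "has_weak_derivative f g 0 L"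
  obtains h where "continuous_rep L f h" "\<And>x. x \<in> {0..L} \<Longrightarrow> h x = h 0 + prim g 0 x"
proof -
  obtain C where C: "AE x in lborel. x \<in> {0<..<L} \<longrightarrow> f x = C + prim g 0 x"
    using has_weak_derivative_imp_prim[OF assms] by metis
  define G where "G = (\<lambda>x. indicator {0<..<L} x *\<^sub>R g x)"
  have G: "integrable lborel G" using assms(2) by (simp add: has_weak_derivative_def set_integrable_def G_def)
  have eq: "prim G 0 x = prim g 0 x" if "x \<le> L" for x
    unfolding G_def using that by (rule prim_indicator)
  have "continuous_rep L f (\<lambda>x. C + prim G 0 x)"
    unfolding continuous_rep_def
  proof
    show "continuous_on {0..L} (\<lambda>x. C + prim G 0 x)"
      by (intro continuous_intros prim_continuous G)
    show "AE x in lborel. x \<in> {0..L} \<longrightarrow> f x = C + prim G 0 x"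
      using C AE_lborel_singleton[of 0] AE_lborel_singleton[of L] by eventually_elim (auto simp: eq)
  qed
  moreover have "C + prim G 0 x = C + prim G 0 0 + prim g 0 x" if "x \<in> {0..L}" for x
    using that by (simp add: eq)
  ultimately show thesis by (intro that[of "\<lambda>x. C + prim G 0 x"]) auto
qed

text \<open>Both functions are a constant plus a primitive of their derivative, so after expanding
  the products the claim is \<open>prim_mult_prim\<close> with two boundary values added.\<close>

lemma integral_by_parts_weak:
  assumes L: "0 < L" and f: "has_weak_derivative f f' 0 L" "continuous_rep L f hf"
    and g: "has_weak_derivative g g' 0 L" "continuous_rep L g hg"
  shows "(LINT x:{0<..<L}|lborel. f x * g' x) + (LINT x:{0<..<L}|lborel. f' x * g x) = hf L * hg L - hf 0 * hg 0"
proof -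
  obtain h1 where h1: "continuous_rep L f h1" "\<And>x. x \<in> {0..L} \<Longrightarrow> h1 x = h1 0 + prim f' 0 x"
    using weak_derivative_continuous_rep[OF L f(1)] by metis
  obtain h2 where h2: "continuous_rep L g h2" "\<And>x. x \<in> {0..L} \<Longrightarrow> h2 x = h2 0 + prim g' 0 x"
    using weak_derivative_continuous_rep[OF L g(1)] by metis
  define F G where "F = (\<lambda>x. indicator {0<..<L} x *\<^sub>R f' x)" and "G = (\<lambda>x. indicator {0<..<L} x *\<^sub>R g' x)"
  have F: "integrable lborel F" and G: "integrable lborel G"
    using f(1) g(1) by (simp_all add: has_weak_derivative_def set_integrable_def F_def G_def)
  have hf: "AE x in lborel. x \<in> {0<..<L} \<longrightarrow> f x = h1 0 + prim F 0 x"
  proof -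
    have "AE x in lborel. x \<in> {0..L} \<longrightarrow> f x = h1 x" using h1(1) by (simp add: continuous_rep_def)
    then show ?thesis
    proof eventually_elim
      case (elim x)
      have "x \<le> L \<Longrightarrow> prim F 0 x = prim f' 0 x" unfolding F_def by (rule prim_indicator)
      then show ?case using elim h1(2)[of x] by auto
    qed
  qed
  have hg: "AE x in lborel. x \<in> {0<..<L} \<longrightarrow> g x = h2 0 + prim G 0 x"
  proof -
    have "AE x in lborel. x \<in> {0..L} \<longrightarrow> g x = h2 x" using h2(1) by (simp add: continuous_rep_def)
    then show ?thesis
    proof eventually_elim
      case (elim x)
      have "x \<le> L \<Longrightarrow> prim G 0 x = prim g' 0 x" unfolding G_def by (rule prim_indicator)
      then show ?case using elim h2(2)[of x] by auto
    qed
  qed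
  have [measurable]: "F \<in> borel_measurable borel" "G \<in> borel_measurable borel"
    using F G by (simp_all add: borel_measurable_integrable)
  have [measurable]: "prim F 0 \<in> borel_measurable borel" "prim G 0 \<in> borel_measurable borel"
    by (rule borel_measurable_continuous_onI, rule prim_continuous[OF F])
      (rule borel_measurable_continuous_onI, rule prim_continuous[OF G])
  have [measurable]: "(\<lambda>x. indicator {0<..<L} x * f x) \<in> borel_measurable borel" "(\<lambda>x. indicator {0<..<L} x * g x) \<in> borel_measurable borel"
    using f(1) g(1) by (auto simp: has_weak_derivative_def set_integrable_def dest: borel_measurable_integrable)
  have 1: "(LINT x:{0<..<L}|lborel. f x * g' x) = (LINT x:{0<..<L}|lborel. h1 0 * G x + prim F 0 x *\<^sub>R G x)"
    unfolding set_lebesgue_integral_def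
  proof (rule integral_cong_AE)
    have "(\<lambda>x. indicator {0<..<L} x *\<^sub>R (f x * g' x)) = (\<lambda>x. (indicator {0<..<L} x * f x) * G x)"
      by (auto simp: G_def indicator_def)
    then show "(\<lambda>x. indicator {0<..<L} x *\<^sub>R (f x * g' x)) \<in> borel_measurable lborel" by simp
    show "AE x in lborel. indicator {0<..<L} x *\<^sub>R (f x * g' x) = indicator {0<..<L} x *\<^sub>R (h1 0 * G x + prim F 0 x *\<^sub>R G x)"
      using hf by eventually_elim (auto simp: G_def indicator_def algebra_simps)
  qed measurable
  have 2: "(LINT x:{0<..<L}|lborel. f' x * g x) = (LINT x:{0<..<L}|lborel. h2 0 * F x + F x *\<^sub>R prim G 0 x)"
    unfolding set_lebesgue_integral_def
  proof (rule integral_cong_AE)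
    have "(\<lambda>x. indicator {0<..<L} x *\<^sub>R (f' x * g x)) = (\<lambda>x. F x * (indicator {0<..<L} x * g x))"
      by (auto simp: F_def indicator_def)
    then show "(\<lambda>x. indicator {0<..<L} x *\<^sub>R (f' x * g x)) \<in> borel_measurable lborel" by simp
    show "AE x in lborel. indicator {0<..<L} x *\<^sub>R (f' x * g x) = indicator {0<..<L} x *\<^sub>R (h2 0 * F x + F x *\<^sub>R prim G 0 x)"
      using hg by eventually_elim (auto simp: F_def indicator_def algebra_simps)
  qed measurable
  have si: "set_integrable lborel {0<..<L} h" if "integrable lborel h" for h :: "real \<Rightarrow> real"
    using integrable_mult_indicator[OF _ that, of "{0<..<L}"] by (simp add: set_integrable_def)
  note pp = prim_mult_prim[OF F G, of 0]
  have 3: "(LINT x:{0<..<L}|lborel. h1 0 * G x + prim F 0 x *\<^sub>R G x) = h1 0 * prim G 0 L + (LINT x:{0<..<L}|lborel. prim F 0 x *\<^sub>R G x)"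
    using set_integral_add(2)[OF set_integrable_mult_right[OF si[OF G]] si[OF pp(2)], of "h1 0"]
    by (simp add: prim_def)
  have 4: "(LINT x:{0<..<L}|lborel. h2 0 * F x + F x *\<^sub>R prim G 0 x) = h2 0 * prim F 0 L + (LINT x:{0<..<L}|lborel. F x *\<^sub>R prim G 0 x)"
    using set_integral_add(2)[OF set_integrable_mult_right[OF si[OF F]] si[OF pp(1)], of "h2 0"]
    by (simp add: prim_def)
  have FL: "prim F 0 L = prim f' 0 L" and GL: "prim G 0 L = prim g' 0 L"
    unfolding F_def G_def by (simp_all only: prim_indicator[OF order_refl])
  have e: "hf 0 = h1 0" "hf L = h1 0 + prim F 0 L" "hg 0 = h2 0" "hg L = h2 0 + prim G 0 L"
    using continuous_rep_unique[OF L f(2) h1(1)] continuous_rep_unique[OF L g(2) h2(1)] L h1(2)[of L] h2(2)[of L]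
    by (simp_all add: FL GL)
  show ?thesis
    unfolding 1 2 3 4 e using pp(3)[of L] by (simp add: algebra_simps)
qed

text \<open>The continuous representatives agree, so both derivatives have the same primitive and
  hence the same integral over every subinterval.\<close>

lemma weak_derivative_unique:
  fixes f g g' :: "real \<Rightarrow> real"
  assumes L: "0 < L" and g: "has_weak_derivative f g 0 L" and g': "has_weak_derivative f g' 0 L"
  shows "AE x in lborel. x \<in> {0<..<L} \<longrightarrow> g x = g' x"
proof -
  obtain h where h: "continuous_rep L f h" "\<And>x. x \<in> {0..L} \<Longrightarrow> h x = h 0 + prim g 0 x"
    using weak_derivative_continuous_rep[OF L g] by metis
  obtain h' where h': "continuous_rep L f h'" "\<And>x. x \<in> {0..L} \<Longrightarrow> h' x = h' 0 + prim g' 0 x"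
    using weak_derivative_continuous_rep[OF L g'] by metis
  have int: "set_integrable lborel {0<..<L} g" "set_integrable lborel {0<..<L} g'"
    using g g' by (auto simp: has_weak_derivative_def)
  have eq: "prim g 0 x = prim g' 0 x" if "x \<in> {0..L}" for x
    using continuous_rep_unique[OF L h(1) h'(1), of x] continuous_rep_unique[OF L h(1) h'(1), of 0] h(2)[OF that] h'(2)[OF that] L that
    by simp
  have "AE x in lborel. x \<in> {0<..<L} \<longrightarrow> g x - g' x = 0"
  proof (rule AE_zero_if_interval_integrals_zero)
    show "set_integrable lborel {0<..<L} (\<lambda>x. g x - g' x)" by (rule set_integral_diff(1)[OF int])
    fix c d assume cd: "0 < c" "d < L" "c < d"
    have i: "set_integrable lborel {0<..<d} g" "set_integrable lborel {0<..<d} g'"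
      "set_integrable lborel {c<..<d} g" "set_integrable lborel {c<..<d} g'"
      using cd by (auto intro: set_integrable_subset[OF int(1)] set_integrable_subset[OF int(2)])
    have "prim g c d = prim g' c d"
      using prim_split[OF i(1), of c] prim_split[OF i(2), of c] eq[of c] eq[of d] cd by simp
    then show "(LINT x:{c<..<d}|lborel. g x - g' x) = 0"
      using set_integral_diff(2)[OF i(3,4)] by (simp add: prim_def)
  qed
  then show ?thesis by eventually_elim simp
qed

lemma differentiable_has_weak_derivative:
  fixes h g :: "real \<Rightarrow> real"
  assumes "0 < L" "\<And>x. (h has_field_derivative g x) (at x)" "continuous_on UNIV g"
  shows "has_weak_derivative h g 0 L"
proof -
  have g: "set_integrable lborel {0<..<L} g" by (rule continuous_set_integrable_Ioo[OF assms(3)])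
  have h: "continuous_on UNIV h" using assms(2) by (blast intro: DERIV_continuous_on)
  have [measurable]: "h \<in> borel_measurable borel" "g \<in> borel_measurable borel"
    using h assms(3) by (auto intro: borel_measurable_continuous_onI)
  show ?thesis
  proof (rule has_weak_derivative_AE_cong[OF prim_has_weak_derivative[OF assms(1) g, of "h 0"]])
    show "AE x in lborel. x \<in> {0<..<L} \<longrightarrow> h 0 + prim g 0 x = h x"
      using prim_deriv[OF assms(2,3), of 0] by (intro AE_I2) auto
  qed (auto simp: set_borel_measurable_def)
qed

lemma continuous_cutoff_square_integrable:
  fixes h :: "real \<Rightarrow> real"
  assumes "continuous_on UNIV h"
  shows "square_integrable (\<lambda>x. indicator {0..L} x * h x)"
  unfolding square_integrable_def
proof
  have [measurable]: "h \<in> borel_measurable borel" using assms by (rule borel_measurable_continuous_onI)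
  show "(\<lambda>x. indicator {0..L} x * h x) \<in> borel_measurable borel" by measurable
  have "integrable lborel (\<lambda>x. indicator {0..L} x *\<^sub>R (h x)\<^sup>2)"
    by (rule borel_integrable_compact) (auto intro!: continuous_intros continuous_on_subset[OF assms])
  moreover have "(\<lambda>x. (indicator {0..L} x * h x)\<^sup>2) = (\<lambda>x. indicator {0..L} x *\<^sub>R (h x)\<^sup>2)"
    by (auto simp: indicator_def)
  ultimately show "integrable lborel (\<lambda>x. (indicator {0..L} x * h x)\<^sup>2)" by simp
qed

section \<open>Multiplication operators\<close>

definition mult_L2 :: "(real \<Rightarrow> real) \<Rightarrow> L2 \<Rightarrow> L2" where
  "mult_L2 \<phi> u = abs_L2 (\<lambda>x. \<phi> x * rep_L2 u x)"

text \<open>The bound holds at every point and not only almost everywhere. Truncated coefficients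
  and indicators satisfy it, and the estimates for quadratic forms become pointwise
  comparisons.\<close>

definition bounded_borel :: "real \<Rightarrow> (real \<Rightarrow> real) \<Rightarrow> bool" where
  "bounded_borel B \<phi> \<longleftrightarrow> \<phi> \<in> borel_measurable borel \<and> (\<forall>x. \<bar>\<phi> x\<bar> \<le> B)"

lemma bounded_borel_nonneg:
  assumes "bounded_borel B \<phi>"
  shows "0 \<le> B"
proof -
  have "\<bar>\<phi> 0\<bar> \<le> B" using assms by (simp add: bounded_borel_def)
  then show ?thesis by linarith
qed

lemma bounded_borelD:
  assumes "bounded_borel B \<phi>"
  shows "\<phi> \<in> borel_measurable borel" "\<bar>\<phi> x\<bar> \<le> B"
  using assms by (auto simp: bounded_borel_def)

lemma bounded_borel_mult:
  assumes "bounded_borel B \<phi>" "bounded_borel B' \<psi>"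
  shows "bounded_borel (B * B') (\<lambda>x. \<phi> x * \<psi> x)"
  unfolding bounded_borel_def abs_mult
  using bounded_borelD[OF assms(1)] bounded_borelD[OF assms(2)] bounded_borel_nonneg[OF assms(1)]
  by (intro conjI allI mult_mono) auto

lemma mult_L2_square_integrable:
  assumes "bounded_borel B \<phi>"
  shows "square_integrable (\<lambda>x. \<phi> x * rep_L2 u x)"
proof (rule square_integrable_bound[where h="\<lambda>x. B * rep_L2 u x"])
  show "square_integrable (\<lambda>x. B * rep_L2 u x)" by (intro square_integrable_scale) simp
  have [measurable]: "\<phi> \<in> borel_measurable borel" using assms by (simp add: bounded_borel_def)
  show "(\<lambda>x. \<phi> x * rep_L2 u x) \<in> borel_measurable borel" by measurable
  have "\<bar>\<phi> x\<bar> \<le> \<bar>B\<bar>" for x using bounded_borelD(2)[OF assms, of x] by simp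
  then show "AE x in lborel. \<bar>\<phi> x * rep_L2 u x\<bar> \<le> \<bar>B * rep_L2 u x\<bar>"
    by (intro AE_I2) (simp add: abs_mult mult_right_mono)
qed

lemma AE_rep_mult:
  "bounded_borel B \<phi> \<Longrightarrow> AE x in lborel. rep_L2 (mult_L2 \<phi> u) x = \<phi> x * rep_L2 u x"
  unfolding mult_L2_def by (rule AE_rep_abs[OF mult_L2_square_integrable])

lemma inner_mult_L2:
  assumes "bounded_borel B \<phi>"
  shows "inner (mult_L2 \<phi> u) v = (LINT x|lborel. \<phi> x * rep_L2 u x * rep_L2 v x)"
  by (rule inner_L2_cong[OF AE_rep_mult[OF assms]]) (use assms in \<open>auto simp: bounded_borel_def\<close>)

lemma inner_mult_L2_commute:
  assumes "bounded_borel B \<phi>"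
  shows "inner (mult_L2 \<phi> u) v = inner u (mult_L2 \<phi> v)"
  by (subst inner_commute[of u]) (simp add: inner_mult_L2[OF assms] mult_ac)

lemma mult_L2_integrable:
  assumes "bounded_borel B \<phi>"
  shows "integrable lborel (\<lambda>x. \<phi> x * rep_L2 u x * rep_L2 v x)"
  by (rule integrable_mult_L2[OF mult_L2_square_integrable[OF assms]]) simp

lemma inner_mult_L2_mono:
  assumes "bounded_borel B \<phi>" "bounded_borel B' \<psi>" "\<And>x. \<phi> x \<le> \<psi> x"
  shows "inner (mult_L2 \<phi> u) u \<le> inner (mult_L2 \<psi> u) u"
  unfolding inner_mult_L2[OF assms(1)] inner_mult_L2[OF assms(2)] mult.assoc
  using mult_L2_integrable[OF assms(1), of u u] mult_L2_integrable[OF assms(2), of u u] assms(3)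
  by (intro integral_mono) (auto simp: mult.assoc intro: mult_right_mono)

lemma bounded_borel_const: "bounded_borel \<bar>k\<bar> (\<lambda>_. k)"
  by (simp add: bounded_borel_def)

lemma mult_L2_const: "mult_L2 (\<lambda>_. k) u = k *\<^sub>R u"
  by (simp add: mult_L2_def scaleR_L2_def)

lemma mult_L2_add:
  assumes "bounded_borel B \<phi>"
  shows "mult_L2 \<phi> (u + v) = mult_L2 \<phi> u + mult_L2 \<phi> v"
  using AE_rep_mult[OF assms, of u] AE_rep_mult[OF assms, of v] AE_rep_mult[OF assms, of "u + v"]
    AE_rep_plus[of u v] AE_rep_plus[of "mult_L2 \<phi> u" "mult_L2 \<phi> v"]
  by (intro L2_eqI, eventually_elim) (simp add: algebra_simps)

lemma mult_L2_scaleR: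
  assumes "bounded_borel B \<phi>"
  shows "mult_L2 \<phi> (k *\<^sub>R u) = k *\<^sub>R mult_L2 \<phi> u"
  using AE_rep_mult[OF assms, of u] AE_rep_mult[OF assms, of "k *\<^sub>R u"]
    AE_rep_scaleR[of k u] AE_rep_scaleR[of k "mult_L2 \<phi> u"]
  by (intro L2_eqI, eventually_elim) simp

lemma mult_L2_mult:
  assumes "bounded_borel B \<phi>" "bounded_borel B' \<psi>"
  shows "mult_L2 \<phi> (mult_L2 \<psi> u) = mult_L2 (\<lambda>x. \<phi> x * \<psi> x) u"
  using AE_rep_mult[OF assms(1), of "mult_L2 \<psi> u"] AE_rep_mult[OF assms(2), of u]
    AE_rep_mult[OF bounded_borel_mult[OF assms], of u]
  by (intro L2_eqI, eventually_elim) simp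

lemma norm_mult_L2:
  assumes "bounded_borel B \<phi>"
  shows "norm (mult_L2 \<phi> u) \<le> B * norm u"
proof -
  have B: "0 \<le> B" by (rule bounded_borel_nonneg[OF assms])
  have m: "bounded_borel (B * B) (\<lambda>x. \<phi> x * \<phi> x)" "bounded_borel (B * B) (\<lambda>_. B * B)"
    using bounded_borel_mult[OF assms assms] B by (auto simp: bounded_borel_def)
  have le: "\<phi> x * \<phi> x \<le> B * B" for x
    using bounded_borelD(2)[OF m(1), of x] by simp
  have "inner (mult_L2 \<phi> u) (mult_L2 \<phi> u) = inner (mult_L2 (\<lambda>x. \<phi> x * \<phi> x) u) u"
    by (simp add: inner_mult_L2_commute[OF assms, symmetric] mult_L2_mult[OF assms assms])
  also have "\<dots> \<le> inner (mult_L2 (\<lambda>_. B * B) u) u"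
    by (rule inner_mult_L2_mono[OF m le])
  finally have "(norm (mult_L2 \<phi> u))\<^sup>2 \<le> (B * norm u)\<^sup>2"
    by (simp add: mult_L2_const power_mult_distrib power2_norm_eq_inner power2_eq_square[of B])
  then show ?thesis by (rule power2_le_imp_le) (simp add: B)
qed

definition mult_net :: "('i \<Rightarrow> real \<Rightarrow> real) \<Rightarrow> (L2, 'i::finite) vec \<Rightarrow> (L2, 'i) vec" where
  "mult_net \<Phi> w = (\<chi> e. mult_L2 (\<Phi> e) (w $ e))"

lemma mult_net_nth [simp]: "mult_net \<Phi> w $ e = mult_L2 (\<Phi> e) (w $ e)"
  by (simp add: mult_net_def)

lemma norm_mult_net:
  assumes "\<And>e. bounded_borel B (\<Phi> e)"
  shows "norm (mult_net \<Phi> w) \<le> B * norm w"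
proof -
  have B: "0 \<le> B" by (rule bounded_borel_nonneg[OF assms])
  have "(norm (mult_L2 (\<Phi> e) (w $ e)))\<^sup>2 \<le> (B * norm (w $ e))\<^sup>2" for e
    by (rule power_mono[OF norm_mult_L2[OF assms]]) simp
  then have "(norm (mult_net \<Phi> w))\<^sup>2 \<le> (B * norm w)\<^sup>2"
    unfolding power_mult_distrib power2_norm_eq_inner
    by (simp add: inner_vec_def sum_distrib_left sum_mono)
  then show ?thesis by (rule power2_le_imp_le) (simp add: B)
qed

lemma bounded_linear_mult_net:
  assumes "\<And>e. bounded_borel B (\<Phi> e)"
  shows "bounded_linear (mult_net \<Phi>)"
  by (rule bounded_linear_intro[where K=B])
    (use norm_mult_net[OF assms] in \<open>auto simp: vec_eq_iff mult_L2_add[OF assms] mult_L2_scaleR[OF assms] mult.commute\<close>)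

lemma inner_mult_net_commute:
  assumes "\<And>e. bounded_borel B (\<Phi> e)"
  shows "inner (mult_net \<Phi> u) v = inner u (mult_net \<Phi> v)"
  by (simp add: inner_vec_def inner_mult_L2_commute[OF assms])

lemma inner_mult_net_bounds:
  assumes "\<And>e. bounded_borel B (\<Phi> e)"
  shows "(\<And>e x. m \<le> \<Phi> e x) \<Longrightarrow> m * inner u u \<le> inner (mult_net \<Phi> u) u"
    and "(\<And>e x. \<Phi> e x \<le> m) \<Longrightarrow> inner (mult_net \<Phi> u) u \<le> m * inner u u"
  using inner_mult_L2_mono[OF bounded_borel_const assms, of m] inner_mult_L2_mono[OF assms bounded_borel_const, of _ m]
  by (auto simp: inner_vec_def sum_distrib_left mult_L2_const intro!: sum_mono)

lemma mult_net_mult: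
  assumes "\<And>e. bounded_borel B (\<Phi> e)" "\<And>e. bounded_borel B' (\<Psi> e)"
  shows "mult_net \<Phi> (mult_net \<Psi> u) = mult_net (\<lambda>e x. \<Phi> e x * \<Psi> e x) u"
  by (simp add: vec_eq_iff mult_L2_mult[OF assms])

lemma mult_net_one: "mult_net (\<lambda>e x. 1) u = u"
  by (simp add: vec_eq_iff mult_L2_const)

section \<open>The derivative on the network\<close>

locale network =
  fixes E :: "('v::finite \<times> 'v) set" and l :: "'v \<times> 'v \<Rightarrow> real"
  assumes no_loops: "e \<in> E \<Longrightarrow> fst e \<noteq> snd e" and lengths: "e \<in> E \<Longrightarrow> 0 < l e"
begin

text \<open>The orthogonal projection onto \<open>L2_network\<close>. As a multiplication operator
  it commutes with the coefficients.\<close>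

definition proj :: "'v network_fun \<Rightarrow> 'v network_fun" where
  "proj = mult_net (\<lambda>e x. if e \<in> E then indicator {0..l e} x else 0)"

lemma proj_bounded_borel: "bounded_borel 1 (\<lambda>x. if e \<in> E then indicator {0..l e} x else 0)"
  by (cases "e \<in> E") (auto simp: bounded_borel_def indicator_def)

lemma bounded_linear_proj: "bounded_linear proj"
  unfolding proj_def by (rule bounded_linear_mult_net[OF proj_bounded_borel])

lemma norm_proj: "norm (proj w) \<le> norm w"
  unfolding proj_def using norm_mult_net[OF proj_bounded_borel, where w=w] by simp

lemma inner_proj: "inner (proj u) v = inner u (proj v)"
  unfolding proj_def by (rule inner_mult_net_commute[OF proj_bounded_borel])

lemma AE_rep_proj:
  "e \<in> E \<Longrightarrow> AE x in lborel. rep_L2 (proj w $ e) x = indicator {0..l e} x * rep_L2 (w $ e) x"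
  using AE_rep_mult[OF proj_bounded_borel[of e], of "w $ e"] by (simp add: proj_def)

lemma proj_in: "proj w \<in> L2_network E l"
  unfolding L2_network_def
proof (intro CollectI conjI ballI allI impI)
  fix e assume "e \<in> E"
  from AE_rep_proj[OF this, of w] show "AE x in lborel. x \<notin> {0..l e} \<longrightarrow> rep_L2 (proj w $ e) x = 0"
    by eventually_elim simp
next
  fix e assume "e \<notin> E"
  then show "proj w $ e = 0" by (simp add: proj_def mult_L2_const)
qed

lemma L2_networkD:
  "w \<in> L2_network E l \<Longrightarrow> e \<in> E \<Longrightarrow> AE x in lborel. x \<notin> {0..l e} \<longrightarrow> rep_L2 (w $ e) x = 0"
  "w \<in> L2_network E l \<Longrightarrow> e \<notin> E \<Longrightarrow> w $ e = 0"
  unfolding L2_network_def by blast+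

lemma L2_network_eqI:
  assumes "w \<in> L2_network E l" "z \<in> L2_network E l"
    and "\<And>e. e \<in> E \<Longrightarrow> AE x in lborel. x \<in> {0<..<l e} \<longrightarrow> rep_L2 (w $ e) x = rep_L2 (z $ e) x"
  shows "w = z"
proof -
  have "w $ e = z $ e" for e
  proof (cases "e \<in> E")
    case True
    show ?thesis
      using L2_networkD(1)[OF assms(1) True] L2_networkD(1)[OF assms(2) True] assms(3)[OF True]
        AE_lborel_singleton[of 0] AE_lborel_singleton[of "l e"]
      by (intro L2_eqI, eventually_elim) force
  qed (use L2_networkD(2) assms in auto)
  then show ?thesis by (simp add: vec_eq_iff)
qed

lemma proj_id:
  assumes "w \<in> L2_network E l"
  shows "proj w = w"
proof (rule L2_network_eqI[OF proj_in assms])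
  fix e assume "e \<in> E"
  from AE_rep_proj[OF this, of w]
  show "AE x in lborel. x \<in> {0<..<l e} \<longrightarrow> rep_L2 (proj w $ e) x = rep_L2 (w $ e) x"
    by eventually_elim auto
qed

lemma proj_proj [simp]: "proj (proj w) = proj w"
  by (rule proj_id[OF proj_in])

lemma inner_L2_network:
  assumes "w \<in> L2_network E l"
  shows "inner w z = (\<Sum>e\<in>E. LINT x:{0<..<l e}|lborel. rep_L2 (w $ e) x * rep_L2 (z $ e) x)"
proof -
  have "inner w z = (\<Sum>e\<in>E. inner (w $ e) (z $ e))"
    unfolding inner_vec_def by (rule sum.mono_neutral_right) (use L2_networkD(2)[OF assms] in auto)
  also have "\<dots> = (\<Sum>e\<in>E. LINT x:{0<..<l e}|lborel. rep_L2 (w $ e) x * rep_L2 (z $ e) x)"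
    unfolding inner_L2_def set_lebesgue_integral_def
  proof (intro sum.cong integral_cong_AE)
    fix e assume e: "e \<in> E"
    show "AE x in lborel. rep_L2 (w $ e) x * rep_L2 (z $ e) x
        = indicator {0<..<l e} x *\<^sub>R (rep_L2 (w $ e) x * rep_L2 (z $ e) x)"
      using L2_networkD(1)[OF assms e] AE_lborel_singleton[of 0] AE_lborel_singleton[of "l e"]
      by eventually_elim (auto simp: indicator_def)
  qed auto
  finally show ?thesis .
qed

lemma edge_derivative_eq:
  assumes "has_edge_derivative E l w z"
  shows "edge_derivative E l w = z"
  unfolding edge_derivative_def
proof (rule the_equality)
  show "has_edge_derivative E l w z" by (rule assms)
  fix z' assume z': "has_edge_derivative E l w z'"
  show "z' = z"
  proof (rule L2_network_eqI)
    fix e assume e: "e \<in> E"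
    show "AE x in lborel. x \<in> {0<..<l e} \<longrightarrow> rep_L2 (z' $ e) x = rep_L2 (z $ e) x"
      using assms z' e unfolding has_edge_derivative_def
      by (intro weak_derivative_unique[OF lengths[OF e]]) blast+
  qed (use assms z' in \<open>simp_all add: has_edge_derivative_def\<close>)
qed

lemma edge_trace_eq:
  assumes "e \<in> E" "continuous_rep (l e) (rep_L2 (w $ e)) h"
  shows "edge_trace l w e v = h (if fst e = v then 0 else l e)"
  unfolding edge_trace_def
proof (rule the_equality)
  show "\<exists>h'. continuous_on {0..l e} h' \<and> (AE x in lborel. x \<in> {0..l e} \<longrightarrow> rep_L2 (w $ e) x = h' x) \<and>
      h (if fst e = v then 0 else l e) = h' (if fst e = v then 0 else l e)"
    using assms(2) unfolding continuous_rep_def by blast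
  fix y assume "\<exists>h'. continuous_on {0..l e} h' \<and> (AE x in lborel. x \<in> {0..l e} \<longrightarrow> rep_L2 (w $ e) x = h' x) \<and>
      y = h' (if fst e = v then 0 else l e)"
  then obtain h' where h': "continuous_rep (l e) (rep_L2 (w $ e)) h'" "y = h' (if fst e = v then 0 else l e)"
    by (auto simp: continuous_rep_def)
  then show "y = h (if fst e = v then 0 else l e)"
    using continuous_rep_unique[OF lengths[OF assms(1)] h'(1) assms(2)] lengths[OF assms(1)] by auto
qed

text \<open>Regroups boundary terms from edges to vertices. Distinct ends matter here: on a loop
  \<open>edge_sign\<close> would only see the initial vertex.\<close>

lemma sum_over_ends:
  fixes X :: "'v \<times> 'v \<Rightarrow> 'v \<Rightarrow> real"
  shows "(\<Sum>e\<in>E. X e (snd e) - X e (fst e)) = (\<Sum>v\<in>UNIV. \<Sum>e\<in>incident_edges E v. edge_sign e v * X e v)"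
proof -
  have "(\<Sum>v\<in>UNIV. \<Sum>e\<in>incident_edges E v. edge_sign e v * X e v) = (\<Sum>v\<in>UNIV. \<Sum>e\<in>E. edge_sign e v * X e v)"
    by (intro sum.cong refl sum.mono_neutral_left) (auto simp: incident_edges_def edge_sign_def)
  also have "\<dots> = (\<Sum>e\<in>E. \<Sum>v\<in>UNIV. edge_sign e v * X e v)"
    by (rule sum.swap)
  also have "\<dots> = (\<Sum>e\<in>E. X e (snd e) - X e (fst e))"
  proof (rule sum.cong)
    fix e assume e: "e \<in> E"
    have "(\<Sum>v\<in>UNIV. edge_sign e v * X e v) = (\<Sum>v\<in>UNIV. (if v = snd e then X e v else 0) - (if v = fst e then X e v else 0))"
      using no_loops[OF e] by (intro sum.cong) (auto simp: edge_sign_def)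
    then show "(\<Sum>v\<in>UNIV. edge_sign e v * X e v) = X e (snd e) - X e (fst e)"
      by (simp add: sum_subtractf)
  qed simp
  finally show ?thesis ..
qed

text \<open>Integration by parts on each edge, regrouped at the vertices. No vertex conditions are
  imposed, so the same formula serves to derive such conditions from vanishing pairings.\<close>

lemma green_formula:
  assumes u: "u \<in> L2_network E l" "has_edge_derivative E l u r"
    and p: "p \<in> L2_network E l" "has_edge_derivative E l p q"
  shows "inner u q + inner r p
    = (\<Sum>v\<in>UNIV. \<Sum>e\<in>incident_edges E v. edge_sign e v * (edge_trace l u e v * edge_trace l p e v))"
proof -
  have r: "r \<in> L2_network E l" using u(2) by (simp add: has_edge_derivative_def)
  have "inner u q + inner r p = (\<Sum>e\<in>E. edge_trace l u e (snd e) * edge_trace l p e (snd e)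
      - edge_trace l u e (fst e) * edge_trace l p e (fst e))"
    unfolding inner_L2_network[OF u(1)] inner_L2_network[OF r] sum.distrib[symmetric]
  proof (rule sum.cong)
    fix e assume e: "e \<in> E"
    have w: "has_weak_derivative (rep_L2 (u $ e)) (rep_L2 (r $ e)) 0 (l e)"
      "has_weak_derivative (rep_L2 (p $ e)) (rep_L2 (q $ e)) 0 (l e)"
      using u(2) p(2) e by (auto simp: has_edge_derivative_def)
    obtain h where h: "continuous_rep (l e) (rep_L2 (u $ e)) h"
      using weak_derivative_continuous_rep[OF lengths[OF e] w(1)] by metis
    obtain k where k: "continuous_rep (l e) (rep_L2 (p $ e)) k"
      using weak_derivative_continuous_rep[OF lengths[OF e] w(2)] by metis
    show "(LINT x:{0<..<l e}|lborel. rep_L2 (u $ e) x * rep_L2 (q $ e) x) + (LINT x:{0<..<l e}|lborel. rep_L2 (r $ e) x * rep_L2 (p $ e) x)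
      = edge_trace l u e (snd e) * edge_trace l p e (snd e) - edge_trace l u e (fst e) * edge_trace l p e (fst e)"
      using no_loops[OF e] integral_by_parts_weak[OF lengths[OF e] w(1) h w(2) k]
      by (simp add: edge_trace_eq[OF e h] edge_trace_eq[OF e k])
  qed simp
  then show ?thesis
    by (simp only: sum_over_ends[of "\<lambda>e v. edge_trace l u e v * edge_trace l p e v"])
qed

section \<open>Test elements given by explicit functions on the edges\<close>

definition netfun :: "('v \<times> 'v \<Rightarrow> real \<Rightarrow> real) \<Rightarrow> 'v network_fun" where
  "netfun h = (\<chi> e. if e \<in> E then abs_L2 (\<lambda>x. indicator {0..l e} x * h e x) else 0)"

lemma AE_rep_netfun:
  assumes "e \<in> E" "continuous_on UNIV (h e)"
  shows "AE x in lborel. rep_L2 (netfun h $ e) x = indicator {0..l e} x * h e x"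
  using AE_rep_abs[OF continuous_cutoff_square_integrable[OF assms(2), of "l e"]] assms(1)
  by (simp add: netfun_def)

lemma netfun_in:
  assumes "\<And>e. e \<in> E \<Longrightarrow> continuous_on UNIV (h e)"
  shows "netfun h \<in> L2_network E l"
  unfolding L2_network_def
proof (intro CollectI conjI ballI allI impI)
  fix e assume e: "e \<in> E"
  from AE_rep_netfun[where h=h, OF e assms[OF e]] show "AE x in lborel. x \<notin> {0..l e} \<longrightarrow> rep_L2 (netfun h $ e) x = 0"
    by eventually_elim simp
qed (simp add: netfun_def)

lemma netfun_trace:
  assumes "e \<in> E" "continuous_on UNIV (h e)"
  shows "edge_trace l (netfun h) e v = h e (if fst e = v then 0 else l e)"
proof (rule edge_trace_eq[OF assms(1)])
  have "AE x in lborel. x \<in> {0..l e} \<longrightarrow> rep_L2 (netfun h $ e) x = h e x"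
    using AE_rep_netfun[where h=h, OF assms] by eventually_elim simp
  then show "continuous_rep (l e) (rep_L2 (netfun h $ e)) (h e)"
    unfolding continuous_rep_def using assms(2) by (auto intro: continuous_on_subset)
qed

lemma netfun_derivative:
  assumes d: "\<And>e x. e \<in> E \<Longrightarrow> (h e has_field_derivative g e x) (at x)"
    and g: "\<And>e. e \<in> E \<Longrightarrow> continuous_on UNIV (g e)"
  shows "netfun h \<in> L2_network E l" "has_edge_derivative E l (netfun h) (netfun g)"
proof -
  have h: "continuous_on UNIV (h e)" if "e \<in> E" for e
    by (rule DERIV_continuous_on[OF d[OF that]])
  show "netfun h \<in> L2_network E l" by (rule netfun_in[OF h])
  show "has_edge_derivative E l (netfun h) (netfun g)"
    unfolding has_edge_derivative_def
  proof (intro conjI ballI netfun_in[OF g])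
    fix e assume e: "e \<in> E"
    have "has_weak_derivative (h e) (g e) 0 (l e)"
      by (rule differentiable_has_weak_derivative[OF lengths[OF e] d[OF e] g[OF e]])
    then show "has_weak_derivative (rep_L2 (netfun h $ e)) (rep_L2 (netfun g $ e)) 0 (l e)"
    proof (rule has_weak_derivative_AE_cong)
      show "AE x in lborel. x \<in> {0<..<l e} \<longrightarrow> h e x = rep_L2 (netfun h $ e) x"
        using AE_rep_netfun[where h=h, OF e h[OF e]] by eventually_elim simp
      show "AE x in lborel. x \<in> {0<..<l e} \<longrightarrow> g e x = rep_L2 (netfun g $ e) x"
        using AE_rep_netfun[where h=g, OF e g[OF e]] by eventually_elim simp
    qed (auto simp: set_borel_measurable_def)
  qed
qed

text \<open>
  The projection makes these relations densely defined in the whole type and not only in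
  $L^2(\mathcal E)$.
\<close>

definition D_div :: "('v network_fun \<times> 'v network_fun) set" where
  "D_div = {(u, r). has_edge_derivative E l (proj u) r \<and> proj u \<in> H_div E l}"

definition D_0 :: "('v network_fun \<times> 'v network_fun) set" where
  "D_0 = {(p, q). has_edge_derivative E l (proj p) q \<and> proj p \<in> H1_0 E l}"

lemma H1_networkI: "w \<in> L2_network E l \<Longrightarrow> has_edge_derivative E l w z \<Longrightarrow> w \<in> H1_network E l"
  by (auto simp: H1_network_def)

text \<open>Vanishing traces satisfy the vertex conditions of both spaces, so functions of this kind
  are test elements for either relation.\<close>

lemma zero_vertex_values:
  assumes "w \<in> L2_network E l" "has_edge_derivative E l w z"
    and "\<And>e v. e \<in> E \<Longrightarrow> edge_trace l w e v = 0"
  shows "(w, z) \<in> D_div" "(w, z) \<in> D_0"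
  using assms H1_networkI[OF assms(1,2)]
  by (auto simp: D_div_def D_0_def H_div_def H1_0_def proj_id incident_edges_def)

text \<open>The part of x off the network is killed by \<open>proj\<close> and therefore has
  derivative 0. Testing with these pairs forces the second component of an adjoint pair to be
  supported on the network.\<close>

lemma kernel_pairs: "(x - proj x, 0) \<in> D_div" "(x - proj x, 0) \<in> D_0"
proof -
  have 0: "netfun (\<lambda>e x. 0) = 0"
    by (simp add: vec_eq_iff netfun_def zero_L2_def)
  have d: "has_edge_derivative E l 0 0" "0 \<in> L2_network E l"
    using netfun_derivative[of "\<lambda>e x. 0" "\<lambda>e x. 0"] by (simp_all add: 0)
  have t: "edge_trace l 0 e v = 0" if "e \<in> E" for e v
    using netfun_trace[OF that, of "\<lambda>e x. 0"] by (simp add: 0)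
  have p: "proj (x - proj x) = 0" "proj 0 = 0"
    using bounded_linear.linear[OF bounded_linear_proj] by (simp_all add: linear_diff linear_0)
  show "(x - proj x, 0) \<in> D_div" "(x - proj x, 0) \<in> D_0"
    using zero_vertex_values[OF d(2,1) t] by (simp_all add: D_div_def D_0_def p)
qed

text \<open>Only test elements common to both relations are used, so X can be either of them. The
  kernel pairs place y in \<open>L2_network\<close>, and a test function on a single edge gives the
  weak derivative there.\<close>

lemma adjoint_imp_derivative:
  assumes X: "\<And>x. (x - proj x, 0) \<in> X"
      "\<And>w z. w \<in> L2_network E l \<Longrightarrow> has_edge_derivative E l w z \<Longrightarrow> (\<And>e v. e \<in> E \<Longrightarrow> edge_trace l w e v = 0) \<Longrightarrow> (w, z) \<in> X"
    and adj: "\<And>p q. (p, q) \<in> X \<Longrightarrow> inner w q + inner y p = 0"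
  shows "has_edge_derivative E l (proj w) y"
  unfolding has_edge_derivative_def
proof (intro conjI ballI)
  \<comment> \<open>The difference y - proj y is orthogonal to y by the kernel pair and to proj y
    because \<open>proj\<close> is an orthogonal projection, hence to itself.\<close>
  have "inner y (y - proj y) = 0"
    using adj[OF X(1)[of y]] by simp
  moreover have "inner (proj y) (y - proj y) = 0"
    by (simp add: inner_diff_right inner_proj)
  ultimately have "inner (y - proj y) (y - proj y) = 0"
    by (simp add: inner_diff_left)
  then have y: "proj y = y" by simp
  then show yin: "y \<in> L2_network E l" using proj_in[of y] by simp
  fix e assume e: "e \<in> E"
  show "has_weak_derivative (rep_L2 (proj w $ e)) (rep_L2 (y $ e)) 0 (l e)"
    unfolding has_weak_derivative_def
  proof (intro conjI ballI square_integrable_set_integrable square_integrable_rep)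
    fix \<phi> assume \<phi>: "\<phi> \<in> test_functions 0 (l e)"
    \<comment> \<open>The test function lives on the edge \<open>e\<close> and is zero on all
      others, so \<open>pick\<close> reduces each inner product to one integral.\<close>
    define h g where "h = (\<lambda>e'. if e' = e then \<phi> else (\<lambda>_. 0))" and "g = (\<lambda>e'. if e' = e then deriv \<phi> else (\<lambda>_. 0))"
    have d: "(h e' has_field_derivative g e' x) (at x)" for e' x
      using test_function_has_deriv[OF \<phi>] by (simp add: h_def g_def)
    have c: "continuous_on UNIV (g e')" "continuous_on UNIV (h e')" for e'
      using test_function_continuous[OF \<phi>] by (simp_all add: h_def g_def)
    have "edge_trace l (netfun h) e' v = 0" if "e' \<in> E" for e' v
      using test_function_endpoints[OF \<phi>] netfun_trace[where h=h, OF that c(2)] by (simp add: h_def)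
    then have "(netfun h, netfun g) \<in> X"
      using netfun_derivative[where h=h and g=g, OF d c(1)] by (intro X(2))
    then have "inner w (netfun g) + inner y (netfun h) = 0" by (rule adj)
    moreover have "inner w (netfun g) = inner (proj w) (netfun g)"
      by (simp add: inner_proj proj_id[OF netfun_in[OF c(1)]])
    moreover have pick: "inner z (netfun k) = (LINT x:{0<..<l e}|lborel. k e x *\<^sub>R rep_L2 (z $ e) x)"
      if z: "z \<in> L2_network E l" and k: "\<And>e. continuous_on UNIV (k e)" "\<And>e'. e' \<noteq> e \<Longrightarrow> k e' = (\<lambda>_. 0)" for z k
    proof -
      have "inner z (netfun k) = (\<Sum>e'\<in>E. LINT x:{0<..<l e'}|lborel. k e' x *\<^sub>R rep_L2 (z $ e') x)"
        unfolding inner_L2_network[OF z] set_lebesgue_integral_def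
      proof (intro sum.cong integral_cong_AE)
        fix e' assume e': "e' \<in> E"
        have [measurable]: "k e' \<in> borel_measurable borel" using k(1) by (rule borel_measurable_continuous_onI)
        show "AE x in lborel. indicator {0<..<l e'} x *\<^sub>R (rep_L2 (z $ e') x * rep_L2 (netfun k $ e') x)
            = indicator {0<..<l e'} x *\<^sub>R k e' x *\<^sub>R rep_L2 (z $ e') x"
          using AE_rep_netfun[where h=k, OF e' k(1)] by eventually_elim (auto simp: indicator_def)
        show "(\<lambda>x. indicator {0<..<l e'} x *\<^sub>R k e' x *\<^sub>R rep_L2 (z $ e') x) \<in> borel_measurable lborel"
          by measurable
      qed auto
      also have "\<dots> = (\<Sum>e'\<in>E. if e' = e then LINT x:{0<..<l e}|lborel. k e x *\<^sub>R rep_L2 (z $ e) x else 0)"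
        using k(2) by (intro sum.cong) auto
      finally show ?thesis using e by simp
    qed
    ultimately show "(LINT x:{0<..<l e}|lborel. deriv \<phi> x *\<^sub>R rep_L2 (proj w $ e) x)
        = - (LINT x:{0<..<l e}|lborel. \<phi> x *\<^sub>R rep_L2 (y $ e) x)"
      using pick[where k=g, OF proj_in c(1)] pick[where k=h, OF yin c(2)]
      by (simp add: g_def h_def)
  qed
qed

text \<open>Affine interpolation between the two ends of every edge: traces can be prescribed
  independently for each edge and each of its ends.\<close>

lemma affine_netfun:
  fixes \<beta> :: "'v \<times> 'v \<Rightarrow> 'v \<Rightarrow> real"
  obtains w z where "w \<in> L2_network E l" "has_edge_derivative E l w z"
    "\<And>e v. e \<in> incident_edges E v \<Longrightarrow> edge_trace l w e v = \<beta> e v"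
proof -
  define s where "s e = (\<beta> e (snd e) - \<beta> e (fst e)) / l e" for e
  define h where "h e x = \<beta> e (fst e) + s e * x" for e x
  have d: "(h e has_field_derivative s e) (at x)" for e x
    unfolding h_def by (auto intro!: derivative_eq_intros)
  have c: "continuous_on UNIV (h e)" for e
    unfolding h_def by (intro continuous_intros)
  have "edge_trace l (netfun h) e v = \<beta> e v" if "e \<in> incident_edges E v" for e v
  proof -
    have e: "e \<in> E" using that by (simp add: incident_edges_def)
    show ?thesis
      using that lengths[OF e] by (auto simp: netfun_trace[where h=h, OF e c] h_def s_def incident_edges_def)
  qed
  with netfun_derivative[of h "\<lambda>e _. s e"] d show thesis
    by (intro that[of "netfun h" "netfun (\<lambda>e _. s e)"]) auto
qed

text \<open>At an interior vertex the common value of p factors out and leaves the flux sum of u,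
  which is zero; at a boundary vertex p itself vanishes.\<close>

lemma pairing_D: "(u, r) \<in> D_div \<Longrightarrow> (p, q) \<in> D_0 \<Longrightarrow> inner u q + inner r p = 0"
proof -
  assume u: "(u, r) \<in> D_div" and p: "(p, q) \<in> D_0"
  have q: "q \<in> L2_network E l" and r: "r \<in> L2_network E l"
    using u p by (auto simp: D_div_def D_0_def has_edge_derivative_def)
  have "inner u q + inner r p = inner (proj u) q + inner r (proj p)"
    using inner_proj[of u q] inner_proj[of r p] proj_id[OF q] proj_id[OF r] by simp
  also have "\<dots> = (\<Sum>v\<in>UNIV. \<Sum>e\<in>incident_edges E v.
      edge_sign e v * (edge_trace l (proj u) e v * edge_trace l (proj p) e v))"
    using u p by (intro green_formula proj_in) (auto simp: D_div_def D_0_def)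
  also have "\<dots> = 0"
  proof (rule sum.neutral, rule ballI)
    fix v :: 'v
    show "(\<Sum>e\<in>incident_edges E v. edge_sign e v * (edge_trace l (proj u) e v * edge_trace l (proj p) e v)) = 0"
    proof (cases "v \<in> interior_vertices E")
      case True
      show ?thesis
      proof (cases "incident_edges E v = {}")
        case False
        then obtain e0 where e0: "e0 \<in> incident_edges E v" by blast
        have "edge_trace l (proj p) e v = edge_trace l (proj p) e0 v" if "e \<in> incident_edges E v" for e
          using p True e0 that unfolding D_0_def H1_0_def by blast
        then have "(\<Sum>e\<in>incident_edges E v. edge_sign e v * (edge_trace l (proj u) e v * edge_trace l (proj p) e v))
          = (\<Sum>e\<in>incident_edges E v. edge_sign e v * edge_trace l (proj u) e v * edge_trace l (proj p) e0 v)"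
          by (simp only: mult.assoc cong: sum.cong)
        also have "\<dots> = (\<Sum>e\<in>incident_edges E v. edge_sign e v * edge_trace l (proj u) e v) * edge_trace l (proj p) e0 v"
          by (simp add: sum_distrib_right)
        also have "\<dots> = 0" using u True by (simp add: D_div_def H_div_def)
        finally show ?thesis .
      qed simp
    next
      case False
      then have "v \<in> boundary_vertices E" by (simp add: boundary_vertices_def)
      then show ?thesis using p by (intro sum.neutral) (auto simp: D_0_def H1_0_def)
    qed
  qed
  finally show ?thesis .
qed

text \<open>The test element is the hat function that is 1 at \<open>v0\<close> and 0 at all other
  vertices. It satisfies the conditions of \<open>H1_0\<close> because \<open>v0\<close> is
  interior, and in Green's formula it isolates the flux sum at \<open>v0\<close>.\<close>

lemma adjoint_in_D_div:
  assumes adj: "\<And>p q. (p, q) \<in> D_0 \<Longrightarrow> inner u q + inner r p = 0"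
  shows "(u, r) \<in> D_div"
proof -
  have d: "has_edge_derivative E l (proj u) r"
    by (rule adjoint_imp_derivative[OF kernel_pairs(2) zero_vertex_values(2) adj])
  have r: "r \<in> L2_network E l" using d by (simp add: has_edge_derivative_def)
  have "(\<Sum>e\<in>incident_edges E v0. edge_sign e v0 * edge_trace l (proj u) e v0) = 0"
    if v0: "v0 \<in> interior_vertices E" for v0
  proof -
    obtain p q where p: "p \<in> L2_network E l" "has_edge_derivative E l p q"
      and t: "\<And>e v. e \<in> incident_edges E v \<Longrightarrow> edge_trace l p e v = (if v = v0 then 1 else 0)"
      using affine_netfun[of "\<lambda>e v. if v = v0 then 1 else 0"] by metis
    have "(p, q) \<in> D_0"
      using p t v0 H1_networkI[OF p] by (auto simp: D_0_def H1_0_def proj_id boundary_vertices_def)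
    then have "0 = inner u q + inner r p" by (rule adj[symmetric])
    also have "\<dots> = inner (proj u) q + inner r p"
      using inner_proj[of u q] proj_id[of q] p(2) by (simp add: has_edge_derivative_def)
    also have "\<dots> = (\<Sum>v\<in>UNIV. \<Sum>e\<in>incident_edges E v. edge_sign e v * (edge_trace l (proj u) e v * edge_trace l p e v))"
      by (intro green_formula proj_in d p)
    also have "\<dots> = (\<Sum>v\<in>UNIV. if v = v0 then \<Sum>e\<in>incident_edges E v0. edge_sign e v0 * edge_trace l (proj u) e v0 else 0)"
      by (intro sum.cong) (auto simp: t)
    finally show ?thesis by simp
  qed
  then show ?thesis
    using d H1_networkI[OF proj_in d] by (simp add: D_div_def H_div_def)
qed

lemma edge_sign_square: "e \<in> incident_edges E v \<Longrightarrow> edge_sign e v * edge_sign e v = 1"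
  by (auto simp: incident_edges_def edge_sign_def)

text \<open>Two fluxes are used as tests: one that enters \<open>v0\<close> through one edge and
  leaves through another forces equal traces, and one through a single edge at a boundary vertex
  forces the trace 0.\<close>

lemma adjoint_in_D_0:
  assumes adj: "\<And>u r. (u, r) \<in> D_div \<Longrightarrow> inner u q + inner r p = 0"
  shows "(p, q) \<in> D_0"
proof -
  have adj': "inner p r + inner q u = 0" if "(u, r) \<in> D_div" for u r
    using adj[OF that] by (simp add: inner_commute add.commute)
  have d: "has_edge_derivative E l (proj p) q"
    by (rule adjoint_imp_derivative[OF kernel_pairs(1) zero_vertex_values(1) adj'])
  \<comment> \<open>Any end values \<beta> whose flux sums vanish at the interior vertices are the
    traces of an element of \<open>H_div\<close>; Green's formula turns this into a linear relation
    for the traces of p.\<close>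
  have test: "(\<Sum>v\<in>UNIV. \<Sum>e\<in>incident_edges E v. edge_sign e v * (\<beta> e v * edge_trace l (proj p) e v)) = 0"
    if \<beta>: "\<And>v. v \<in> interior_vertices E \<Longrightarrow> (\<Sum>e\<in>incident_edges E v. edge_sign e v * \<beta> e v) = 0" for \<beta>
  proof -
    obtain u r where u: "u \<in> L2_network E l" "has_edge_derivative E l u r"
      and t: "\<And>e v. e \<in> incident_edges E v \<Longrightarrow> edge_trace l u e v = \<beta> e v"
      using affine_netfun[of \<beta>] by metis
    have "(u, r) \<in> D_div"
      using u \<beta> H1_networkI[OF u] by (simp add: D_div_def H_div_def proj_id t)
    then have "0 = inner u q + inner r p" by (rule adj[symmetric])
    also have "\<dots> = inner u q + inner r (proj p)"
      using inner_proj[of r p] proj_id[of r] u(2) by (simp add: has_edge_derivative_def)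
    also have "\<dots> = (\<Sum>v\<in>UNIV. \<Sum>e\<in>incident_edges E v. edge_sign e v * (edge_trace l u e v * edge_trace l (proj p) e v))"
      by (intro green_formula proj_in d u)
    finally show ?thesis by (simp add: t)
  qed
  have continuity: "edge_trace l (proj p) e1 v0 = edge_trace l (proj p) e2 v0"
    if e: "e1 \<in> incident_edges E v0" "e2 \<in> incident_edges E v0" for v0 e1 e2
  proof (cases "e1 = e2")
    case False
    \<comment> \<open>The factor \<open>edge_sign\<close> cancels the sign in Green's formula, since
      its square is 1 at an end of the edge. The signed fluxes are 1 and -1, so their sum is
      0.\<close>
    define \<beta> where "\<beta> e v = (if v = v0 \<and> e = e1 then edge_sign e v else if v = v0 \<and> e = e2 then - edge_sign e v else 0)" for e v
    have s: "edge_sign e v * (\<beta> e v * k e) = (if v = v0 then (if e = e1 then k e1 else 0) - (if e = e2 then k e2 else 0) else 0)"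
      if "e \<in> incident_edges E v" for e v and k :: "'v \<times> 'v \<Rightarrow> real"
      using edge_sign_square[OF that] False by (auto simp: \<beta>_def simp flip: mult.assoc)
    have sum0: "(\<Sum>e\<in>incident_edges E v. edge_sign e v * (\<beta> e v * k e)) = (if v = v0 then k e1 - k e2 else 0)"
      for v and k :: "'v \<times> 'v \<Rightarrow> real"
    proof -
      have "(\<Sum>e\<in>incident_edges E v. edge_sign e v * (\<beta> e v * k e))
        = (\<Sum>e\<in>incident_edges E v. if v = v0 then (if e = e1 then k e1 else 0) - (if e = e2 then k e2 else 0) else 0)"
        by (intro sum.cong refl s)
      then show ?thesis using e by (simp add: sum_subtractf)
    qed
    have "(\<Sum>v\<in>UNIV. \<Sum>e\<in>incident_edges E v. edge_sign e v * (\<beta> e v * edge_trace l (proj p) e v)) = 0"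
      using sum0[of _ "\<lambda>_. 1"] by (intro test) simp
    moreover have "(\<Sum>e\<in>incident_edges E v. edge_sign e v * (\<beta> e v * edge_trace l (proj p) e v))
        = (if v = v0 then edge_trace l (proj p) e1 v0 - edge_trace l (proj p) e2 v0 else 0)" for v
      using sum0[of v "\<lambda>e. edge_trace l (proj p) e v"] by simp
    ultimately show ?thesis by simp
  qed simp
  have boundary: "edge_trace l (proj p) e0 v0 = 0"
    if v0: "v0 \<in> boundary_vertices E" and e0: "e0 \<in> incident_edges E v0" for v0 e0
  proof -
    \<comment> \<open>A single flux is admissible because \<open>H_div\<close> imposes no condition
      at a boundary vertex.\<close>
    define \<beta> where "\<beta> e v = (if v = v0 \<and> e = e0 then edge_sign e v else 0)" for e v
    have "(\<Sum>v\<in>UNIV. \<Sum>e\<in>incident_edges E v. edge_sign e v * (\<beta> e v * edge_trace l (proj p) e v)) = 0"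
      using v0 by (intro test sum.neutral) (auto simp: \<beta>_def boundary_vertices_def)
    moreover have "(\<Sum>e\<in>incident_edges E v. edge_sign e v * (\<beta> e v * edge_trace l (proj p) e v))
        = (if v = v0 then edge_trace l (proj p) e0 v0 else 0)" for v
    proof -
      have "(\<Sum>e\<in>incident_edges E v. edge_sign e v * (\<beta> e v * edge_trace l (proj p) e v))
        = (\<Sum>e\<in>incident_edges E v. if v = v0 then (if e = e0 then edge_trace l (proj p) e0 v0 else 0) else 0)"
        using edge_sign_square by (intro sum.cong) (auto simp: \<beta>_def simp flip: mult.assoc)
      then show ?thesis using e0 by simp
    qed
    ultimately show ?thesis by simp
  qed
  have "proj p \<in> H1_0 E l"
    unfolding H1_0_def using H1_networkI[OF proj_in d] continuity boundary by blast
  with d show ?thesis by (simp add: D_0_def)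
qed

lemma zero_derivative:
  assumes "has_edge_derivative E l (proj 0) n"
  shows "n = 0"
proof -
  have "(0 - proj 0, 0) \<in> D_div" by (rule kernel_pairs)
  then have "has_edge_derivative E l (proj 0) 0"
    using bounded_linear.linear[OF bounded_linear_proj] by (simp add: D_div_def linear_0)
  then show ?thesis
    using edge_derivative_eq assms by metis
qed

lemma H_div_D_div: "u \<in> H_div E l \<longleftrightarrow> proj u = u \<and> (u, edge_derivative E l u) \<in> D_div"
proof
  assume u: "u \<in> H_div E l"
  then obtain z where z: "u \<in> L2_network E l" "has_edge_derivative E l u z"
    by (auto simp: H_div_def H1_network_def)
  then show "proj u = u \<and> (u, edge_derivative E l u) \<in> D_div"
    using u by (simp add: D_div_def proj_id edge_derivative_eq)
qed (auto simp: D_div_def)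

lemma H1_0_D_0: "p \<in> H1_0 E l \<longleftrightarrow> proj p = p \<and> (p, edge_derivative E l p) \<in> D_0"
proof
  assume p: "p \<in> H1_0 E l"
  then obtain z where z: "p \<in> L2_network E l" "has_edge_derivative E l p z"
    by (auto simp: H1_0_def H1_network_def)
  then show "proj p = p \<and> (p, edge_derivative E l p) \<in> D_0"
    using p by (simp add: D_0_def proj_id edge_derivative_eq)
qed (auto simp: D_0_def)

lemma D_divD: "(u, r) \<in> D_div \<Longrightarrow> proj u \<in> H_div E l \<and> edge_derivative E l (proj u) = r \<and> proj r = r"
  by (auto simp: D_div_def edge_derivative_eq has_edge_derivative_def proj_id)

lemma D_0D: "(p, q) \<in> D_0 \<Longrightarrow> proj p \<in> H1_0 E l \<and> edge_derivative E l (proj p) = q \<and> proj q = q"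
  by (auto simp: D_0_def edge_derivative_eq has_edge_derivative_def proj_id)

lemma D_proj: "(proj u, r) \<in> D_div \<longleftrightarrow> (u, r) \<in> D_div" "(proj p, q) \<in> D_0 \<longleftrightarrow> (p, q) \<in> D_0"
  by (simp_all add: D_div_def D_0_def)

end

section \<open>The evolution problem\<close>

lemma time_derivative_eq:
  assumes "0 < T" "t \<in> {0..T}" "(u has_vector_derivative u') (at t within {0..T})"
  shows "time_derivative T u t = u'"
  unfolding time_derivative_def
  using vector_derivative_within_cbox[of 0 T t u u'] assms by (simp add: box_real)

lemma time_derivative_works:
  "u differentiable (at t within {0..T}) \<Longrightarrow> (u has_vector_derivative time_derivative T u t) (at t within {0..T})"
  by (simp add: time_derivative_def vector_derivative_works)

text \<open>Provides the continuous representative C + prim F 0 with a bound for its initial value.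
  For almost every t the constant is the difference of f t and a primitive of norm at most J, so
  integrating over (0, T) gives T norm C \<le> I + T J.\<close>

lemma W11_primitive:
  fixes f :: "real \<Rightarrow> 'v::finite network_fun"
  assumes T: "0 < T" and f: "f \<in> W11_L2 E l T"
  obtains C F where "AE t in lborel. t \<in> {0<..<T} \<longrightarrow> f t = C + prim F 0 t" "integrable lborel F"
    "norm C \<le> (1 / T + 1) * W11_norm T f" "(LINT t|lborel. norm (F t)) \<le> W11_norm T f"
proof -
  \<comment> \<open>The same choice of a weak derivative as in \<open>W11_norm\<close>, so its
    integral is a summand of that norm.\<close>
  define g where "g = (SOME g. has_weak_derivative f g 0 T)"
  have "\<exists>g. has_weak_derivative f g 0 T" using f by (simp add: W11_L2_def)
  then have g: "has_weak_derivative f g 0 T" unfolding g_def by (rule someI_ex)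
  obtain C where C: "AE t in lborel. t \<in> {0<..<T} \<longrightarrow> f t = C + prim g 0 t"
    by (rule has_weak_derivative_imp_prim[OF T g])
  define F where "F t = indicator {0<..<T} t *\<^sub>R g t" for t
  have F: "integrable lborel F" using g by (simp add: has_weak_derivative_def set_integrable_def F_def[abs_def])
  have fi: "integrable lborel (\<lambda>t. indicator {0<..<T} t *\<^sub>R f t)"
    using g by (simp add: has_weak_derivative_def set_integrable_def)
  have CF: "AE t in lborel. t \<in> {0<..<T} \<longrightarrow> f t = C + prim F 0 t"
    using C by eventually_elim (simp add: F_def[abs_def] prim_indicator)
  have nF: "(LINT t|lborel. norm (F t)) = (LINT t:{0<..<T}|lborel. norm (g t))"
    by (simp add: set_lebesgue_integral_def F_def)
  define I J where "I = (LINT t:{0<..<T}|lborel. norm (f t))" and "J = (LINT t|lborel. norm (F t))"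
  have W: "W11_norm T f = I + J"
    by (simp add: W11_norm_def I_def J_def nF g_def)
  have I0: "0 \<le> I" and J0: "0 \<le> J" by (simp_all add: I_def J_def set_lebesgue_integral_def)
  have ind: "integrable lborel (\<lambda>t. indicator {0<..<T} t * k)" for k :: real
    using T by (intro integrable_mult_left integrable_real_indicator) auto
  have "T * norm C = (LINT t|lborel. indicator {0<..<T} t * norm C)" using T by simp
  also have "\<dots> \<le> (LINT t|lborel. norm (indicator {0<..<T} t *\<^sub>R f t) + indicator {0<..<T} t * J)"
  proof (rule integral_mono_AE[OF ind Bochner_Integration.integrable_add[OF integrable_norm[OF fi] ind]])
    show "AE t in lborel. indicator {0<..<T} t * norm C \<le> norm (indicator {0<..<T} t *\<^sub>R f t) + indicator {0<..<T} t * J"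
      using CF
    proof eventually_elim
      case (elim t)
      show ?case
      proof (cases "t \<in> {0<..<T}")
        case True
        then have "C = f t - prim F 0 t" using elim by simp
        then have "norm C \<le> norm (f t) + norm (prim F 0 t)" by (simp add: norm_triangle_ineq4)
        then show ?thesis using norm_prim_le[OF F, of 0 t] True by (simp add: J_def)
      qed simp
    qed
  qed
  also have "\<dots> = I + T * J"
    unfolding Bochner_Integration.integral_add[OF integrable_norm[OF fi] ind]
    using T by (simp add: I_def set_lebesgue_integral_def)
  finally have "norm C \<le> (I + T * J) / T" using T by (simp add: pos_le_divide_eq mult.commute)
  also have "\<dots> \<le> (1 / T + 1) * W11_norm T f"
    using T I0 J0 by (simp add: W field_simps)
  finally have "norm C \<le> (1 / T + 1) * W11_norm T f" .
  moreover have "J \<le> W11_norm T f" using I0 by (simp add: W)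
  ultimately show thesis using that[OF CF F] by (simp add: J_def)
qed

lemma W11_norm_nonneg: "0 \<le> W11_norm T f"
  unfolding W11_norm_def set_lebesgue_integral_def by (intro add_nonneg_nonneg Bochner_Integration.integral_nonneg) auto

lemma H1_norm_bounds:
  "norm w \<le> H1_norm E l w" "norm (edge_derivative E l w) \<le> H1_norm E l w"
  "H1_norm E l w \<le> norm w + norm (edge_derivative E l w)" "0 \<le> H1_norm E l w"
  by (simp_all add: H1_norm_def real_le_rsqrt sqrt_sum_squares_le_sum)

locale network_system = network E l
  for E :: "('v::finite \<times> 'v) set" and l +
  fixes a b c :: "'v network_fun" and C0 C1 :: real
  assumes bounds: "bounded_between E l C0 C1 a" "bounded_between E l C0 C1 b" "bounded_between E l C0 C1 c"
    and C0: "0 < C0"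
begin

text \<open>
  Outside the edges the coefficients vanish. Truncating them makes the multiplication operators
  invertible on the whole space without changing them on the network.
\<close>

definition truncated :: "'v network_fun \<Rightarrow> 'v \<times> 'v \<Rightarrow> real \<Rightarrow> real" where
  "truncated w e x = max C0 (min (max C0 C1) (rep_L2 (w $ e) x))"

text \<open>The upper bound is \<open>max C0 C1\<close> because the bounds on the coefficients only
  imply C0 \<le> C1 if there is an edge.\<close>

lemma truncated_bounds: "C0 \<le> truncated w e x" "truncated w e x \<le> max C0 C1"
  by (auto simp: truncated_def)

lemma truncated_measurable [measurable]: "truncated w e \<in> borel_measurable borel"
  unfolding truncated_def by measurable

lemma truncated_bounded_borel:
  "bounded_borel (max C0 C1) (truncated w e)" "bounded_borel (1 / C0) (\<lambda>x. 1 / truncated w e x)"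
proof -
  have p: "0 < truncated w e x" for x using truncated_bounds(1)[of w e x] C0 by simp
  show "bounded_borel (max C0 C1) (truncated w e)"
    unfolding bounded_borel_def using truncated_bounds(2)[of w e] p by (auto simp: abs_of_pos)
  show "bounded_borel (1 / C0) (\<lambda>x. 1 / truncated w e x)"
    unfolding bounded_borel_def
  proof (intro conjI allI)
    show "(\<lambda>x. 1 / truncated w e x) \<in> borel_measurable borel" by measurable
    show "\<bar>1 / truncated w e x\<bar> \<le> 1 / C0" for x
      using truncated_bounds(1)[of w e x] p[of x] C0 by (simp add: frac_le)
  qed
qed

definition coeff :: "'v network_fun \<Rightarrow> 'v network_fun \<Rightarrow> 'v network_fun" where
  "coeff w = mult_net (truncated w)"

definition coeff_inv :: "'v network_fun \<Rightarrow> 'v network_fun \<Rightarrow> 'v network_fun" where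
  "coeff_inv w = mult_net (\<lambda>e x. 1 / truncated w e x)"

lemma coeff_linear: "bounded_linear (coeff w)" "bounded_linear (coeff_inv w)"
  unfolding coeff_def coeff_inv_def
  by (rule bounded_linear_mult_net[OF truncated_bounded_borel(1)], rule bounded_linear_mult_net[OF truncated_bounded_borel(2)])

lemma norm_coeff: "norm (coeff w u) \<le> max C0 C1 * norm u"
  unfolding coeff_def by (rule norm_mult_net[OF truncated_bounded_borel(1)])

lemma coeff_inverse: "coeff w (coeff_inv w u) = u"
proof -
  have "(\<lambda>e x. truncated w e x * (1 / truncated w e x)) = (\<lambda>e x. 1)"
  proof (intro ext)
    fix e x show "truncated w e x * (1 / truncated w e x) = 1"
      using truncated_bounds(1)[of w e x] C0 by simp
  qed
  then show ?thesis
    unfolding coeff_def coeff_inv_def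
    by (simp only: mult_net_mult[OF truncated_bounded_borel] mult_net_one)
qed

text \<open>Multiplications commute, so a solution on the whole space can be projected to the
  network without disturbing the equations.\<close>

lemma proj_coeff: "proj (coeff w u) = coeff w (proj u)"
  unfolding proj_def coeff_def
  by (simp only: mult_net_mult[OF truncated_bounded_borel(1) proj_bounded_borel]
      mult_net_mult[OF proj_bounded_borel truncated_bounded_borel(1)] mult.commute)

lemma AE_rep_coeff:
  assumes "bounded_between E l C0 C1 w" "e \<in> E"
  shows "AE x in lborel. x \<in> {0..l e} \<longrightarrow> rep_L2 (coeff w u $ e) x = rep_L2 (w $ e) x * rep_L2 (u $ e) x"
proof -
  have "AE x in lborel. x \<in> {0..l e} \<longrightarrow> C0 \<le> rep_L2 (w $ e) x \<and> rep_L2 (w $ e) x \<le> C1"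
    using assms unfolding bounded_between_def by blast
  then show ?thesis
    using AE_rep_mult[OF truncated_bounded_borel(1)[of w e], of "u $ e"]
    by eventually_elim (auto simp: coeff_def truncated_def)
qed

sublocale damped_system D_div D_0 "coeff a" "coeff b" "coeff c" "coeff_inv b" "coeff_inv c" C0 "max C0 C1"
proof (intro damped_system.intro skew_adjoint_pair.intro damped_system_axioms.intro)
  show "((u, r) \<in> D_div) = (\<forall>(p, q)\<in>D_0. inner u q + inner r p = 0)" for u r
    using pairing_D[of u r] adjoint_in_D_div[of u r] by blast
  show "((p, q) \<in> D_0) = (\<forall>(u, r)\<in>D_div. inner u q + inner r p = 0)" for p q
    using pairing_D[of _ _ p q] adjoint_in_D_0[of q p] by blast
  show "n = 0" if "(0, n) \<in> D_div" for n using that zero_derivative by (simp add: D_div_def)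
  show "n = 0" if "(0, n) \<in> D_0" for n using that zero_derivative by (simp add: D_0_def)
  have sym: "inner (coeff w x) y = inner x (coeff w y)" for w x y
    unfolding coeff_def by (rule inner_mult_net_commute[OF truncated_bounded_borel(1)])
  show "inner (coeff a x) y = inner x (coeff a y)" "inner (coeff b x) y = inner x (coeff b y)"
    "inner (coeff c x) y = inner x (coeff c y)" for x y by (rule sym)+
  have lower: "C0 * inner x x \<le> inner (coeff w x) x" and upper: "inner (coeff w x) x \<le> max C0 C1 * inner x x" for w x
    unfolding coeff_def
    by (rule inner_mult_net_bounds[OF truncated_bounded_borel(1)[of w]], rule truncated_bounds)+
  show "C0 * inner x x \<le> inner (coeff b x) x" "C0 * inner x x \<le> inner (coeff c x) x" for x by (rule lower)+
  show "inner (coeff b x) x \<le> max C0 C1 * inner x x" "inner (coeff c x) x \<le> max C0 C1 * inner x x" for x by (rule upper)+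
  show "0 \<le> inner (coeff a x) x" for x
    using lower[of x a] C0 by (meson inner_ge_zero less_imp_le mult_nonneg_nonneg order_trans)
  show "0 < C0" "0 < max C0 C1" using C0 by auto
qed (rule coeff_linear coeff_inverse)+

lemma eq_proj_iff:
  assumes "proj z = z"
  shows "z = proj f \<longleftrightarrow> (\<forall>e\<in>E. AE x in lborel. x \<in> {0..l e} \<longrightarrow> rep_L2 (z $ e) x = rep_L2 (f $ e) x)"
proof
  assume z: "z = proj f"
  show "\<forall>e\<in>E. AE x in lborel. x \<in> {0..l e} \<longrightarrow> rep_L2 (z $ e) x = rep_L2 (f $ e) x"
  proof
    fix e assume "e \<in> E"
    from AE_rep_proj[OF this, of f] show "AE x in lborel. x \<in> {0..l e} \<longrightarrow> rep_L2 (z $ e) x = rep_L2 (f $ e) x"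
      unfolding z by eventually_elim simp
  qed
next
  assume z: "\<forall>e\<in>E. AE x in lborel. x \<in> {0..l e} \<longrightarrow> rep_L2 (z $ e) x = rep_L2 (f $ e) x"
  have "proj z = proj f"
  proof (rule L2_network_eqI[OF proj_in proj_in])
    fix e assume e: "e \<in> E"
    from z e have "AE x in lborel. x \<in> {0..l e} \<longrightarrow> rep_L2 (z $ e) x = rep_L2 (f $ e) x" by blast
    with AE_rep_proj[OF e, of f] AE_rep_proj[OF e, of z]
    show "AE x in lborel. x \<in> {0<..<l e} \<longrightarrow> rep_L2 (proj z $ e) x = rep_L2 (proj f $ e) x"
      by eventually_elim auto
  qed
  then show "z = proj f" by (simp add: assms)
qed

text \<open>Passes between the pointwise system and two equations between vectors. The sources occur
  through \<open>proj\<close> because the pointwise system only sees their values on the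
  edges.\<close>

lemma equations_iff:
  assumes "proj u' = u'" "proj p' = p'" "proj u = u" "proj q = q" "proj r = r"
  shows "(\<forall>e\<in>E. AE x in lborel. x \<in> {0..l e} \<longrightarrow>
      rep_L2 (c $ e) x * rep_L2 (u' $ e) x + rep_L2 (q $ e) x + rep_L2 (a $ e) x * rep_L2 (u $ e) x = rep_L2 (f $ e) x \<and>
      rep_L2 (b $ e) x * rep_L2 (p' $ e) x + rep_L2 (r $ e) x = rep_L2 (g $ e) x)
    \<longleftrightarrow> coeff c u' + q + coeff a u = proj f \<and> coeff b p' + r = proj g"
    (is "?L \<longleftrightarrow> _")
proof -
  let ?z = "coeff c u' + q + coeff a u" and ?y = "coeff b p' + r"
  have z: "AE x in lborel. x \<in> {0..l e} \<longrightarrow> rep_L2 (?z $ e) x =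
      rep_L2 (c $ e) x * rep_L2 (u' $ e) x + rep_L2 (q $ e) x + rep_L2 (a $ e) x * rep_L2 (u $ e) x" if e: "e \<in> E" for e
    using AE_rep_coeff[OF bounds(3) e, of u'] AE_rep_coeff[OF bounds(1) e, of u]
      AE_rep_plus[of "coeff c u' $ e" "q $ e"] AE_rep_plus[of "coeff c u' $ e + q $ e" "coeff a u $ e"]
    by eventually_elim simp
  have y: "AE x in lborel. x \<in> {0..l e} \<longrightarrow> rep_L2 (?y $ e) x =
      rep_L2 (b $ e) x * rep_L2 (p' $ e) x + rep_L2 (r $ e) x" if e: "e \<in> E" for e
    using AE_rep_coeff[OF bounds(2) e, of p'] AE_rep_plus[of "coeff b p' $ e" "r $ e"]
    by eventually_elim simp
  have lin: "linear proj" using bounded_linear_proj by (rule bounded_linear.linear)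
  have fixed: "proj ?z = ?z" "proj ?y = ?y"
    using assms by (simp_all add: linear_add[OF lin] proj_coeff)
  have "?L \<longleftrightarrow> (\<forall>e\<in>E. (AE x in lborel. x \<in> {0..l e} \<longrightarrow> rep_L2 (?z $ e) x = rep_L2 (f $ e) x) \<and>
      (AE x in lborel. x \<in> {0..l e} \<longrightarrow> rep_L2 (?y $ e) x = rep_L2 (g $ e) x))"
  proof (intro ball_cong refl iffI conjI)
    fix e assume e: "e \<in> E"
    assume eq: "AE x in lborel. x \<in> {0..l e} \<longrightarrow>
      rep_L2 (c $ e) x * rep_L2 (u' $ e) x + rep_L2 (q $ e) x + rep_L2 (a $ e) x * rep_L2 (u $ e) x = rep_L2 (f $ e) x \<and>
      rep_L2 (b $ e) x * rep_L2 (p' $ e) x + rep_L2 (r $ e) x = rep_L2 (g $ e) x"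
    show "AE x in lborel. x \<in> {0..l e} \<longrightarrow> rep_L2 (?z $ e) x = rep_L2 (f $ e) x"
      using eq z[OF e] by eventually_elim metis
    show "AE x in lborel. x \<in> {0..l e} \<longrightarrow> rep_L2 (?y $ e) x = rep_L2 (g $ e) x"
      using eq y[OF e] by eventually_elim metis
  next
    fix e assume e: "e \<in> E"
    assume "(AE x in lborel. x \<in> {0..l e} \<longrightarrow> rep_L2 (?z $ e) x = rep_L2 (f $ e) x) \<and>
      (AE x in lborel. x \<in> {0..l e} \<longrightarrow> rep_L2 (?y $ e) x = rep_L2 (g $ e) x)"
    then have "AE x in lborel. x \<in> {0..l e} \<longrightarrow> rep_L2 (?z $ e) x = rep_L2 (f $ e) x"
      "AE x in lborel. x \<in> {0..l e} \<longrightarrow> rep_L2 (?y $ e) x = rep_L2 (g $ e) x" by blast+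
    then show "AE x in lborel. x \<in> {0..l e} \<longrightarrow>
      rep_L2 (c $ e) x * rep_L2 (u' $ e) x + rep_L2 (q $ e) x + rep_L2 (a $ e) x * rep_L2 (u $ e) x = rep_L2 (f $ e) x \<and>
      rep_L2 (b $ e) x * rep_L2 (p' $ e) x + rep_L2 (r $ e) x = rep_L2 (g $ e) x"
      using z[OF e] y[OF e] by eventually_elim metis
  qed
  also have "\<dots> \<longleftrightarrow> ?z = proj f \<and> ?y = proj g"
    unfolding eq_proj_iff[OF fixed(1)] eq_proj_iff[OF fixed(2)] by blast
  finally show ?thesis .
qed

section \<open>Solutions in terms of the abstract relations, and uniqueness\<close>

lemma proj_time_derivative:
  assumes "0 < T" "t \<in> {0..T}" "\<And>s. s \<in> {0..T} \<Longrightarrow> proj (u s) = u s" "u differentiable (at t within {0..T})"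
  shows "proj (time_derivative T u t) = time_derivative T u t"
proof -
  have "((\<lambda>s. proj (u s)) has_vector_derivative proj (time_derivative T u t)) (at t within {0..T})"
    by (rule bounded_linear.has_vector_derivative[OF bounded_linear_proj time_derivative_works[OF assms(4)]])
  then have "(u has_vector_derivative proj (time_derivative T u t)) (at t within {0..T})"
    by (rule has_vector_derivative_transform[rotated 2]) (use assms in auto)
  from time_derivative_eq[OF assms(1,2) this] show ?thesis by simp
qed

lemma solution_spaceD:
  assumes "0 < T" "(u, p) \<in> solution_space E l T"
  shows "continuous_on {0..T} (time_derivative T u)" "continuous_on {0..T} (time_derivative T p)"
    and "t \<in> {0..T} \<Longrightarrow> (u has_vector_derivative time_derivative T u t) (at t within {0..T})"
    and "t \<in> {0..T} \<Longrightarrow> (p has_vector_derivative time_derivative T p t) (at t within {0..T})"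
    and "t \<in> {0..T} \<Longrightarrow> proj (u t) = u t \<and> (u t, edge_derivative E l (u t)) \<in> D_div"
    and "t \<in> {0..T} \<Longrightarrow> proj (p t) = p t \<and> (p t, edge_derivative E l (p t)) \<in> D_0"
    and "t \<in> {0..T} \<Longrightarrow> proj (time_derivative T u t) = time_derivative T u t"
    and "t \<in> {0..T} \<Longrightarrow> proj (time_derivative T p t) = time_derivative T p t"
proof -
  have 1: "\<forall>t\<in>{0..T}. u differentiable (at t within {0..T}) \<and> p differentiable (at t within {0..T})"
    "\<forall>t\<in>{0..T}. u t \<in> H_div E l \<and> p t \<in> H1_0 E l"
    "continuous_on {0..T} (time_derivative T u)" "continuous_on {0..T} (time_derivative T p)"
    using assms(2) by (simp_all add: solution_space_def)
  show "continuous_on {0..T} (time_derivative T u)" "continuous_on {0..T} (time_derivative T p)" by (rule 1)+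
  have 2: "\<forall>t\<in>{0..T}. proj (u t) = u t \<and> (u t, edge_derivative E l (u t)) \<in> D_div"
    "\<forall>t\<in>{0..T}. proj (p t) = p t \<and> (p t, edge_derivative E l (p t)) \<in> D_0"
    using 1(2) H_div_D_div H1_0_D_0 by blast+
  assume t: "t \<in> {0..T}"
  show "(u has_vector_derivative time_derivative T u t) (at t within {0..T})"
    "(p has_vector_derivative time_derivative T p t) (at t within {0..T})"
    using 1(1) t by (blast intro: time_derivative_works)+
  show "proj (u t) = u t \<and> (u t, edge_derivative E l (u t)) \<in> D_div"
    "proj (p t) = p t \<and> (p t, edge_derivative E l (p t)) \<in> D_0"
    using 2 t by blast+
  show "proj (time_derivative T u t) = time_derivative T u t" "proj (time_derivative T p t) = time_derivative T p t"
    using 1(1) 2 t by (auto intro: proj_time_derivative[OF assms(1)])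
qed

lemma is_solution_equations:
  assumes T: "0 < T" and sol: "is_solution E l T a b c u0 p0 f g u p"
  shows "AE t in lborel. t \<in> {0<..<T} \<longrightarrow>
    coeff c (time_derivative T u t) + edge_derivative E l (p t) + coeff a (u t) = proj (f t) \<and>
    coeff b (time_derivative T p t) + edge_derivative E l (u t) = proj (g t)"
proof -
  have ss: "(u, p) \<in> solution_space E l T" using sol by (simp add: is_solution_def)
  note s = solution_spaceD[OF T ss]
  have "AE t in lborel. t \<in> {0<..<T} \<longrightarrow>
        (\<forall>e\<in>E. AE x in lborel. x \<in> {0..l e} \<longrightarrow>
           rep_L2 (c $ e) x * rep_L2 (time_derivative T u t $ e) x +
             rep_L2 (edge_derivative E l (p t) $ e) x + rep_L2 (a $ e) x * rep_L2 (u t $ e) x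
             = rep_L2 (f t $ e) x \<and>
           rep_L2 (b $ e) x * rep_L2 (time_derivative T p t $ e) x +
             rep_L2 (edge_derivative E l (u t) $ e) x = rep_L2 (g t $ e) x)"
    using sol unfolding is_solution_def by blast
  then show ?thesis
  proof eventually_elim
    case (elim t)
    show ?case
    proof
      assume t: "t \<in> {0<..<T}"
      then have t': "t \<in> {0..T}" by simp
      have "proj (edge_derivative E l (p t)) = edge_derivative E l (p t)" "proj (edge_derivative E l (u t)) = edge_derivative E l (u t)"
        using D_0D s(6)[OF t'] D_divD s(5)[OF t'] by blast+
      from equations_iff[OF s(7)[OF t'] s(8)[OF t'] _ this] elim t s(5)[OF t']
      show "coeff c (time_derivative T u t) + edge_derivative E l (p t) + coeff a (u t) = proj (f t) \<and>
        coeff b (time_derivative T p t) + edge_derivative E l (u t) = proj (g t)"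
        by blast
    qed
  qed
qed

text \<open>The sources cancel in the difference of two solutions, so the difference and its time
  derivative lie in the graph of the generator for almost every t, and
  \<open>energy_uniqueness\<close> applies.\<close>

lemma solution_unique:
  assumes T: "0 < T" and sol: "is_solution E l T a b c u0 p0 f g u p" "is_solution E l T a b c u0 p0 f g v q"
    and t: "t \<in> {0..T}"
  shows "v t = u t \<and> q t = p t"
proof -
  have ss: "(u, p) \<in> solution_space E l T" "(v, q) \<in> solution_space E l T"
    using sol by (simp_all add: is_solution_def)
  note s1 = solution_spaceD[OF T ss(1)] and s2 = solution_spaceD[OF T ss(2)]
  define w where "w t = (v t - u t, q t - p t)" for t
  define w' where "w' t = (time_derivative T v t - time_derivative T u t, time_derivative T q t - time_derivative T p t)" for t
  have "w t = 0"
  proof (rule energy_uniqueness[where w'=w' and T=T])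
    show "(w has_vector_derivative w' t) (at t within {0..T})" if "t \<in> {0..T}" for t
      unfolding w_def w'_def using s1(3,4)[OF that] s2(3,4)[OF that]
      by (intro has_vector_derivative_Pair has_vector_derivative_diff)
    show "continuous_on {0..T} w'"
      unfolding w'_def by (intro continuous_intros s1(1,2) s2(1,2))
    show "w 0 = 0" using sol by (simp add: w_def is_solution_def zero_prod_def)
    show "t \<in> {0..T}" by (rule t)
    show "AE t in lborel. t \<in> {0<..<T} \<longrightarrow> (w t, w' t) \<in> gen"
      using is_solution_equations[OF T sol(1)] is_solution_equations[OF T sol(2)]
    proof eventually_elim
      case (elim t)
      show ?case
      proof
        assume t: "t \<in> {0<..<T}"
        then have t': "t \<in> {0..T}" by simp
        let ?r = "edge_derivative E l (v t) - edge_derivative E l (u t)" and ?q = "edge_derivative E l (q t) - edge_derivative E l (p t)"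
        have D: "(v t - u t, ?r) \<in> D_div" "(q t - p t, ?q) \<in> D_0"
          using subspace_diff[OF subspace_D1, of "(v t, edge_derivative E l (v t))" "(u t, edge_derivative E l (u t))"]
            subspace_diff[OF swap.subspace_D1, of "(q t, edge_derivative E l (q t))" "(p t, edge_derivative E l (p t))"]
            s1(5,6)[OF t'] s2(5,6)[OF t'] by auto
        have e: "coeff c (time_derivative T u t) + edge_derivative E l (p t) + coeff a (u t) = proj (f t)"
          "coeff b (time_derivative T p t) + edge_derivative E l (u t) = proj (g t)"
          "coeff c (time_derivative T v t) + edge_derivative E l (q t) + coeff a (v t) = proj (f t)"
          "coeff b (time_derivative T q t) + edge_derivative E l (v t) = proj (g t)"
          using elim t by blast+
        have "?r = - coeff b (time_derivative T q t - time_derivative T p t)"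
          using e(2,4) lin(2) by (simp add: linear_diff algebra_simps eq_diff_eq)
        moreover have "?q = - coeff c (time_derivative T v t - time_derivative T u t) - coeff a (v t - u t)"
        proof -
          have "edge_derivative E l (q t) = proj (f t) - coeff c (time_derivative T v t) - coeff a (v t)"
            "edge_derivative E l (p t) = proj (f t) - coeff c (time_derivative T u t) - coeff a (u t)"
            using e(1,3) by (simp_all add: algebra_simps)
          then show ?thesis using lin(1,3) by (simp add: linear_diff)
        qed
        ultimately show "(w t, w' t) \<in> gen" using D by (simp add: gen_def w_def w'_def)
      qed
    qed
  qed
  then show ?thesis by (simp add: w_def zero_prod_def)
qed

end

context network_system
begin

text \<open>The abstract theorem bounds the time derivatives. Integrating them bounds the functions,
  and the equations themselves bound the edge derivatives and show that these depend continuously on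
  time.\<close>

lemma solution_exists:
  assumes T: "0 < T"
  shows "\<exists>K. \<forall>u0\<in>H_div E l. \<forall>p0\<in>H1_0 E l. \<forall>f\<in>W11_L2 E l T. \<forall>g\<in>W11_L2 E l T.
    \<exists>u p. is_solution E l T a b c u0 p0 f g u p \<and>
      solution_norm E l T u p \<le> K * (H1_norm E l u0 + H1_norm E l p0 + W11_norm T f + W11_norm T g)"
proof -
  obtain K where K: "0 \<le> K" and sol: "\<And>u0 r0 p0 q0 f0 g0 F G. (u0, r0) \<in> D_div \<Longrightarrow> (p0, q0) \<in> D_0 \<Longrightarrow>
    integrable lborel F \<Longrightarrow> integrable lborel G \<Longrightarrow>
    \<exists>u u' p p'. u 0 = u0 \<and> p 0 = p0 \<and> continuous_on UNIV u' \<and> continuous_on UNIV p' \<and>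
      (\<forall>t\<ge>0. (u has_vector_derivative u' t) (at t within {0..}) \<and>
        (p has_vector_derivative p' t) (at t within {0..}) \<and>
        (u t, g0 + prim G 0 t - coeff b (p' t)) \<in> D_div \<and>
        (p t, f0 + prim F 0 t - coeff c (u' t) - coeff a (u t)) \<in> D_0) \<and>
      (\<forall>t. norm (u' t, p' t) \<le> K * (norm u0 + norm r0 + norm q0 + norm f0 + norm g0 +
         (LINT s|lborel. norm (F s)) + (LINT s|lborel. norm (G s))))"
    using inhomogeneous_solution by blast
  define C2 where "C2 = max C0 C1"
  \<comment> \<open>The bound for the initial value of a source contributes 1 / T + 1 and the
    integral of its derivative 1. The resulting k \<ge> 2 also absorbs the two bounds by the norm of
    u0.\<close>
  define k where "k = 2 + 1 / T"
  have k: "0 \<le> k" using T by (simp add: k_def)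
  \<comment> \<open>The three brackets bound the three suprema in \<open>solution_norm\<close>, with
    \<open>B\<close> written as K k N and one factor N taken out.\<close>
  define K' where "K' = (2 + 2 * T * (K * k)) + 2 * (K * k) +
    (2 + 2 * T * (K * k) + 2 * k + 2 * C2 * (K * k) + C2 * (1 + T * (K * k)))"
  show ?thesis
  proof (intro exI[of _ K'] ballI)
    fix u0 p0 :: "'v network_fun" and f g :: "real \<Rightarrow> 'v network_fun"
    assume u0: "u0 \<in> H_div E l" and p0: "p0 \<in> H1_0 E l" and f: "f \<in> W11_L2 E l T" and g: "g \<in> W11_L2 E l T"
    define N where "N = H1_norm E l u0 + H1_norm E l p0 + W11_norm T f + W11_norm T g"
    have N: "0 \<le> N" "H1_norm E l u0 \<le> N" "H1_norm E l p0 \<le> N"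
      using H1_norm_bounds(4)[of E l u0] H1_norm_bounds(4)[of E l p0] W11_norm_nonneg[of T f] W11_norm_nonneg[of T g]
      by (auto simp: N_def)
    obtain f0 F where F: "AE t in lborel. t \<in> {0<..<T} \<longrightarrow> f t = f0 + prim F 0 t" "integrable lborel F"
      "norm f0 \<le> (1 / T + 1) * W11_norm T f" "(LINT t|lborel. norm (F t)) \<le> W11_norm T f"
      by (rule W11_primitive[OF T f])
    obtain g0 G where G: "AE t in lborel. t \<in> {0<..<T} \<longrightarrow> g t = g0 + prim G 0 t" "integrable lborel G"
      "norm g0 \<le> (1 / T + 1) * W11_norm T g" "(LINT t|lborel. norm (G t)) \<le> W11_norm T g"
      by (rule W11_primitive[OF T g])
    have fk: "norm f0 + (LINT t|lborel. norm (F t)) \<le> k * W11_norm T f"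
      "norm g0 + (LINT t|lborel. norm (G t)) \<le> k * W11_norm T g"
      using F(3,4) G(3,4) by (simp_all add: k_def algebra_simps)
    have data: "(u0, edge_derivative E l u0) \<in> D_div" "(p0, edge_derivative E l p0) \<in> D_0" "proj u0 = u0" "proj p0 = p0"
      using u0 p0 H_div_D_div H1_0_D_0 by blast+
    define R where "R = norm u0 + norm (edge_derivative E l u0) + norm (edge_derivative E l p0) + norm f0 + norm g0 +
         (LINT s|lborel. norm (F s)) + (LINT s|lborel. norm (G s))"
    have "R \<le> 2 * H1_norm E l u0 + H1_norm E l p0 + k * W11_norm T f + k * W11_norm T g"
      using fk H1_norm_bounds(1)[of u0 E l] H1_norm_bounds(2)[of E l u0] H1_norm_bounds(2)[of E l p0] by (simp add: R_def)
    also have "\<dots> \<le> k * H1_norm E l u0 + k * H1_norm E l p0 + k * W11_norm T f + k * W11_norm T g"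
      using T H1_norm_bounds(4)[of E l u0] H1_norm_bounds(4)[of E l p0]
        mult_right_mono[of 2 k "H1_norm E l u0"] mult_right_mono[of 1 k "H1_norm E l p0"]
      by (simp add: k_def)
    finally have R: "R \<le> k * N" by (simp add: N_def algebra_simps)
    obtain u u' p p' where init: "u 0 = u0" "p 0 = p0" and cont: "continuous_on UNIV u'" "continuous_on UNIV p'"
      and ud: "\<And>t. 0 \<le> t \<Longrightarrow> (u has_vector_derivative u' t) (at t within {0..})"
      and pd: "\<And>t. 0 \<le> t \<Longrightarrow> (p has_vector_derivative p' t) (at t within {0..})"
      and uD: "\<And>t. 0 \<le> t \<Longrightarrow> (u t, g0 + prim G 0 t - coeff b (p' t)) \<in> D_div"
      and pD: "\<And>t. 0 \<le> t \<Longrightarrow> (p t, f0 + prim F 0 t - coeff c (u' t) - coeff a (u t)) \<in> D_0"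
      and bound: "\<And>t. norm (u' t, p' t) \<le> K * R"
      using sol[OF data(1,2) F(2) G(2), of g0 f0] unfolding R_def by metis
    define B where "B = K * k * N"
    have B: "norm (u' t) \<le> B" "norm (p' t) \<le> B" for t
    proof -
      have "norm (u' t, p' t) \<le> B"
        using bound[of t] mult_left_mono[OF R K] by (simp add: B_def mult.assoc)
      then show "norm (u' t) \<le> B" "norm (p' t) \<le> B"
        using norm_fst_le[of "u' t" "p' t"] norm_snd_le[of "p' t" "u' t"] by linarith+
    qed
    have B0: "0 \<le> B" using K k N by (simp add: B_def)
    \<comment> \<open>Starting from a norm of at most N, a derivative bounded by B adds at most T B
      up to time T.\<close>
    have grow: "norm (w t) \<le> N + T * B"
      if w: "\<And>t. 0 \<le> t \<Longrightarrow> (w has_vector_derivative w' t) (at t within {0..})" and w': "continuous_on UNIV w'"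
        and b: "\<And>t. norm (w' t) \<le> B" and 0: "norm (w 0) \<le> N" and t: "t \<in> {0..T}" for w w' :: "real \<Rightarrow> 'v network_fun" and t
    proof -
      have "prim w' 0 t = w t - w 0" using t by (intro prim_vector_derivative_eq[OF w' w]) auto
      moreover have "norm (prim w' 0 t) \<le> B * (t - 0)"
        using t b by (intro norm_prim_bound continuous_set_integrable_Ioo[OF w']) auto
      moreover have "B * (t - 0) \<le> T * B" using t B0 by (simp add: mult.commute mult_left_mono)
      ultimately show ?thesis using norm_triangle_sub[of "w t" "w 0"] 0 by simp
    qed
    have un: "norm (u t) \<le> N + T * B" if "t \<in> {0..T}" for t
      by (rule grow[OF ud cont(1) B(1) _ that])
        (use init N(2) H1_norm_bounds(1)[of u0 E l] in auto)
    have pn: "norm (p t) \<le> N + T * B" if "t \<in> {0..T}" for t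
      by (rule grow[OF pd cont(2) B(2) _ that])
        (use init N(3) H1_norm_bounds(1)[of p0 E l] in auto)
    define r where "r t = g0 + prim G 0 t - coeff b (p' t)" for t
    define q where "q t = f0 + prim F 0 t - coeff c (u' t) - coeff a (u t)" for t
    \<comment> \<open>The abstract solution may have a part off the network; its projection keeps
      the same edge derivatives by \<open>D_proj\<close>.\<close>
    define U where "U t = proj (u t)" for t
    define Q where "Q t = proj (p t)" for t
    have UD: "(U t, r t) \<in> D_div" "(Q t, q t) \<in> D_0" if "0 \<le> t" for t
      using uD[OF that] pD[OF that] by (simp_all add: U_def Q_def r_def q_def D_proj)
    have projUQ: "proj (U t) = U t" "proj (Q t) = Q t" for t by (simp_all add: U_def Q_def)
    have Ue: "U t \<in> H_div E l" "edge_derivative E l (U t) = r t" "proj (r t) = r t" if "0 \<le> t" for t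
      using D_divD[OF UD(1)[OF that]] by (simp_all add: projUQ)
    have Qe: "Q t \<in> H1_0 E l" "edge_derivative E l (Q t) = q t" "proj (q t) = q t" if "0 \<le> t" for t
      using D_0D[OF UD(2)[OF that]] by (simp_all add: projUQ)
    have deriv: "(U has_vector_derivative proj (u' t)) (at t within {0..T})"
      "(Q has_vector_derivative proj (p' t)) (at t within {0..T})" if t: "t \<in> {0..T}" for t
    proof -
      have "(u has_vector_derivative u' t) (at t within {0..T})" "(p has_vector_derivative p' t) (at t within {0..T})"
        using has_vector_derivative_within_subset[OF ud[of t], of "{0..T}"] has_vector_derivative_within_subset[OF pd[of t], of "{0..T}"] t
        by auto
      then show "(U has_vector_derivative proj (u' t)) (at t within {0..T})"
        "(Q has_vector_derivative proj (p' t)) (at t within {0..T})"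
        unfolding U_def Q_def by (auto intro: bounded_linear.has_vector_derivative[OF bounded_linear_proj])
    qed
    have td: "time_derivative T U t = proj (u' t)" "time_derivative T Q t = proj (p' t)" if "t \<in> {0..T}" for t
      using time_derivative_eq[OF T that] deriv[OF that] by blast+
    have cU: "continuous_on {0..T} U" "continuous_on {0..T} Q"
      using deriv[THEN has_vector_derivative_continuous] by (auto simp: continuous_on_eq_continuous_within)
    have cu: "continuous_on {0..} u"
      using ud[THEN has_vector_derivative_continuous] by (auto simp: continuous_on_eq_continuous_within)
    have cr: "continuous_on {0..T} r" "continuous_on {0..T} q"
      unfolding r_def q_def
      by (intro continuous_intros prim_continuous F(2) G(2) bounded_linear.continuous_on[OF coeff_linear(1)]
          continuous_on_subset[OF cont(1)] continuous_on_subset[OF cont(2)] continuous_on_subset[OF cu]; force)+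
    \<comment> \<open>Continuity in the stronger norm is continuity of the function together with
      its edge derivative. The latter is one of the explicit continuous functions \<open>r\<close>
      and \<open>q\<close>.\<close>
    have H1_tendsto: "((\<lambda>s. H1_norm E l (w s - w t)) \<longlongrightarrow> 0) (at t within {0..T})"
      if w: "continuous_on {0..T} w" and d: "continuous_on {0..T} d" and t: "t \<in> {0..T}"
        and e: "\<And>s. s \<in> {0..T} \<Longrightarrow> edge_derivative E l (w s - w t) = d s - d t"
      for w d :: "real \<Rightarrow> 'v network_fun" and t
    proof -
      have "((\<lambda>s. sqrt ((norm (w s - w t))\<^sup>2 + (norm (d s - d t))\<^sup>2)) \<longlongrightarrow> sqrt ((norm (w t - w t))\<^sup>2 + (norm (d t - d t))\<^sup>2)) (at t within {0..T})"
        using w d t by (intro tendsto_intros) (auto simp: continuous_on_def)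
      then have "((\<lambda>s. sqrt ((norm (w s - w t))\<^sup>2 + (norm (d s - d t))\<^sup>2)) \<longlongrightarrow> 0) (at t within {0..T})" by simp
      then show ?thesis
        by (rule Lim_transform_eventually) (auto simp: eventually_at_filter H1_norm_def e)
    qed
    have "((\<lambda>s. H1_norm E l (U s - U t)) \<longlongrightarrow> 0) (at t within {0..T})" if t: "t \<in> {0..T}" for t
    proof (rule H1_tendsto[OF cU(1) cr(1) t])
      fix s assume "s \<in> {0..T}"
      then have "(U s - U t, r s - r t) \<in> D_div"
        using subspace_diff[OF subspace_D1, of "(U s, r s)" "(U t, r t)"] UD t by simp
      from D_divD[OF this] show "edge_derivative E l (U s - U t) = r s - r t"
        using bounded_linear.linear[OF bounded_linear_proj] by (simp add: linear_diff projUQ)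
    qed
    moreover have "((\<lambda>s. H1_norm E l (Q s - Q t)) \<longlongrightarrow> 0) (at t within {0..T})" if t: "t \<in> {0..T}" for t
    proof (rule H1_tendsto[OF cU(2) cr(2) t])
      fix s assume "s \<in> {0..T}"
      then have "(Q s - Q t, q s - q t) \<in> D_0"
        using subspace_diff[OF swap.subspace_D1, of "(Q s, q s)" "(Q t, q t)"] UD t by simp
      from D_0D[OF this] show "edge_derivative E l (Q s - Q t) = q s - q t"
        using bounded_linear.linear[OF bounded_linear_proj] by (simp add: linear_diff projUQ)
    qed
    moreover have "continuous_on {0..T} (time_derivative T U)" "continuous_on {0..T} (time_derivative T Q)"
    proof -
      have "continuous_on {0..T} (\<lambda>t. proj (u' t))" "continuous_on {0..T} (\<lambda>t. proj (p' t))"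
        by (rule bounded_linear.continuous_on[OF bounded_linear_proj continuous_on_subset[OF cont(1) subset_UNIV]],
            rule bounded_linear.continuous_on[OF bounded_linear_proj continuous_on_subset[OF cont(2) subset_UNIV]])
      then show "continuous_on {0..T} (time_derivative T U)" "continuous_on {0..T} (time_derivative T Q)"
        using continuous_on_cong[OF refl td(1), of "{0..T}" "\<lambda>t. t"]
          continuous_on_cong[OF refl td(2), of "{0..T}" "\<lambda>t. t"] by simp_all
    qed
    moreover have "U differentiable (at t within {0..T})" "Q differentiable (at t within {0..T})" if "t \<in> {0..T}" for t
      by (rule differentiableI_vector[OF deriv(1)[OF that]], rule differentiableI_vector[OF deriv(2)[OF that]])
    ultimately have space: "(U, Q) \<in> solution_space E l T"
      using Ue(1) Qe(1) unfolding solution_space_def by auto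
    have eqs: "coeff c (proj (u' t)) + q t + coeff a (U t) = proj (f0 + prim F 0 t)"
      "coeff b (proj (p' t)) + r t = proj (g0 + prim G 0 t)" if "0 \<le> t" for t
    proof -
      have lp: "linear proj" using bounded_linear_proj by (rule bounded_linear.linear)
      have "q t + coeff c (u' t) + coeff a (u t) = f0 + prim F 0 t" by (simp add: q_def)
      from arg_cong[OF this, of proj] Qe(3)[OF that]
      show "coeff c (proj (u' t)) + q t + coeff a (U t) = proj (f0 + prim F 0 t)"
        by (simp add: linear_add[OF lp] proj_coeff U_def algebra_simps)
      have "r t + coeff b (p' t) = g0 + prim G 0 t" by (simp add: r_def)
      from arg_cong[OF this, of proj] Ue(3)[OF that]
      show "coeff b (proj (p' t)) + r t = proj (g0 + prim G 0 t)"
        by (simp add: linear_add[OF lp] proj_coeff algebra_simps)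
    qed
    have "is_solution E l T a b c u0 p0 f g U Q"
      unfolding is_solution_def
    proof (intro conjI space)
      show "U 0 = u0" "Q 0 = p0" by (simp_all add: U_def Q_def init data)
      show "AE t in lborel. t \<in> {0<..<T} \<longrightarrow>
        (\<forall>e\<in>E. AE x in lborel. x \<in> {0..l e} \<longrightarrow>
           rep_L2 (c $ e) x * rep_L2 (time_derivative T U t $ e) x +
             rep_L2 (edge_derivative E l (Q t) $ e) x + rep_L2 (a $ e) x * rep_L2 (U t $ e) x
             = rep_L2 (f t $ e) x \<and>
           rep_L2 (b $ e) x * rep_L2 (time_derivative T Q t $ e) x +
             rep_L2 (edge_derivative E l (U t) $ e) x = rep_L2 (g t $ e) x)"
        using F(1) G(1)
      proof eventually_elim
        case (elim t)
        show ?case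
        proof
          assume t: "t \<in> {0<..<T}"
          then have t': "t \<in> {0..T}" "0 \<le> t" by simp_all
          have "f t = f0 + prim F 0 t" "g t = g0 + prim G 0 t" using elim t by blast+
          then have "coeff c (proj (u' t)) + q t + coeff a (U t) = proj (f t) \<and> coeff b (proj (p' t)) + r t = proj (g t)"
            using eqs[OF t'(2)] by simp
          then show "\<forall>e\<in>E. AE x in lborel. x \<in> {0..l e} \<longrightarrow>
           rep_L2 (c $ e) x * rep_L2 (time_derivative T U t $ e) x +
             rep_L2 (edge_derivative E l (Q t) $ e) x + rep_L2 (a $ e) x * rep_L2 (U t $ e) x
             = rep_L2 (f t $ e) x \<and>
           rep_L2 (b $ e) x * rep_L2 (time_derivative T Q t $ e) x +
             rep_L2 (edge_derivative E l (U t) $ e) x = rep_L2 (g t $ e) x"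
            unfolding td[OF t'(1)] Ue(2)[OF t'(2)] Qe(2)[OF t'(2)]
            by (intro equations_iff[THEN iffD2] proj_proj projUQ Ue(3)[OF t'(2)] Qe(3)[OF t'(2)])
        qed
      qed
    qed
    moreover have "solution_norm E l T U Q \<le> K' * N"
    proof -
      have T0: "{0..T} \<noteq> {}" using T by simp
      have n1: "norm (U t) \<le> N + T * B" "norm (Q t) \<le> N + T * B" if "t \<in> {0..T}" for t
        using norm_proj[of "u t"] norm_proj[of "p t"] un[OF that] pn[OF that] by (simp_all add: U_def Q_def)
      have kN: "k * W11_norm T f \<le> k * N" "k * W11_norm T g \<le> k * N"
        using H1_norm_bounds(4)[of E l u0] H1_norm_bounds(4)[of E l p0] W11_norm_nonneg[of T f] W11_norm_nonneg[of T g] k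
        by (auto intro!: mult_left_mono simp: N_def)
      have nc: "norm (coeff w x) \<le> C2 * m" if "norm x \<le> m" for w x m
        unfolding C2_def by (rule order_trans[OF norm_coeff mult_left_mono[OF that]]) (use C0 in simp)
      have nr: "norm (r t) \<le> k * N + C2 * B" for t
      proof -
        have "norm (r t) \<le> norm g0 + norm (prim G 0 t) + norm (coeff b (p' t))"
          unfolding r_def by (intro order_trans[OF norm_triangle_ineq4] add_mono norm_triangle_ineq) simp
        also have "norm (coeff b (p' t)) \<le> C2 * B"
          by (rule nc[OF B(2)])
        finally show ?thesis using norm_prim_le[OF G(2), of 0 t] fk(2) kN(2) by simp
      qed
      have nq: "norm (q t) \<le> k * N + C2 * B + C2 * (N + T * B)" if "t \<in> {0..T}" for t
      proof -
        have "norm (q t) \<le> norm f0 + norm (prim F 0 t) + norm (coeff c (u' t)) + norm (coeff a (u t))"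
          unfolding q_def by (intro order_trans[OF norm_triangle_ineq4] add_mono norm_triangle_ineq) simp_all
        also have "norm (coeff c (u' t)) \<le> C2 * B"
          by (rule nc[OF B(1)])
        also have "norm (coeff a (u t)) \<le> C2 * (N + T * B)"
          by (rule nc[OF un[OF that]])
        finally show ?thesis using norm_prim_le[OF F(2), of 0 t] fk(1) kN(1) by simp
      qed
      have "(SUP t\<in>{0..T}. norm (U t, Q t)) \<le> 2 * (N + T * B)"
        using n1 by (intro cSUP_least[OF T0] order_trans[OF norm_Pair_le]) (force intro: add_mono)
      moreover have "(SUP t\<in>{0..T}. norm (time_derivative T U t, time_derivative T Q t)) \<le> 2 * B"
      proof (rule cSUP_least[OF T0])
        fix t assume t: "t \<in> {0..T}"
        have "norm (proj (u' t)) \<le> B" "norm (proj (p' t)) \<le> B"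
          using norm_proj[of "u' t"] norm_proj[of "p' t"] B[of t] by linarith+
        then show "norm (time_derivative T U t, time_derivative T Q t) \<le> 2 * B"
          unfolding td[OF t] using norm_Pair_le[of "proj (u' t)" "proj (p' t)"] by linarith
      qed
      moreover have "(SUP t\<in>{0..T}. sqrt ((H1_norm E l (U t))\<^sup>2 + (H1_norm E l (Q t))\<^sup>2))
          \<le> 2 * (N + T * B) + 2 * (k * N) + 2 * (C2 * B) + C2 * (N + T * B)"
      proof (rule cSUP_least[OF T0])
        fix t assume t: "t \<in> {0..T}"
        then have t0: "0 \<le> t" by simp
        have "sqrt ((H1_norm E l (U t))\<^sup>2 + (H1_norm E l (Q t))\<^sup>2) \<le> H1_norm E l (U t) + H1_norm E l (Q t)"
          by (intro sqrt_sum_squares_le_sum H1_norm_bounds)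
        also have "\<dots> \<le> (norm (U t) + norm (r t)) + (norm (Q t) + norm (q t))"
          using H1_norm_bounds(3)[of E l "U t"] H1_norm_bounds(3)[of E l "Q t"]
          unfolding Ue(2)[OF t0] Qe(2)[OF t0] by (rule add_mono)
        also have "\<dots> \<le> ((N + T * B) + (k * N + C2 * B)) + ((N + T * B) + (k * N + C2 * B + C2 * (N + T * B)))"
          by (intro add_mono n1[OF t] nr nq[OF t])
        also have "\<dots> = 2 * (N + T * B) + 2 * (k * N) + 2 * (C2 * B) + C2 * (N + T * B)"
          by (simp add: algebra_simps)
        finally show "sqrt ((H1_norm E l (U t))\<^sup>2 + (H1_norm E l (Q t))\<^sup>2)
          \<le> 2 * (N + T * B) + 2 * (k * N) + 2 * (C2 * B) + C2 * (N + T * B)" .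
      qed
      ultimately have "solution_norm E l T U Q \<le> 2 * (N + T * B) + 2 * B +
          (2 * (N + T * B) + 2 * (k * N) + 2 * (C2 * B) + C2 * (N + T * B))"
        unfolding solution_norm_def by linarith
      also have "\<dots> = K' * N"
        by (simp add: K'_def B_def algebra_simps)
      finally show ?thesis .
    qed
    ultimately show "\<exists>u p. is_solution E l T a b c u0 p0 f g u p \<and>
      solution_norm E l T u p \<le> K' * (H1_norm E l u0 + H1_norm E l p0 + W11_norm T f + W11_norm T g)"
      unfolding N_def by blast
  qed
qed

end

theorem lemma3p2:
  fixes E :: "('v::finite \<times> 'v) set" and l :: "'v \<times> 'v \<Rightarrow> real"
    and a b c :: "'v network_fun" and C0 C1 T :: real
  assumes "\<forall>e\<in>E. fst e \<noteq> snd e"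
    and "weakly_connected E"
    and "boundary_vertices E \<noteq> {}"
    and "\<forall>e\<in>E. 0 < l e"
    and "0 < C0" and "0 < C1"
    and "a \<in> L2_network E l" and "bounded_between E l C0 C1 a"
    and "b \<in> L2_network E l" and "bounded_between E l C0 C1 b"
    and "c \<in> L2_network E l" and "bounded_between E l C0 C1 c"
    and "0 < T"
  shows "\<exists>K. \<forall>u0\<in>H_div E l. \<forall>p0\<in>H1_0 E l. \<forall>f\<in>W11_L2 E l T. \<forall>g\<in>W11_L2 E l T.
    \<exists>u p. is_solution E l T a b c u0 p0 f g u p \<and>
      (\<forall>v q. is_solution E l T a b c u0 p0 f g v q \<longrightarrow> (\<forall>t\<in>{0..T}. v t = u t \<and> q t = p t)) \<and>
      solution_norm E l T u p
        \<le> K * (H1_norm E l u0 + H1_norm E l p0 + W11_norm T f + W11_norm T g)"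
proof -
  interpret network_system E l a b c C0 C1
    by standard (use assms in blast)+
  obtain K where K: "\<forall>u0\<in>H_div E l. \<forall>p0\<in>H1_0 E l. \<forall>f\<in>W11_L2 E l T. \<forall>g\<in>W11_L2 E l T.
    \<exists>u p. is_solution E l T a b c u0 p0 f g u p \<and>
      solution_norm E l T u p \<le> K * (H1_norm E l u0 + H1_norm E l p0 + W11_norm T f + W11_norm T g)"
    using solution_exists[OF assms(13)] by (rule exE)
  show ?thesis
  proof (intro exI[of _ K] ballI)
    fix u0 p0 f g
    assume "u0 \<in> H_div E l" "p0 \<in> H1_0 E l" "f \<in> W11_L2 E l T" "g \<in> W11_L2 E l T"
    then obtain u p where sol: "is_solution E l T a b c u0 p0 f g u p"
      and "solution_norm E l T u p \<le> K * (H1_norm E l u0 + H1_norm E l p0 + W11_norm T f + W11_norm T g)"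
      using K by blast
    then show "\<exists>u p. is_solution E l T a b c u0 p0 f g u p \<and>
      (\<forall>v q. is_solution E l T a b c u0 p0 f g v q \<longrightarrow> (\<forall>t\<in>{0..T}. v t = u t \<and> q t = p t)) \<and>
      solution_norm E l T u p
        \<le> K * (H1_norm E l u0 + H1_norm E l p0 + W11_norm T f + W11_norm T g)"
      by (intro exI[of _ u] exI[of _ p] conjI allI impI ballI solution_unique[OF assms(13) sol, THEN conjunct1]
          solution_unique[OF assms(13) sol, THEN conjunct2])
  qed
qed

end
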